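(* Let $0<p<\infty$ and $A\in L^q(D,\mathbb{B})$ with $q>2$. Let $f=\varphi e^{\phi}\in H^p_{A,0}(D,\mathbb{B})$, where $\phi=T_{\mathbb{B}}(A)$ and $\varphi=p^+\varphi^++p^-\varphi^-\in Hol(D,\mathbb{B})$. Suppose that $\varphi^+\in H^p_w(D)$ for some $w\in L^\gamma(D)$, where either $\gamma>2$, or $1<\gamma\le 2$ and $p<\frac{\gamma}{2-\gamma}$ (with $\frac{\gamma}{2-\gamma}=\infty$ if $\gamma=2$). Then $f$ has a nontangential limit $f_{nt}\in L^p(\partial D,\mathbb{B})$, and $$\lim_{r\nearrow 1}\int_0^{2\pi}\|f_{nt}(e^{i\theta})-f(re^{i\theta})\|_{\mathbb{B}}^p\,d\theta=0.$$
   Context: $D$ is the open unit disk in $\mathbb{C}$, $\partial D$ the unit circle. For $u\in\mathbb{C}$, $u^*$ denotes the complex conjugate; $\frac{\partial}{\partial z}=\frac12(\partial_x-i\partial_y)$, $\frac{\partial}{\partial z^*}=\frac12(\partial_x+i\partial_y)$. $\mathbb{B}$ denotes the bicomplex numbers: the commutative $\mathbb{C}$-algebra of elements $z_1+jz_2$ with $z_1,z_2\in\mathbb{C}$, $j^2=-1$, $ij=ji$. Put $p^\pm=\frac12(1\pm ij)$ (idempotents with $p^+p^-=0$). Each $w=z_1+jz_2\in\mathbb{B}$ is uniquely $w=p^+w^++p^-w^-$ with $w^\pm=z_1\mp iz_2\in\mathbb{C}$; for functions, $f^\pm$ is defined pointwise. $\|w\|_{\mathbb{B}}=\sqrt{(|w^+|^2+|w^-|^2)/2}$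 and $e^w=p^+e^{w^+}+p^-e^{w^-}$. $L^q(D,\mathbb{B})$ and $L^p(\partial D,\mathbb{B})$ consist of $\mathbb{B}$-valued functions with $\|\cdot\|_{\mathbb{B}}^q$, resp. $\|\cdot\|_{\mathbb{B}}^p$, integrable; $L^\gamma(D)$ is the usual complex-valued Lebesgue space. $\bar\partial=\frac12(\partial_x+j\partial_y)=p^+\frac{\partial}{\partial z}+p^-\frac{\partial}{\partial z^*}$; derivatives are understood in the weak sense. $Hol(D,\mathbb{B})$ is the set of $f:D\to\mathbb{B}$ with $\bar\partial f=0$, equivalently with $(f^+)^*$ and $f^-$ ordinary holomorphic functions. $H^p_{A,0}(D,\mathbb{B})$ is the set of $f:D\to\mathbb{B}$ with $\bar\partial f=Af$ and $\sup_{0<r<1}\int_0^{2\pi}\|f(re^{i\theta})\|_{\mathbb{B}}^p\,d\theta<\infty$. For $w:D\to\mathbb{C}$, $H^p_w(D)$ is the set of $u:D\to\mathbb{C}$ with $\frac{\partial u}{\partial z^*}=w$ and $\sup_{0<r<1}\int_0^{2\pi}|u(re^{i\theta})|^p\,d\theta<\infty$. The bicomplex Theodorescu operator is $$T_{\mathbb{B}}(g)(z)=p^+\left(-\frac1\pi\iint_D\frac{g^+(\zeta)}{\zeta^*-z^*}\,d\xi\,d\eta\right)+p^-\left(-\frac1\pi\iint_D\frac{g^-(\zeta)}{\zeta-z}\,d\xi\,d\eta\right),\quad \zeta=\xi+i\eta.$$ It is known that every solution of $\bar\partial f=Af$ can be written $f=\varphi e^{T_{\mathbb{B}}(A)}$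 with $\varphi\in Hol(D,\mathbb{B})$; $f$ is identified with this continuous representative. A function on $D$ has nontangential limit $f_{nt}$ if for almost every $\theta$, $f(z)\to f_{nt}(e^{i\theta})$ as $z\to e^{i\theta}$ within every nontangential approach region (Stolz angle) at $e^{i\theta}$. *)

theory Defs
  imports "HOL-Analysis.Analysis"
begin

section \<open>Bicomplex numbers\<close>

text \<open>\<open>Bicomplex z1 z2\<close> is the bicomplex number \<open>z1 + j z2\<close>.\<close>

datatype bicomplex = Bicomplex (bc1: complex) (bc2: complex)

lemma bicomplex_eq_iff: "v = w \<longleftrightarrow> bc1 v = bc1 w \<and> bc2 v = bc2 w"
  by (cases v; cases w) auto

instantiation bicomplex :: comm_ring_1
begin

definition zero_bicomplex :: bicomplex where "0 = Bicomplex 0 0"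
definition one_bicomplex :: bicomplex where "1 = Bicomplex 1 0"
definition plus_bicomplex :: "bicomplex \<Rightarrow> bicomplex \<Rightarrow> bicomplex"
  where "v + w = Bicomplex (bc1 v + bc1 w) (bc2 v + bc2 w)"
definition minus_bicomplex :: "bicomplex \<Rightarrow> bicomplex \<Rightarrow> bicomplex"
  where "v - w = Bicomplex (bc1 v - bc1 w) (bc2 v - bc2 w)"
definition uminus_bicomplex :: "bicomplex \<Rightarrow> bicomplex"
  where "- w = Bicomplex (- bc1 w) (- bc2 w)"
definition times_bicomplex :: "bicomplex \<Rightarrow> bicomplex \<Rightarrow> bicomplex"
  where "v * w = Bicomplex (bc1 v * bc1 w - bc2 v * bc2 w) (bc1 v * bc2 w + bc2 v * bc1 w)"

instance
  by standard
    (auto simp: bicomplex_eq_iff zero_bicomplex_def one_bicomplex_def plus_bicomplex_def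
      minus_bicomplex_def uminus_bicomplex_def times_bicomplex_def algebra_simps)

end

definition bc_of_complex :: "complex \<Rightarrow> bicomplex"
  where "bc_of_complex z = Bicomplex z 0"

definition bc_j :: bicomplex
  where "bc_j = Bicomplex 0 1"

definition p_plus :: bicomplex
  where "p_plus = bc_of_complex (1/2) * (1 + bc_of_complex \<i> * bc_j)"

definition p_minus :: bicomplex
  where "p_minus = bc_of_complex (1/2) * (1 - bc_of_complex \<i> * bc_j)"

definition c_plus :: "bicomplex \<Rightarrow> complex"
  where "c_plus w = bc1 w - \<i> * bc2 w"

definition c_minus :: "bicomplex \<Rightarrow> complex"
  where "c_minus w = bc1 w + \<i> * bc2 w"

lemmas bicomplex_defs =
  zero_bicomplex_def one_bicomplex_def plus_bicomplex_def minus_bicomplex_def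
  uminus_bicomplex_def times_bicomplex_def bc_of_complex_def bc_j_def
  p_plus_def p_minus_def c_plus_def c_minus_def

lemma bicomplex_eq_bc: "w = bc_of_complex (bc1 w) + bc_j * bc_of_complex (bc2 w)"
  by (simp add: bicomplex_eq_iff bicomplex_defs)

lemma bc_j_squared: "bc_j * bc_j = -1"
  by (simp add: bicomplex_eq_iff bicomplex_defs)

lemma p_plus_p_minus:
  "p_plus * p_plus = p_plus" "p_minus * p_minus = p_minus" "p_plus * p_minus = 0"
  by (simp_all add: bicomplex_eq_iff bicomplex_defs field_simps)

lemma bicomplex_idempotent_decomp:
  "w = p_plus * bc_of_complex (c_plus w) + p_minus * bc_of_complex (c_minus w)"
  by (simp add: bicomplex_eq_iff bicomplex_defs field_simps)

lemma c_plus_idempotent [simp]: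
  "c_plus (p_plus * bc_of_complex a + p_minus * bc_of_complex b) = a"
  and c_minus_idempotent [simp]:
  "c_minus (p_plus * bc_of_complex a + p_minus * bc_of_complex b) = b"
  by (simp_all add: bicomplex_defs field_simps)

lemma c_plus_simps [simp]:
  "c_plus 0 = 0" "c_plus 1 = 1" "c_plus (v + w) = c_plus v + c_plus w"
  "c_plus (v - w) = c_plus v - c_plus w" "c_plus (- w) = - c_plus w"
  "c_plus (v * w) = c_plus v * c_plus w"
  by (simp_all add: bicomplex_defs algebra_simps)

lemma c_minus_simps [simp]:
  "c_minus 0 = 0" "c_minus 1 = 1" "c_minus (v + w) = c_minus v + c_minus w"
  "c_minus (v - w) = c_minus v - c_minus w" "c_minus (- w) = - c_minus w"
  "c_minus (v * w) = c_minus v * c_minus w"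
  by (simp_all add: bicomplex_defs algebra_simps)

lemma bicomplex_eqI: "c_plus v = c_plus w \<Longrightarrow> c_minus v = c_minus w \<Longrightarrow> v = w"
  by (metis bicomplex_idempotent_decomp)

text \<open>The norm is not submultiplicative for constant 1 (it is for \<open>sqrt 2\<close>), so the type is
  not made an instance of \<^class>\<open>real_normed_algebra\<close> and the generic \<open>exp\<close> is not available.\<close>

instantiation bicomplex :: real_normed_vector
begin

definition scaleR_bicomplex :: "real \<Rightarrow> bicomplex \<Rightarrow> bicomplex"
  where "r *\<^sub>R w = Bicomplex (r *\<^sub>R bc1 w) (r *\<^sub>R bc2 w)"
definition norm_bicomplex :: "bicomplex \<Rightarrow> real"
  where "norm w = sqrt (((cmod (c_plus w))\<^sup>2 + (cmod (c_minus w))\<^sup>2) / 2)"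
definition sgn_bicomplex :: "bicomplex \<Rightarrow> bicomplex"
  where "sgn (w::bicomplex) = inverse (norm w) *\<^sub>R w"
definition dist_bicomplex :: "bicomplex \<Rightarrow> bicomplex \<Rightarrow> real"
  where "dist (v::bicomplex) w = norm (v - w)"
definition uniformity_bicomplex :: "(bicomplex \<times> bicomplex) filter"
  where "uniformity = (INF e\<in>{0<..}. principal {(v::bicomplex, w). dist v w < e})"
definition open_bicomplex :: "bicomplex set \<Rightarrow> bool"
  where "open (U::bicomplex set) \<longleftrightarrow> (\<forall>x\<in>U. eventually (\<lambda>(x', y). x' = x \<longrightarrow> y \<in> U) uniformity)"

instance
proof
  fix r s :: real and v w :: bicomplex and U :: "bicomplex set"
  have norm_eq: "norm u = norm (c_plus u, c_minus u) / sqrt 2" for u :: bicomplex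
    by (simp add: norm_bicomplex_def norm_Pair real_sqrt_divide)
  have scale: "c_plus (a *\<^sub>R u) = a *\<^sub>R c_plus u" "c_minus (a *\<^sub>R u) = a *\<^sub>R c_minus u"
    for a :: real and u
    by (simp_all add: scaleR_bicomplex_def c_plus_def c_minus_def algebra_simps)
  show "r *\<^sub>R (v + w) = r *\<^sub>R v + r *\<^sub>R w" "(r + s) *\<^sub>R v = r *\<^sub>R v + s *\<^sub>R v"
    "r *\<^sub>R s *\<^sub>R v = (r * s) *\<^sub>R v" "1 *\<^sub>R v = v"
    by (simp_all add: bicomplex_eq_iff scaleR_bicomplex_def plus_bicomplex_def algebra_simps)
  show "norm v = 0 \<longleftrightarrow> v = 0"
    by (auto simp: norm_eq zero_prod_def intro: bicomplex_eqI)
  have "norm (c_plus (v + w), c_minus (v + w)) \<le>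
        norm (c_plus v, c_minus v) + norm (c_plus w, c_minus w)"
    using norm_triangle_ineq[of "(c_plus v, c_minus v)" "(c_plus w, c_minus w)"] by simp
  then show "norm (v + w) \<le> norm v + norm w"
    by (simp add: norm_eq field_simps)
  have "norm (c_plus (r *\<^sub>R v), c_minus (r *\<^sub>R v)) = \<bar>r\<bar> * norm (c_plus v, c_minus v)"
    using norm_scaleR[of r "(c_plus v, c_minus v)"] by (simp add: scale)
  then show "norm (r *\<^sub>R v) = \<bar>r\<bar> * norm v"
    by (simp add: norm_eq)
qed (simp_all add: sgn_bicomplex_def dist_bicomplex_def uniformity_bicomplex_def
       open_bicomplex_def)

end

definition bc_exp :: "bicomplex \<Rightarrow> bicomplex"
  where "bc_exp w = p_plus * bc_of_complex (exp (c_plus w)) + p_minus * bc_of_complex (exp (c_minus w))"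


section \<open>Weak derivatives on the unit disk\<close>

abbreviation disk :: "complex set"
  where "disk \<equiv> ball 0 1"

definition pd_x :: "(complex \<Rightarrow> complex) \<Rightarrow> complex \<Rightarrow> complex"
  where "pd_x f z = frechet_derivative f (at z) 1"

definition pd_y :: "(complex \<Rightarrow> complex) \<Rightarrow> complex \<Rightarrow> complex"
  where "pd_y f z = frechet_derivative f (at z) \<i>"

definition d_z :: "(complex \<Rightarrow> complex) \<Rightarrow> complex \<Rightarrow> complex"
  where "d_z f z = (pd_x f z - \<i> * pd_y f z) / 2"

definition d_zbar :: "(complex \<Rightarrow> complex) \<Rightarrow> complex \<Rightarrow> complex"
  where "d_zbar f z = (pd_x f z + \<i> * pd_y f z) / 2"

text \<open>\<open>C_diff k f\<close>: \<open>f\<close> is \<open>k\<close> times continuously differentiable in the real sense on the plane.\<close>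

primrec C_diff :: "nat \<Rightarrow> (complex \<Rightarrow> complex) \<Rightarrow> bool" where
  "C_diff 0 f \<longleftrightarrow> continuous_on UNIV f"
| "C_diff (Suc k) f \<longleftrightarrow> (\<forall>z. f differentiable (at z)) \<and> C_diff k (pd_x f) \<and> C_diff k (pd_y f)"

definition test_function :: "(complex \<Rightarrow> complex) \<Rightarrow> bool"
  where "test_function \<psi> \<longleftrightarrow> (\<forall>k. C_diff k \<psi>) \<and>
    compact (closure {z. \<psi> z \<noteq> 0}) \<and> closure {z. \<psi> z \<noteq> 0} \<subseteq> disk"

definition locally_integrable :: "(complex \<Rightarrow> complex) \<Rightarrow> bool"
  where "locally_integrable u \<longleftrightarrow> (\<forall>K. compact K \<and> K \<subseteq> disk \<longrightarrow> u absolutely_integrable_on K)"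

definition weak_d_z :: "(complex \<Rightarrow> complex) \<Rightarrow> (complex \<Rightarrow> complex) \<Rightarrow> bool"
  where "weak_d_z u g \<longleftrightarrow> locally_integrable u \<and> locally_integrable g \<and>
    (\<forall>\<psi>. test_function \<psi> \<longrightarrow>
      (LINT z|lebesgue_on disk. u z * d_z \<psi> z) = - (LINT z|lebesgue_on disk. g z * \<psi> z))"

definition weak_d_zbar :: "(complex \<Rightarrow> complex) \<Rightarrow> (complex \<Rightarrow> complex) \<Rightarrow> bool"
  where "weak_d_zbar u g \<longleftrightarrow> locally_integrable u \<and> locally_integrable g \<and>
    (\<forall>\<psi>. test_function \<psi> \<longrightarrow>
      (LINT z|lebesgue_on disk. u z * d_zbar \<psi> z) = - (LINT z|lebesgue_on disk. g z * \<psi> z))"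

text \<open>The bicomplex equation \<open>dbar f = g\<close>, where \<open>dbar = p_plus d_z + p_minus d_zbar\<close>
  and products are computed componentwise in the idempotent decomposition.\<close>

definition weak_dbar :: "(complex \<Rightarrow> bicomplex) \<Rightarrow> (complex \<Rightarrow> bicomplex) \<Rightarrow> bool"
  where "weak_dbar f g \<longleftrightarrow>
    weak_d_z (\<lambda>z. c_plus (f z)) (\<lambda>z. c_plus (g z)) \<and>
    weak_d_zbar (\<lambda>z. c_minus (f z)) (\<lambda>z. c_minus (g z))"


section \<open>Function spaces\<close>

definition Lp_space :: "'a measure \<Rightarrow> real \<Rightarrow> ('a \<Rightarrow> 'b::real_normed_vector) set"
  where "Lp_space M p = {f. f \<in> borel_measurable M \<and> integrable M (\<lambda>x. norm (f x) powr p)}"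

text \<open>Functions on the unit circle are given on the whole plane; only their values at the
  points \<open>cis \<theta>\<close> matter.\<close>

definition Lp_circle :: "real \<Rightarrow> (complex \<Rightarrow> bicomplex) set"
  where "Lp_circle p = {g. (\<lambda>\<theta>. g (cis \<theta>)) \<in> Lp_space (lebesgue_on {0..2*pi}) p}"

definition bounded_p_means :: "real \<Rightarrow> (complex \<Rightarrow> 'b::real_normed_vector) \<Rightarrow> bool"
  where "bounded_p_means p f \<longleftrightarrow>
    (SUP r\<in>{0<..<1}. \<integral>\<^sup>+\<theta>. ennreal (norm (f (of_real r * cis \<theta>)) powr p) \<partial>lebesgue_on {0..2*pi}) < \<infinity>"

text \<open>A weak solution of \<open>dbar f = 0\<close> is only determined almost everywhere;
  continuity selects its pointwise representative.\<close>

definition Hol_bc :: "(complex \<Rightarrow> bicomplex) set"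
  where "Hol_bc = {f. continuous_on disk f \<and> weak_dbar f (\<lambda>z. 0)}"

definition Hp_A :: "real \<Rightarrow> (complex \<Rightarrow> bicomplex) \<Rightarrow> (complex \<Rightarrow> bicomplex) set"
  where "Hp_A p A = {f. weak_dbar f (\<lambda>z. A z * f z) \<and> bounded_p_means p f}"

definition Hp_w :: "real \<Rightarrow> (complex \<Rightarrow> complex) \<Rightarrow> (complex \<Rightarrow> complex) set"
  where "Hp_w p w = {u. weak_d_zbar u w \<and> bounded_p_means p u}"

definition T_bc :: "(complex \<Rightarrow> bicomplex) \<Rightarrow> complex \<Rightarrow> bicomplex"
  where "T_bc g z =
    p_plus * bc_of_complex
      (- (1 / pi) * (LINT \<zeta>|lebesgue_on disk. c_plus (g \<zeta>) / (cnj \<zeta> - cnj z))) +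
    p_minus * bc_of_complex
      (- (1 / pi) * (LINT \<zeta>|lebesgue_on disk. c_minus (g \<zeta>) / (\<zeta> - z)))"


section \<open>Nontangential limits\<close>

definition stolz_region :: "real \<Rightarrow> complex \<Rightarrow> complex set"
  where "stolz_region \<alpha> \<zeta> = {z \<in> disk. cmod (z - \<zeta>) < \<alpha> * (1 - cmod z)}"

text \<open>For \<open>\<alpha> \<le> 1\<close> the region is empty.\<close>

definition has_nontangential_limit ::
    "(complex \<Rightarrow> 'b::real_normed_vector) \<Rightarrow> (complex \<Rightarrow> 'b) \<Rightarrow> bool"
  where "has_nontangential_limit f g \<longleftrightarrow>
    (AE \<theta> in lebesgue_on {0..2*pi}. \<forall>\<alpha>>1.
      (f \<longlongrightarrow> g (cis \<theta>)) (at (cis \<theta>) within stolz_region \<alpha> (cis \<theta>)))"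

end

theory Submission
  imports Defs "HOL-Complex_Analysis.Complex_Analysis"
begin

text \<open>
In the idempotent decomposition the equation \<open>f = \<phi> e\<^bsup>T A\<^esup>\<close> splits into two scalar equations. The
components of \<open>T A\<close> are Cauchy transforms (up to conjugation) of functions in \<open>L\<^sup>q\<close> with \<open>q > 2\<close>,
hence continuous on the whole plane (\<open>cauchy_transform_continuous\<close>), so the exponential factors
are continuous and bounded above and below on the closed disk. By the Weyl lemma
(\<open>weyl_lemma\<close>) the functions \<open>h\<^sub>1 = (\<phi>\<^sup>+)\<^sup>*\<close> and \<open>h\<^sub>2 = \<phi>\<^sup>-\<close> are holomorphic, and the bound on the
\<open>p\<close>-means of \<open>f\<close> passes to them: both belong to the classical Hardy space \<open>H\<^sup>p\<close> of the disk. What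
remains is the theory of boundary values in \<open>H\<^sup>p\<close> for all \<open>0 < p < \<infinity>\<close>.

It is reduced to \<open>H\<^sup>2\<close> by a factorization that avoids the zeros of \<open>h\<close> altogether. On a circle of
radius \<open>R < 1\<close> the function \<open>log (|h|\<^sup>p + 1)\<close> is continuous, and real parts of polynomials are
uniformly dense there by Stone-Weierstrass. This gives a polynomial \<open>Q\<close> for which \<open>exp Q\<close>
dominates \<open>h\<close> on the circle, hence inside by the maximum principle, while \<open>|exp Q|\<^sup>p\<close> is at most
\<open>2 (|h|\<^sup>p + 1)\<close> on the circle. As \<open>exp Q\<close> has no zeros, all its powers are at hand: with
\<open>G = exp (Q/m)\<close>, \<open>k = exp (p Q/2)\<close> and \<open>B = h / exp Q\<close> one has \<open>h = B G\<^sup>m\<close> and \<open>|h|\<^sup>p \<le> |k|\<^sup>2\<close>, and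
\<open>B\<close>, \<open>G\<close>, \<open>k\<close> have bounded square means as soon as \<open>2/m \<le> p\<close>. Montel's theorem lets \<open>R\<close> tend
to \<open>1\<close> (\<open>hardy_factorization\<close>).

For \<open>u\<close> in \<open>H\<^sup>2\<close>, Parseval's identity approximates \<open>u\<close> by its Taylor polynomials uniformly in all
square means. The Cauchy formula gives a Poisson majorant of \<open>|u|\<^sup>2\<close>, and the Vitali covering lemma
turns it into a weak-type bound for the maximal function over Stolz regions
(\<open>stolz_maximal_weak_type\<close>). Together they show that the oscillation of \<open>u\<close> at almost every boundary
point vanishes, so \<open>u\<close> has nontangential limits (\<open>hardy2_nontangential_limit\<close>), and Fatou's lemma
yields convergence in the mean square (\<open>hardy2_mean_convergence\<close>).

Consequently \<open>h = B G\<^sup>m\<close> has nontangential limits. Convergence in the \<open>p\<close>-th mean follows from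
dominated convergence: the \<open>p\<close>-th power of the error is at most a fixed integrable function, built
from the boundary values of \<open>k\<close>, plus an error built from the mean-square error of \<open>k\<close>, and the
latter tends to \<open>0\<close> (\<open>bicomplex_hardy_boundary_values\<close>).
\<close>

section \<open>Smooth bumps and the Weyl lemma\<close>

text \<open>The family contains the flat function \<open>exp (-1/t)\<close> and is closed under differentiation up to linear
combinations, which makes smoothness a matter of algebra.\<close>

definition flat_exp :: "nat \<Rightarrow> real \<Rightarrow> real"
  where "flat_exp n t = (if 0 < t then exp (- (1 / t)) / t ^ n else 0)"

lemma flat_exp_pos: "0 < t \<Longrightarrow> 0 < flat_exp n t"
  by (simp add: flat_exp_def)

lemma flat_exp_nonneg: "0 \<le> flat_exp n t"
  by (simp add: flat_exp_def)

text \<open>Since \<open>exp x \<ge> (x/m)\<^sup>m\<close>, the exponential beats \<open>t\<^sup>n\<close> with two powers to spare. This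
gives the derivative \<open>0\<close> at the origin.\<close>

lemma flat_exp_bound: "\<bar>flat_exp n t\<bar> \<le> real (n + 2) ^ (n + 2) * t\<^sup>2"
proof (cases "0 < t")
  case True
  define m where "m = n + 2"
  have m: "m > 0" by (simp add: m_def)
  have "1 / (real m * t) \<le> exp (1 / (real m * t))"
    using exp_ge_add_one_self[of "1 / (real m * t)"] by linarith
  then have "(1 / (real m * t)) ^ m \<le> exp (1 / (real m * t)) ^ m"
    using True m by (intro power_mono) auto
  also have "\<dots> = exp (1 / t)" using m by (simp flip: exp_of_nat_mult)
  finally have "1 / exp (1 / t) \<le> 1 / (1 / (real m * t)) ^ m"
    using True m by (intro divide_left_mono) auto
  then have "exp (- (1 / t)) \<le> (real m * t) ^ m"
    by (simp add: exp_minus inverse_eq_divide power_one_over)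
  then have "exp (- (1 / t)) / t ^ n \<le> (real m * t) ^ m / t ^ n"
    using True by (intro divide_right_mono) auto
  also have "\<dots> = real m ^ m * t\<^sup>2"
    using True by (simp add: m_def power_mult_distrib power_add power2_eq_square)
  finally show ?thesis using True by (simp add: flat_exp_def m_def)
qed (simp add: flat_exp_def)

lemma flat_exp_derivative:
  "(flat_exp n has_real_derivative (flat_exp (n + 2) t - real n * flat_exp (n + 1) t)) (at t)"
proof (cases t "0::real" rule: linorder_cases)
  case less
  have "((\<lambda>_. 0) has_real_derivative 0) (at t)" by simp
  then have "(flat_exp n has_real_derivative 0) (at t)"
    by (rule has_field_derivative_transform_within_open[of _ _ _ "{..<0}"])
      (use less in \<open>auto simp: flat_exp_def\<close>)
  then show ?thesis using less by (simp add: flat_exp_def)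
next
  case equal
  define K where "K = real (n + 2) ^ (n + 2)"
  have "(\<lambda>h. (flat_exp n (0 + h) - flat_exp n 0) / h) \<midarrow>0\<rightarrow> 0"
  proof (rule Lim_null_comparison[where g = "\<lambda>h. K * \<bar>h\<bar>"])
    show "\<forall>\<^sub>F h in at 0. norm ((flat_exp n (0 + h) - flat_exp n 0) / h) \<le> K * \<bar>h\<bar>"
    proof (intro always_eventually allI)
      fix h :: real
      show "norm ((flat_exp n (0 + h) - flat_exp n 0) / h) \<le> K * \<bar>h\<bar>"
      proof (cases "h = 0")
        case False
        have "\<bar>flat_exp n h\<bar> / \<bar>h\<bar> \<le> K * h\<^sup>2 / \<bar>h\<bar>"
          using flat_exp_bound[of n h] by (intro divide_right_mono) (auto simp: K_def)
        also have "\<dots> = K * \<bar>h\<bar>" using False by (simp add: power2_eq_square abs_if)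
        finally show ?thesis by (simp add: flat_exp_def)
      qed (simp add: flat_exp_def)
    qed
    show "(\<lambda>h. K * \<bar>h\<bar>) \<midarrow>0\<rightarrow> 0" by (auto intro!: tendsto_eq_intros)
  qed
  then show ?thesis using equal by (simp add: DERIV_def flat_exp_def)
next
  case greater
  have "((\<lambda>t. exp (- (1 / t)) / t ^ n) has_real_derivative (flat_exp (n + 2) t - real n * flat_exp (n + 1) t)) (at t)"
  proof -
    have "((\<lambda>t. exp (- (1 / t)) / t ^ n) has_real_derivative
        (exp (- (1 / t)) * (1 / t\<^sup>2) * t ^ n - exp (- (1 / t)) * (real n * t ^ (n - 1))) / (t ^ n * t ^ n)) (at t)"
      using greater by (auto intro!: derivative_eq_intros simp: power2_eq_square)
    also have "real n * t ^ (n - 1) = real n * t ^ n / t"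
      using greater by (cases n) auto
    also have "(exp (- (1 / t)) * (1 / t\<^sup>2) * t ^ n - exp (- (1 / t)) * (real n * t ^ n / t)) / (t ^ n * t ^ n)
        = flat_exp (n + 2) t - real n * flat_exp (n + 1) t"
      using greater by (simp add: flat_exp_def field_simps power_add power2_eq_square)
    finally show ?thesis .
  qed
  then show ?thesis
    by (rule has_field_derivative_transform_within_open[of _ _ _ "{0<..}"])
      (use greater in \<open>auto simp: flat_exp_def\<close>)
qed

lemma flat_exp_continuous: "continuous_on UNIV (flat_exp n)"
  by (metis DERIV_continuous continuous_at_imp_continuous_on flat_exp_derivative)

text \<open>The algebra generated by the functions \<open>flat_exp n (r - |z - a|\<^sup>2)\<close>, the coordinates and the constants.
All its members are differentiable and it is stable under both partial derivatives, so all of them are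
smooth; no explicit formulas for higher derivatives are needed.\<close>

inductive bump_algebra :: "complex \<Rightarrow> real \<Rightarrow> (complex \<Rightarrow> complex) \<Rightarrow> bool" for a r where
  flat: "bump_algebra a r (\<lambda>z. of_real (flat_exp n (r - (cmod (z - a))\<^sup>2)))"
| const: "bump_algebra a r (\<lambda>z. c)"
| Re: "bump_algebra a r (\<lambda>z. of_real (Re z))"
| Im: "bump_algebra a r (\<lambda>z. of_real (Im z))"
| add: "bump_algebra a r f \<Longrightarrow> bump_algebra a r g \<Longrightarrow> bump_algebra a r (\<lambda>z. f z + g z)"
| mult: "bump_algebra a r f \<Longrightarrow> bump_algebra a r g \<Longrightarrow> bump_algebra a r (\<lambda>z. f z * g z)"

lemma pd_eqI:
  assumes "\<And>z. (f has_derivative D z) (at z)"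
  shows "pd_x f = (\<lambda>z. D z 1)" "pd_y f = (\<lambda>z. D z \<i>)"
  using frechet_derivative_at[OF assms] by (auto simp: pd_x_def pd_y_def fun_eq_iff)

lemma flat_bump_derivative:
  "((\<lambda>z. flat_exp n (r - (cmod (z - a))\<^sup>2)) has_derivative
    (\<lambda>h. (flat_exp (n + 2) (r - (cmod (z - a))\<^sup>2) - real n * flat_exp (n + 1) (r - (cmod (z - a))\<^sup>2)) * (- 2 * ((z - a) \<bullet> h)))) (at z)"
proof -
  have "((\<lambda>z. r - (cmod (z - a))\<^sup>2) has_derivative (\<lambda>h. - 2 * ((z - a) \<bullet> h))) (at z)"
    unfolding power2_norm_eq_inner
    by (auto intro!: derivative_eq_intros simp: inner_commute)
  moreover have "(flat_exp n has_derivative (*) (flat_exp (n + 2) t - real n * flat_exp (n + 1) t)) (at t)" for t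
    using flat_exp_derivative unfolding has_field_derivative_def .
  ultimately show ?thesis
    using has_derivative_compose[of _ _ z UNIV "flat_exp n"] by blast
qed

lemma bump_algebra_closed:
  assumes "bump_algebra a r f"
  shows "(\<forall>z. f differentiable (at z)) \<and> bump_algebra a r (pd_x f) \<and> bump_algebra a r (pd_y f)"
  using assms
proof induction
  case (flat n)
  define G where "G z = flat_exp (n + 2) (r - (cmod (z - a))\<^sup>2) - real n * flat_exp (n + 1) (r - (cmod (z - a))\<^sup>2)" for z
  have D: "((\<lambda>z. complex_of_real (flat_exp n (r - (cmod (z - a))\<^sup>2))) has_derivative
     (\<lambda>h. of_real (G z * (- 2 * ((z - a) \<bullet> h))))) (at z)" for z
    unfolding G_def by (intro has_derivative_of_real flat_bump_derivative)
  have G: "bump_algebra a r (\<lambda>z. of_real (G z))"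
  proof -
    have "bump_algebra a r (\<lambda>z. of_real (flat_exp (n + 2) (r - (cmod (z - a))\<^sup>2)) + of_real (- real n) * of_real (flat_exp (n + 1) (r - (cmod (z - a))\<^sup>2)))"
      by (intro bump_algebra.intros)
    then show ?thesis by (simp add: G_def)
  qed
  have "bump_algebra a r (\<lambda>z. of_real (G z) * (of_real (- 2) * (of_real (Re z) + of_real (- Re a))))"
    "bump_algebra a r (\<lambda>z. of_real (G z) * (of_real (- 2) * (of_real (Im z) + of_real (- Im a))))"
    by (intro bump_algebra.intros G)+
  moreover have "(\<lambda>z. of_real (G z) * (of_real (- 2) * (of_real (Re z) + of_real (- Re a)))) = (\<lambda>z. complex_of_real (G z * (- 2 * ((z - a) \<bullet> 1))))"
    "(\<lambda>z. of_real (G z) * (of_real (- 2) * (of_real (Im z) + of_real (- Im a)))) = (\<lambda>z. complex_of_real (G z * (- 2 * ((z - a) \<bullet> \<i>))))"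
    by (auto simp: fun_eq_iff inner_complex_def algebra_simps)
  ultimately show ?case using D pd_eqI[OF D] by (auto simp: differentiable_def)
next
  case (const c)
  have D: "((\<lambda>z. c) has_derivative (\<lambda>h. 0)) (at z)" for z by simp
  show ?case unfolding pd_eqI[OF D] by (auto intro: bump_algebra.intros)
next
  case Re
  have D: "((\<lambda>z. complex_of_real (Re z)) has_derivative (\<lambda>h. of_real (Re h))) (at z)" for z
    by (intro has_derivative_of_real has_derivative_Re has_derivative_ident)
  show ?case unfolding pd_eqI[OF D] using D by (auto intro: bump_algebra.intros simp: differentiable_def)
next
  case Im
  have D: "((\<lambda>z. complex_of_real (Im z)) has_derivative (\<lambda>h. of_real (Im h))) (at z)" for z
    by (intro has_derivative_of_real has_derivative_Im has_derivative_ident)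
  show ?case unfolding pd_eqI[OF D] using D by (auto intro: bump_algebra.intros simp: differentiable_def)
next
  case (add f g)
  have D: "((\<lambda>z. f z + g z) has_derivative (\<lambda>h. frechet_derivative f (at z) h + frechet_derivative g (at z) h)) (at z)" for z
    using add.IH by (intro has_derivative_add) (auto simp: frechet_derivative_works)
  have "bump_algebra a r (\<lambda>z. pd_x f z + pd_x g z)" "bump_algebra a r (\<lambda>z. pd_y f z + pd_y g z)"
    using add.IH by (auto intro: bump_algebra.intros)
  then show ?case unfolding pd_eqI[OF D] using D by (auto simp: differentiable_def pd_x_def pd_y_def)
next
  case (mult f g)
  have D: "((\<lambda>z. f z * g z) has_derivative (\<lambda>h. f z * frechet_derivative g (at z) h + frechet_derivative f (at z) h * g z)) (at z)" for z
    using mult.IH by (intro has_derivative_mult) (auto simp: frechet_derivative_works)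
  have "bump_algebra a r (\<lambda>z. f z * pd_x g z + pd_x f z * g z)" "bump_algebra a r (\<lambda>z. f z * pd_y g z + pd_y f z * g z)"
    using mult by (auto intro!: bump_algebra.intros)
  then show ?case unfolding pd_eqI[OF D] using D by (auto simp: differentiable_def pd_x_def pd_y_def)
qed

lemma bump_algebra_smooth: "bump_algebra a r f \<Longrightarrow> C_diff k f"
proof (induction k arbitrary: f)
  case 0
  then have "\<And>z. f differentiable (at z)" using bump_algebra_closed by blast
  then show ?case
    by (simp add: continuous_at_imp_continuous_on differentiable_imp_continuous_within)
next
  case (Suc k)
  then show ?case using bump_algebra_closed by auto
qed

definition bump :: "complex \<Rightarrow> real \<Rightarrow> complex \<Rightarrow> real"
  where "bump a e z = flat_exp 0 (e\<^sup>2 - (cmod (z - a))\<^sup>2)"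

lemma bump_nonneg: "0 \<le> bump a e z"
  by (simp add: bump_def flat_exp_nonneg)

lemma bump_eq_0: "0 < e \<Longrightarrow> e \<le> cmod (z - a) \<Longrightarrow> bump a e z = 0"
  by (simp add: bump_def flat_exp_def not_less)

lemma bump_test_function:
  assumes "0 < e" "cball a e \<subseteq> disk"
  shows "test_function (\<lambda>z. of_real (bump a e z))"
proof -
  have "C_diff k (\<lambda>z. of_real (bump a e z))" for k
    unfolding bump_def by (rule bump_algebra_smooth[OF bump_algebra.flat])
  moreover have "{z. complex_of_real (bump a e z) \<noteq> 0} \<subseteq> cball a e"
    using bump_eq_0[OF assms(1)] by (force simp: dist_norm norm_minus_commute)
  then have sub: "closure {z. complex_of_real (bump a e z) \<noteq> 0} \<subseteq> cball a e"
    by (rule closure_minimal) simp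
  then have "compact (closure {z. complex_of_real (bump a e z) \<noteq> 0})"
    by (meson bounded_cball bounded_subset closed_closure compact_eq_bounded_closed)
  ultimately show ?thesis using sub assms(2) unfolding test_function_def by blast
qed

text \<open>As the bump is real, its two Wirtinger derivatives are conjugate to each other. Testing against bumps
therefore treats holomorphic and antiholomorphic functions alike.\<close>

lemma bump_d_zbar: "d_zbar (\<lambda>z. of_real (bump a e z)) z
    = - of_real (flat_exp 2 (e\<^sup>2 - (cmod (z - a))\<^sup>2)) * (z - a)"
  and bump_d_z: "d_z (\<lambda>z. of_real (bump a e z)) z
    = - of_real (flat_exp 2 (e\<^sup>2 - (cmod (z - a))\<^sup>2)) * cnj (z - a)"
proof -
  have D: "((\<lambda>z. complex_of_real (bump a e z)) has_derivative
     (\<lambda>h. of_real (flat_exp 2 (e\<^sup>2 - (cmod (z - a))\<^sup>2) * (- 2 * ((z - a) \<bullet> h))))) (at z)" for z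
    using has_derivative_of_real[OF flat_bump_derivative[of 0 "e\<^sup>2" a z], where 'a = complex]
    by (simp add: bump_def del: add_2_eq_Suc add_2_eq_Suc')
  show "d_zbar (\<lambda>z. of_real (bump a e z)) z = - of_real (flat_exp 2 (e\<^sup>2 - (cmod (z - a))\<^sup>2)) * (z - a)"
    "d_z (\<lambda>z. of_real (bump a e z)) z = - of_real (flat_exp 2 (e\<^sup>2 - (cmod (z - a))\<^sup>2)) * cnj (z - a)"
    unfolding d_zbar_def d_z_def pd_eqI[OF D] by (simp_all add: complex_eq_iff inner_complex_def field_simps)
qed

lemma bump_continuous: "continuous_on S (\<lambda>z. bump a e z)"
  unfolding bump_def
  by (rule continuous_on_compose2[OF flat_exp_continuous]) (auto intro!: continuous_intros)

lemma lebesgue_integral_supported: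
  fixes f :: "complex \<Rightarrow> 'b::euclidean_space"
  assumes S: "cbox a b \<subseteq> S" "S \<in> sets lebesgue"
    and zero: "\<And>z. z \<notin> cbox a b \<Longrightarrow> f z = 0" and f: "continuous_on (cbox a b) f"
  shows "(LINT z|lebesgue_on S. f z) = integral (cbox a b) f"
proof -
  have "(LINT z|lebesgue_on S. f z) = (LINT z|lebesgue. indicat_real S z *\<^sub>R f z)"
    by (rule integral_restrict_space) (use S in auto)
  also have "(\<lambda>z. indicat_real S z *\<^sub>R f z) = (\<lambda>z. indicat_real (cbox a b) z *\<^sub>R f z)"
    using S(1) zero by (auto simp: fun_eq_iff indicator_def)
  also have "(LINT z|lebesgue. indicat_real (cbox a b) z *\<^sub>R f z) = (LINT z|lebesgue_on (cbox a b). f z)"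
    by (rule integral_restrict_space[symmetric]) auto
  also have "\<dots> = integral (cbox a b) f"
    by (rule lebesgue_integral_eq_integral[OF continuous_imp_integrable[OF f]]) auto
  finally show ?thesis .
qed

text \<open>The mass of the bump does not depend on its centre, so normalizing a mollification by it keeps the
mollification holomorphic.\<close>

lemma bump_mass:
  assumes "0 < e" "cball z e \<subseteq> cbox a b"
  shows "integral (cbox a b) (bump z e) = (LINT y|lborel. bump 0 e y)"
    and "0 < (LINT y|lborel. bump 0 e y)"
proof -
  have cont: "continuous_on UNIV (bump z e)" for z using bump_continuous[of UNIV z e] by simp
  have zero: "bump z e y = 0" if "y \<notin> cbox a b" for y
    using bump_eq_0[OF assms(1), of y z] assms(2) that
    by (force simp: dist_norm norm_minus_commute)
  have "integral (cbox a b) (bump z e) = (LINT y|lebesgue_on UNIV. bump z e y)"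
    by (rule lebesgue_integral_supported[symmetric])
      (auto intro: zero continuous_on_subset[OF cont])
  also have "\<dots> = (LINT y|lborel. bump z e y)"
    by (simp add: lebesgue_on_UNIV_eq integral_completion borel_measurable_continuous_onI[OF cont])
  also have "\<dots> = (LINT y|distr lborel borel ((+) z). bump z e y)"
    by (simp add: lborel_distr_plus)
  also have "\<dots> = (LINT y|lborel. bump z e (z + y))"
    by (rule integral_distr) (auto intro: borel_measurable_continuous_onI[OF cont])
  also have "\<dots> = (LINT y|lborel. bump 0 e y)" by (simp add: bump_def)
  finally show eq: "integral (cbox a b) (bump z e) = (LINT y|lborel. bump 0 e y)" .
  have zin: "z \<in> ball z e" "ball z e \<subseteq> cbox a b" using assms by auto
  then have "z \<in> interior (cbox a b)" by (meson interiorI open_ball)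
  then have "box a b \<noteq> {}" by auto
  then have "integral (cbox a b) (bump z e) = 0 \<longleftrightarrow> (\<forall>x\<in>cbox a b. bump z e x = 0)"
    by (intro integral_cbox_eq_0_iff continuous_on_subset[OF cont] bump_nonneg) auto
  moreover have "bump z e z > 0" using assms(1) by (simp add: bump_def flat_exp_pos)
  ultimately have "integral (cbox a b) (bump z e) \<noteq> 0" using zin by (metis less_irrefl subsetD)
  moreover have "0 \<le> integral (cbox a b) (bump z e)"
    by (intro Henstock_Kurzweil_Integration.integral_nonneg integrable_continuous continuous_on_subset[OF cont] bump_nonneg) auto
  ultimately show "0 < (LINT y|lborel. bump 0 e y)" unfolding eq by linarith
qed

text \<open>Differentiating under the integral sign moves the derivative to the bump. There the derivative with
respect to the centre \<open>z\<close> is minus the derivative with respect to the integration variable, so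
orthogonality to the \<open>z\<^sup>*\<close>-derivatives of the bumps is the Cauchy-Riemann equation.\<close>

lemma mollification_holomorphic:
  assumes u: "continuous_on (cbox a b) u" and U: "open U" "convex U" and e: "0 < e"
    and orth: "\<And>z. z \<in> U \<Longrightarrow> integral (cbox a b) (\<lambda>y. u y * d_zbar (\<lambda>z'. of_real (bump z e z')) y) = 0"
  shows "(\<lambda>z. integral (cbox a b) (\<lambda>y. u y * of_real (bump z e y))) holomorphic_on U"
proof -
  define F where "F z y = flat_exp 2 (e\<^sup>2 - (cmod (z - y))\<^sup>2)" for z y
  \<comment> \<open>The Frechet derivative of the integrand in \<open>z\<close>, as a bounded linear map.\<close>
  define Df where "Df z y = (- 2 * F z y) *\<^sub>R (blinfun_scaleR_left (u y) o\<^sub>L blinfun_inner_right (z - y))" for z y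
  have Df_apply: "blinfun_apply (Df z y) h = u y * of_real (F z y * (- 2 * ((z - y) \<bullet> h)))" for z y h
    by (simp add: Df_def blinfun.scaleR_left blinfun.minus_left scaleR_conv_of_real)
  have Fc: "continuous_on (U \<times> cbox a b) (\<lambda>(z, y). F z y)"
    unfolding F_def split_beta
    by (rule continuous_on_compose2[OF flat_exp_continuous]) (auto intro!: continuous_intros)
  have uc: "continuous_on (U \<times> cbox a b) (\<lambda>x. u (snd x))"
    by (rule continuous_on_compose2[OF u]) (auto intro!: continuous_intros)
  have Dc: "continuous_on (U \<times> cbox a b) (\<lambda>(z, y). Df z y)"
    unfolding Df_def split_beta
    by (intro continuous_intros uc Fc[unfolded split_beta]
        bounded_linear.continuous_on[OF bounded_linear_blinfun_scaleR_left]
        bounded_linear.continuous_on[OF bounded_linear_blinfun_inner_right])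
  have "(\<lambda>z. integral (cbox a b) (\<lambda>y. u y * of_real (bump z e y))) field_differentiable (at z)" if z: "z \<in> U" for z
  proof -
    have sym: "bump z e y = flat_exp 0 (e\<^sup>2 - (cmod (z - y))\<^sup>2)" for z y
      by (simp add: bump_def norm_minus_commute)
    have "((\<lambda>z. integral (cbox a b) (\<lambda>y. u y * of_real (bump z e y))) has_derivative integral (cbox a b) (Df z)) (at z within U)"
    proof (rule leibniz_rule[OF _ _ Dc z U(2)])
      fix x t assume "x \<in> U" "t \<in> cbox a b"
      have "((\<lambda>x. u t * of_real (bump x e t)) has_derivative (\<lambda>h. u t * of_real (F x t * (- 2 * ((x - t) \<bullet> h))))) (at x)"
        using has_derivative_mult_right[OF has_derivative_of_real[OF flat_bump_derivative[of 0 "e\<^sup>2" t x], where 'a = complex], of "u t"]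
        by (simp add: sym F_def del: add_2_eq_Suc add_2_eq_Suc')
      then show "((\<lambda>x. u t * of_real (bump x e t)) has_derivative blinfun_apply (Df x t)) (at x within U)"
        unfolding Df_apply by (rule has_derivative_at_withinI)
    next
      fix x
      show "(\<lambda>y. u y * of_real (bump x e y)) integrable_on cbox a b"
        by (intro integrable_continuous continuous_intros u bump_continuous)
    qed
    then have der: "((\<lambda>z. integral (cbox a b) (\<lambda>y. u y * of_real (bump z e y))) has_derivative integral (cbox a b) (Df z)) (at z)"
      by (simp only: at_within_open[OF z U(1)])
    define L where "L = integral (cbox a b) (Df z)"
    have cint: "continuous_on (cbox a b) (\<lambda>y. F z y)"
      unfolding F_def by (rule continuous_on_compose2[OF flat_exp_continuous]) (auto intro!: continuous_intros)
    have "continuous_on (cbox a b) (Df z)"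
      unfolding Df_def
      by (intro continuous_intros u cint bounded_linear.continuous_on[OF bounded_linear_blinfun_scaleR_left]
          bounded_linear.continuous_on[OF bounded_linear_blinfun_inner_right])
    then have L: "blinfun_apply L h = integral (cbox a b) (\<lambda>y. u y * of_real (F z y * (- 2 * ((z - y) \<bullet> h))))" for h
      unfolding L_def by (subst blinfun_apply_integral) (auto simp: Df_apply integrable_continuous)
    have int: "(\<lambda>y. u y * of_real (F z y * (- 2 * ((z - y) \<bullet> h)))) integrable_on cbox a b" for h
      by (intro integrable_continuous continuous_intros u cint)
    have "blinfun_apply L 1 + \<i> * blinfun_apply L \<i>
      = integral (cbox a b) (\<lambda>y. u y * of_real (F z y * (- 2 * ((z - y) \<bullet> 1))) + \<i> * (u y * of_real (F z y * (- 2 * ((z - y) \<bullet> \<i>)))))"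
      unfolding L integral_mult_right[symmetric]
      by (rule integral_add[symmetric, OF int integrable_on_mult_right[OF int]])
    also have "\<dots> = integral (cbox a b) (\<lambda>y. (- 2) * (u y * d_zbar (\<lambda>z'. of_real (bump z e z')) y))"
    proof (intro integral_cong)
      fix y
      have "of_real (F z y * (- 2 * ((z - y) \<bullet> 1))) + \<i> * of_real (F z y * (- 2 * ((z - y) \<bullet> \<i>)))
        = (- 2) * d_zbar (\<lambda>z'. of_real (bump z e z')) y"
        unfolding bump_d_zbar F_def
        by (simp add: complex_eq_iff inner_complex_def norm_minus_commute[of z] algebra_simps)
      then show "u y * of_real (F z y * (- 2 * ((z - y) \<bullet> 1))) + \<i> * (u y * of_real (F z y * (- 2 * ((z - y) \<bullet> \<i>))))
        = (- 2) * (u y * d_zbar (\<lambda>z'. of_real (bump z e z')) y)"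
        by (metis (no_types, lifting) distrib_left mult.left_commute)
    qed
    also have "\<dots> = 0" using orth[OF z] by simp
    finally have CR: "blinfun_apply L \<i> = \<i> * blinfun_apply L 1"
      by (simp add: add_eq_0_iff complex_eq_iff)
    have complex_linear: "blinfun_apply L h = h * blinfun_apply L 1" for h
    proof -
      have "h = Re h *\<^sub>R 1 + Im h *\<^sub>R \<i>" by (simp add: complex_eq_iff)
      then have "blinfun_apply L h = Re h *\<^sub>R blinfun_apply L 1 + Im h *\<^sub>R blinfun_apply L \<i>"
        by (metis blinfun.add_right blinfun.scaleR_right)
      also have "\<dots> = h * blinfun_apply L 1" unfolding CR by (simp add: complex_eq_iff)
      finally show ?thesis .
    qed
    have "blinfun_apply L = (*) (blinfun_apply L 1)"
    proof
      show "blinfun_apply L h = blinfun_apply L 1 * h" for h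
        by (subst mult.commute) (rule complex_linear)
    qed
    with der have "((\<lambda>z. integral (cbox a b) (\<lambda>y. u y * of_real (bump z e y))) has_derivative (*) (blinfun_apply L 1)) (at z)"
      unfolding L_def by (rule back_subst[of "\<lambda>D. (_ has_derivative D) (at z)"])
    then show ?thesis
      unfolding field_differentiable_def has_field_derivative_def by (rule exI)
  qed
  then show ?thesis using U(1) by (simp add: holomorphic_on_open field_differentiable_def)
qed

text \<open>Locally \<open>u\<close> is the uniform limit of its mollifications, which are holomorphic.\<close>

theorem weyl_lemma:
  assumes u: "continuous_on disk u"
    and weak: "\<And>a e. 0 < e \<Longrightarrow> cball a e \<subseteq> disk \<Longrightarrow>
      (LINT z|lebesgue_on disk. u z * d_zbar (\<lambda>z. of_real (bump a e z)) z) = 0"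
  shows "u holomorphic_on disk"
proof -
  have "\<exists>d>0. u holomorphic_on ball z0 d" if z0: "z0 \<in> disk" for z0
  proof -
    define d where "d = (1 - cmod z0) / 4"
    have d: "d > 0" using z0 by (simp add: d_def)
    define a b where "a = z0 - Complex (2*d) (2*d)" and "b = z0 + Complex (2*d) (2*d)"
    have box: "cball z (d/2) \<subseteq> cbox a b" if "z \<in> ball z0 d" for z
    proof
      fix y assume "y \<in> cball z (d/2)"
      then have "cmod (y - z0) \<le> 2 * d"
        using that norm_triangle_ineq[of "y - z" "z - z0"] d by (auto simp: dist_norm norm_minus_commute)
      then have "\<bar>Re (y - z0)\<bar> \<le> 2 * d" "\<bar>Im (y - z0)\<bar> \<le> 2 * d"
        by (meson abs_Re_le_cmod abs_Im_le_cmod order_trans)+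
      then show "y \<in> cbox a b" by (auto simp: a_def b_def in_cbox_complex_iff abs_le_iff)
    qed
    have box_disk: "cbox a b \<subseteq> disk"
    proof
      fix y assume "y \<in> cbox a b"
      then have "\<bar>Re (y - z0)\<bar> \<le> 2 * d" "\<bar>Im (y - z0)\<bar> \<le> 2 * d"
        by (auto simp: a_def b_def in_cbox_complex_iff abs_le_iff)
      then have "(Re (y - z0))\<^sup>2 \<le> (2*d)\<^sup>2" "(Im (y - z0))\<^sup>2 \<le> (2*d)\<^sup>2"
        using d by (metis abs_ge_zero order_trans power2_le_iff_abs_le)+
      then have "(cmod (y - z0))\<^sup>2 \<le> (2*d)\<^sup>2 + (2*d)\<^sup>2"
        unfolding cmod_power2 by (rule add_mono)
      also have "\<dots> < (4*d)\<^sup>2" using d by (simp add: power2_eq_square)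
      finally have "(cmod (y - z0))\<^sup>2 < (4*d)\<^sup>2" .
      then have "cmod (y - z0) < 4 * d" by (rule power2_less_imp_less) (use d in simp)
      then show "y \<in> disk" using norm_triangle_sub[of y z0] by (simp add: d_def)
    qed
    have uc: "continuous_on (cbox a b) u" using u box_disk by (rule continuous_on_subset)
    define e where "e n = d / 2 * inverse (real (Suc n))" for n
    have e: "0 < e n" "e n \<le> d / 2" for n using d by (auto simp: e_def field_simps)
    have e0: "e \<longlonglongrightarrow> 0" unfolding e_def using tendsto_mult_right_zero[OF LIMSEQ_inverse_real_of_nat, of "d/2"] .
    have be: "cball z (e n) \<subseteq> cbox a b" if "z \<in> ball z0 d" for z n
      using box[OF that] e(2)[of n] by (meson cball_subset_cball_iff order_trans subset_cball)
    define c where "c n = (LINT y|lborel. bump (0::complex) (e n) y)" for n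
    have c: "integral (cbox a b) (bump z (e n)) = c n" "c n > 0" if "z \<in> ball z0 d" for z n
      unfolding c_def using bump_mass[OF e(1) be[OF that]] by auto
    have cpos: "c n > 0" for n using c(2)[of z0 n] d by simp
    define f where "f n z = integral (cbox a b) (\<lambda>y. u y * of_real (bump z (e n) y)) / of_real (c n)" for n z
    have fhol: "f n holomorphic_on ball z0 d" for n
      unfolding f_def
    proof (intro holomorphic_intros mollification_holomorphic uc e)
      fix z assume z: "z \<in> ball z0 d"
      have "integral (cbox a b) (\<lambda>y. u y * d_zbar (\<lambda>z'. of_real (bump z (e n) z')) y)
        = (LINT y|lebesgue_on disk. u y * d_zbar (\<lambda>z'. of_real (bump z (e n) z')) y)"
      proof (rule lebesgue_integral_supported[symmetric, OF box_disk])
        show "continuous_on (cbox a b) (\<lambda>y. u y * d_zbar (\<lambda>z'. of_real (bump z (e n) z')) y)"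
          unfolding bump_d_zbar
          by (intro continuous_intros uc continuous_on_compose2[OF flat_exp_continuous]) auto
        fix y assume "y \<notin> cbox a b"
        then have "y \<notin> cball z (e n)" using be[OF z] by blast
        then have "e n \<le> cmod (y - z)" by (simp add: dist_norm norm_minus_commute)
        then have "(e n)\<^sup>2 \<le> (cmod (y - z))\<^sup>2" using e(1)[of n] by (intro power_mono) auto
        then show "u y * d_zbar (\<lambda>z'. of_real (bump z (e n) z')) y = 0"
          unfolding bump_d_zbar flat_exp_def by (simp add: not_less)
      qed auto
      also have "\<dots> = 0" by (rule weak[OF e(1)]) (use be[OF z] box_disk in blast)
      finally show "integral (cbox a b) (\<lambda>y. u y * d_zbar (\<lambda>z'. of_real (bump z (e n) z')) y) = 0" .
    qed (use cpos in \<open>auto simp: less_imp_neq[symmetric]\<close>)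
    have unif: "uniform_limit (ball z0 d) f u sequentially"
      unfolding uniform_limit_iff
    proof (intro allI impI)
      fix \<epsilon> :: real assume \<epsilon>: "0 < \<epsilon>"
      have "uniformly_continuous_on (cbox a b) u" by (rule compact_uniformly_continuous[OF uc]) simp
      then obtain \<delta> where \<delta>: "\<delta> > 0" "\<And>x y. x \<in> cbox a b \<Longrightarrow> y \<in> cbox a b \<Longrightarrow> dist y x < \<delta> \<Longrightarrow> dist (u y) (u x) < \<epsilon> / 2"
        using \<epsilon> unfolding uniformly_continuous_on_def by (metis half_gt_zero)
      have "\<forall>\<^sub>F n in sequentially. e n < \<delta>" using order_tendstoD(2)[OF e0 \<delta>(1)] .
      then show "\<forall>\<^sub>F n in sequentially. \<forall>z\<in>ball z0 d. dist (f n z) (u z) < \<epsilon>"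
      proof eventually_elim
        case (elim n)
        show ?case
        proof
          fix z assume z: "z \<in> ball z0 d"
          have zb: "z \<in> cbox a b" using be[OF z, of n] e(1)[of n] by auto
          have bc: "continuous_on (cbox a b) (bump z (e n))" using bump_continuous[of "cbox a b" z "e n"] by simp
          have bcc: "continuous_on (cbox a b) (\<lambda>y. complex_of_real (bump z (e n) y))"
            by (intro continuous_intros bc)
          have diff_eq: "f n z - u z = integral (cbox a b) (\<lambda>y. (u y - u z) * of_real (bump z (e n) y)) / of_real (c n)"
          proof -
            have "integral (cbox a b) (\<lambda>y. (u y - u z) * of_real (bump z (e n) y))
              = integral (cbox a b) (\<lambda>y. u y * of_real (bump z (e n) y)) - integral (cbox a b) (\<lambda>y. u z * of_real (bump z (e n) y))"
              unfolding left_diff_distrib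
              by (intro integral_diff integrable_continuous continuous_intros uc bcc)
            also have "integral (cbox a b) (\<lambda>y. u z * of_real (bump z (e n) y)) = u z * of_real (c n)"
              using integral_linear[OF integrable_continuous[OF bc] bounded_linear_of_real[where 'a = complex]] c(1)[OF z, of n]
              by (simp add: o_def)
            finally show ?thesis using cpos[of n] by (simp add: f_def diff_divide_distrib)
          qed
          have diff_le: "cmod (integral (cbox a b) (\<lambda>y. (u y - u z) * of_real (bump z (e n) y)))
            \<le> integral (cbox a b) (\<lambda>y. \<epsilon> / 2 * bump z (e n) y)"
          proof (rule Henstock_Kurzweil_Integration.integral_norm_bound_integral)
            show "(\<lambda>y. (u y - u z) * of_real (bump z (e n) y)) integrable_on cbox a b"
              "(\<lambda>y. \<epsilon> / 2 * bump z (e n) y) integrable_on cbox a b"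
              by (intro integrable_continuous continuous_intros uc bcc bc)+
            fix y assume y: "y \<in> cbox a b"
            show "cmod ((u y - u z) * of_real (bump z (e n) y)) \<le> \<epsilon> / 2 * bump z (e n) y"
            proof (cases "e n \<le> cmod (y - z)")
              case True
              then show ?thesis using bump_eq_0[OF e(1)] by simp
            next
              case False
              then have "dist (u y) (u z) < \<epsilon> / 2" using elim y zb by (intro \<delta>(2)) (auto simp: dist_norm)
              then have "cmod (u y - u z) * bump z (e n) y \<le> \<epsilon> / 2 * bump z (e n) y"
                by (intro mult_right_mono bump_nonneg) (simp add: dist_norm)
              then show ?thesis using bump_nonneg[of z "e n" y] by (simp add: norm_mult)
            qed
          qed
          have mass: "integral (cbox a b) (\<lambda>y. \<epsilon> / 2 * bump z (e n) y) = \<epsilon> / 2 * c n"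
            unfolding integral_mult_right c(1)[OF z, of n] ..
          have "cmod (f n z - u z) = cmod (integral (cbox a b) (\<lambda>y. (u y - u z) * of_real (bump z (e n) y))) / c n"
            unfolding diff_eq using cpos[of n] by (simp add: norm_divide)
          also have "\<dots> \<le> (\<epsilon> / 2 * c n) / c n"
            using diff_le cpos[of n] unfolding mass by (intro divide_right_mono) auto
          finally have "cmod (f n z - u z) \<le> (\<epsilon> / 2 * c n) / c n" .
          then show "dist (f n z) (u z) < \<epsilon>" using cpos[of n] \<epsilon> by (simp add: dist_norm)
        qed
      qed
    qed
    have "u holomorphic_on ball z0 d"
    proof (rule holomorphic_uniform_sequence[OF open_ball fhol])
      fix x assume "x \<in> ball z0 d"
      then obtain r where "r > 0" "cball x r \<subseteq> ball z0 d"
        using open_contains_cball[of "ball z0 d"] by (meson open_ball)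
      then show "\<exists>r>0. cball x r \<subseteq> ball z0 d \<and> uniform_limit (cball x r) f u sequentially"
        using uniform_limit_on_subset[OF unif] by blast
    qed
    then show ?thesis using d by blast
  qed
  then have "u analytic_on disk" unfolding analytic_on_def by blast
  then show ?thesis by (rule analytic_imp_holomorphic)
qed

section \<open>The Cauchy transform of functions in \<open>L\<^sup>q\<close>\<close>

text \<open>Up to a constant, \<open>|y - z|\<^bsup>-s\<^esup>\<close> is bounded by a sum of multiples of indicators of the disks of radius
\<open>2\<^bsup>-n\<^esup>\<close>. Their areas decay like \<open>4\<^bsup>-n\<^esup>\<close> and the kernel grows like \<open>2\<^bsup>ns\<^esup>\<close>, so the sum is geometric for \<open>s < 2\<close>.\<close>

lemma riesz_kernel_mass_bounded:
  fixes s :: real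
  assumes "s < 2" "0 \<le> s"
  shows "\<exists>K\<ge>0. \<forall>z::complex. (\<integral>\<^sup>+y. ennreal (cmod (y - z) powr (-s)) * indicator (ball z 1) y \<partial>lborel) \<le> ennreal K"
proof -
  define V where "V = unit_ball_vol (real DIM(complex))"
  define c where "c n = 2 powr (real (Suc n) * s)" for n :: nat
  define \<rho> where "\<rho> = 2 powr (s - 2)"
  have \<rho>: "0 < \<rho>" "\<rho> < 1" using assms by (auto simp: \<rho>_def powr_less_one)
  have V: "V \<ge> 0" by (simp add: V_def)
  have summand: "c n * (V * ((1/2) ^ n)\<^sup>2) = V * 2 powr s * \<rho> ^ n" for n
  proof -
    have "((1/2::real) ^ n)\<^sup>2 = 2 powr (- 2 * real n)"
    proof -
      have "((1/2::real) ^ n) = 2 powr (- real n)" by (simp add: powr_minus powr_realpow power_one_over inverse_eq_divide)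
      then show ?thesis by (simp add: power2_eq_square flip: powr_add)
    qed
    moreover have "\<rho> ^ n = 2 powr ((s - 2) * real n)"
      by (simp add: \<rho>_def powr_powr flip: powr_realpow)
    ultimately show ?thesis by (simp add: c_def algebra_simps flip: powr_add)
  qed
  have geom: "(\<Sum>n. ennreal (V * 2 powr s * \<rho> ^ n)) = ennreal (V * 2 powr s * (1 / (1 - \<rho>)))"
    using \<rho> V by (intro suminf_ennreal_eq sums_mult geometric_sums) auto
  have "(\<integral>\<^sup>+y. ennreal (cmod (y - z) powr (-s)) * indicator (ball z 1) y \<partial>lborel) \<le> ennreal (V * 2 powr s * (1 / (1 - \<rho>)))"
    for z :: complex
  proof -
    have [measurable]: "cball z ((1/2) ^ n) \<in> sets borel" for n by simp
    have pt: "ennreal (cmod (y - z) powr (-s)) * indicator (ball z 1) y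
      \<le> (\<Sum>n. ennreal (c n) * indicator (cball z ((1/2) ^ n)) y)" for y
    proof (cases "y \<in> ball z 1 \<and> y \<noteq> z")
      case False
      then show ?thesis by (cases "y = z") auto
    next
      case True
      define t where "t = cmod (y - z)"
      have t: "0 < t" "t < 1" using True by (auto simp: t_def dist_norm norm_minus_commute)
      obtain n0 where "(1/2) ^ n0 < t" using real_arch_pow_inv[of t "1/2"] t by auto
      then have ex: "(1/2) ^ Suc n0 < t" using t by (simp add: field_simps)
      define n where "n = (LEAST n. (1/2) ^ Suc n < t)"
      have n1: "(1/2) ^ Suc n < t" unfolding n_def by (rule LeastI[of _ n0]) (rule ex)
      have n2: "t \<le> (1/2) ^ n"
      proof (cases n)
        case 0 then show ?thesis using t by simp
      next
        case (Suc k)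
        then have "\<not> (1/2) ^ Suc k < t" unfolding n_def using not_less_Least by (metis lessI)
        then show ?thesis using Suc by simp
      qed
      have "t powr (-s) \<le> ((1/2) ^ Suc n) powr (-s)"
        using n1 assms(2) by (intro powr_mono2') auto
      also have "\<dots> = c n"
      proof -
        have "((1/2::real) ^ Suc n) = 2 powr (- real (Suc n))"
          by (simp only: powr_minus powr_realpow zero_less_numeral power_one_over inverse_eq_divide)
        then have "((1/2::real) ^ Suc n) powr (-s) = 2 powr (- real (Suc n) * - s)" by (simp only: powr_powr)
        then show ?thesis by (simp only: c_def minus_mult_minus)
      qed
      finally have "ennreal (t powr (-s)) \<le> ennreal (c n)" by (rule ennreal_leI)
      then have "ennreal (cmod (y - z) powr (-s)) * indicator (ball z 1) y \<le> ennreal (c n) * indicator (cball z ((1/2) ^ n)) y"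
        using True n2 by (simp add: t_def indicator_def dist_norm norm_minus_commute)
      also have "\<dots> \<le> (\<Sum>k. ennreal (c k) * indicator (cball z ((1/2) ^ k)) y)"
      proof -
        define F where "F k = ennreal (c k) * indicator (cball z ((1/2) ^ k)) y" for k
        have "(\<Sum>k\<in>{n}. F k) \<le> (\<Sum>k. F k)" by (rule sum_le_suminf) auto
        then have "F n \<le> (\<Sum>k. F k)" by simp
        then show ?thesis unfolding F_def .
      qed
      finally show ?thesis .
    qed
    have "(\<integral>\<^sup>+y. ennreal (cmod (y - z) powr (-s)) * indicator (ball z 1) y \<partial>lborel)
      \<le> (\<integral>\<^sup>+y. (\<Sum>n. ennreal (c n) * indicator (cball z ((1/2) ^ n)) y) \<partial>lborel)"
      by (rule nn_integral_mono) (rule pt)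
    also have "\<dots> = (\<Sum>n. \<integral>\<^sup>+y. ennreal (c n) * indicator (cball z ((1/2) ^ n)) y \<partial>lborel)"
      by (rule nn_integral_suminf) measurable
    also have "\<dots> = (\<Sum>n. ennreal (V * 2 powr s * \<rho> ^ n))"
    proof (rule suminf_cong)
      fix n
      have "(\<integral>\<^sup>+y. ennreal (c n) * indicator (cball z ((1/2) ^ n)) y \<partial>lborel) = ennreal (c n) * emeasure lborel (cball z ((1/2) ^ n))"
        by (rule nn_integral_cmult_indicator) auto
      also have "emeasure lborel (cball z ((1/2) ^ n)) = ennreal (V * ((1/2) ^ n)\<^sup>2)"
        by (subst emeasure_cball) (auto simp: V_def)
      also have "ennreal (c n) * \<dots> = ennreal (V * 2 powr s * \<rho> ^ n)"
        using V by (subst summand[symmetric]) (simp add: ennreal_mult c_def)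
      finally show "(\<integral>\<^sup>+y. ennreal (c n) * indicator (cball z ((1/2) ^ n)) y \<partial>lborel) = ennreal (V * 2 powr s * \<rho> ^ n)" .
    qed
    also have "\<dots> = ennreal (V * 2 powr s * (1 / (1 - \<rho>)))" by (rule geom)
    finally show ?thesis .
  qed
  moreover have "V * 2 powr s * (1 / (1 - \<rho>)) \<ge> 0" using V \<rho> by simp
  ultimately show ?thesis by blast
qed

text \<open>A substitute for the Hoelder inequality that produces the small factor \<open>t\<^sup>\<beta>\<close> at the same time. If
\<open>x \<le> t\<^bsup>-a\<^esup>\<close>, the kernel alone controls \<open>x/t\<close>; otherwise \<open>x = x\<^sup>q x\<^bsup>-(q-1)\<^esup>\<close> is at most \<open>x\<^sup>q t\<^bsup>a(q-1)\<^esup>\<close>.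
Both cases gain a positive power of \<open>t\<close> provided that \<open>1/(q-1) < a < 1\<close>, which is possible exactly
for \<open>q > 2\<close>.\<close>

lemma cauchy_kernel_split:
  assumes q: "(2::real) < q"
  obtains \<beta> s :: real where "0 < \<beta>" "0 \<le> s" "s < 2"
    "\<And>x t. 0 \<le> x \<Longrightarrow> 0 < t \<Longrightarrow> t \<le> 1 \<Longrightarrow> x / t \<le> t powr \<beta> * (t powr (-s) + x powr q)"
proof -
  \<comment> \<open>This is the arithmetic mean of the two bounds \<open>1/(q-1)\<close> and \<open>1\<close>.\<close>
  define a where "a = q / (2 * (q - 1))"
  have aq: "a * (q - 1) = q / 2" using q by (simp add: a_def field_simps)
  have a: "0 < a" "a < 1" using q by (auto simp: a_def)
  have a1: "1 < a * (q - 1)" using q aq by simp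
  define \<beta> where "\<beta> = min ((1 - a) / 2) (a * (q - 1) - 1)"
  define s where "s = 1 + a + \<beta>"
  have \<beta>: "0 < \<beta>" "\<beta> \<le> (1 - a) / 2" "\<beta> \<le> a * (q - 1) - 1"
    using a a1 min.cobounded1[of "(1 - a) / 2" "a * (q - 1) - 1"] min.cobounded2[of "(1 - a) / 2" "a * (q - 1) - 1"]
    unfolding \<beta>_def by (simp, blast, blast)
  have s: "0 \<le> s" "s < 2" using a \<beta> by (auto simp: s_def)
  have "x / t \<le> t powr \<beta> * (t powr (-s) + x powr q)" if x: "0 \<le> x" and t: "0 < t" "t \<le> 1" for x t
  proof (cases "x \<le> t powr (-a)")
    case True
    then have "x / t \<le> t powr (-a) / t" using t by (intro divide_right_mono) auto
    also have "\<dots> = t powr \<beta> * t powr (-s)"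
    proof -
      have "t powr (-a) / t = t powr (-a - 1)" using t by (simp add: powr_diff)
      also have "-a - 1 = \<beta> + -s" by (simp add: s_def)
      finally show ?thesis by (simp only: powr_add)
    qed
    also have "\<dots> \<le> t powr \<beta> * (t powr (-s) + x powr q)"
      by (intro mult_left_mono) auto
    finally show ?thesis .
  next
    case False
    then have xt: "t powr (-a) < x" by simp
    have "0 < t powr (-a)" using t by simp
    then have x0: "0 < x" using xt by linarith
    have "(t powr (-a)) powr (q - 1) \<le> x powr (q - 1)"
      using xt q by (intro powr_mono2) auto
    then have 1: "t powr (- (a * (q - 1))) \<le> x powr (q - 1)" by (simp add: powr_powr)
    have "x = x powr q * x powr (- (q - 1))" using x0 by (simp flip: powr_add)
    also have "x powr (- (q - 1)) = inverse (x powr (q - 1))" by (rule powr_minus)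
    also have "x powr q * inverse (x powr (q - 1)) \<le> x powr q * inverse (t powr (- (a * (q - 1))))"
      using 1 t by (intro mult_left_mono le_imp_inverse_le) auto
    also have "inverse (t powr (- (a * (q - 1)))) = t powr (a * (q - 1))" by (simp add: powr_minus)
    finally have "x / t \<le> x powr q * t powr (a * (q - 1)) / t" using t by (intro divide_right_mono) auto
    also have "\<dots> = x powr q * t powr (a * (q - 1) - 1)" using t by (simp add: powr_diff)
    also have "\<dots> \<le> x powr q * t powr \<beta>"
      using \<beta> t by (intro mult_left_mono powr_mono') auto
    also have "\<dots> \<le> t powr \<beta> * (t powr (-s) + x powr q)" by (simp add: algebra_simps)
    finally show ?thesis .
  qed
  then show ?thesis using that \<beta>(1) s by blast
qed

text \<open>The Cauchy kernel \<open>1/w\<close> for \<open>|w| \<ge> d\<close>, continued continuously through the singularity.\<close>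

definition cut_kernel :: "real \<Rightarrow> complex \<Rightarrow> complex"
  where "cut_kernel d w = cnj w / of_real ((max d (cmod w))\<^sup>2)"

lemma cut_kernel_bound:
  assumes "0 < d"
  shows "cmod (cut_kernel d w) \<le> 1 / d"
proof -
  have m: "0 < max d (cmod w)" using assms by auto
  have "cmod (cut_kernel d w) = cmod w / (max d (cmod w))\<^sup>2"
    by (simp add: cut_kernel_def norm_divide norm_power)
  also have "\<dots> \<le> max d (cmod w) / (max d (cmod w))\<^sup>2" by (intro divide_right_mono) auto
  also have "\<dots> = 1 / max d (cmod w)" using m by (simp add: power2_eq_square)
  also have "\<dots> \<le> 1 / d" using assms by (intro divide_left_mono) auto
  finally show ?thesis .
qed

lemma cut_kernel_continuous: "0 < d \<Longrightarrow> continuous_on UNIV (cut_kernel d)"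
  unfolding cut_kernel_def by (intro continuous_intros) (auto simp: max_def)

lemma cut_kernel_difference:
  assumes "0 < d"
  shows "cmod (1 / w - cut_kernel d w) \<le> (if cmod w < d then 1 / cmod w else 0)"
proof (cases "cmod w < d")
  case False
  then have "cut_kernel d w = 1 / w"
    using assms complex_norm_square[of w] by (auto simp: cut_kernel_def max_def field_simps power2_eq_square)
  then show ?thesis using False by simp
next
  case True
  show ?thesis
  proof (cases "w = 0")
    case True
    then show ?thesis by (simp add: cut_kernel_def)
  next
    case w: False
    have "1 / w - cut_kernel d w = (1 / w) * of_real (1 - (cmod w)\<^sup>2 / d\<^sup>2)"
      using True w complex_norm_square[of w] by (simp add: cut_kernel_def max_def field_simps)
    moreover have "(cmod w)\<^sup>2 \<le> d\<^sup>2" using True by (intro power_mono) auto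
    then have "(cmod w)\<^sup>2 / d\<^sup>2 \<le> 1" "0 \<le> (cmod w)\<^sup>2 / d\<^sup>2" using assms by (auto simp: divide_le_eq_1)
    then have "\<bar>1 - (cmod w)\<^sup>2 / d\<^sup>2\<bar> \<le> 1" by linarith
    ultimately show ?thesis using True w
      by (simp only: norm_mult norm_divide norm_one norm_of_real if_True mult_left_le[OF _ divide_nonneg_nonneg] norm_ge_zero zero_le_one)
  qed
qed

text \<open>The transforms with truncated kernel are continuous by dominated convergence. They converge uniformly
to the Cauchy transform, because the two kernels differ only on a disk of radius \<open>d\<close>, where the
integrand has mass \<open>O(d\<^sup>\<beta>)\<close>, uniformly in the centre.\<close>

theorem cauchy_transform_continuous:
  fixes g :: "complex \<Rightarrow> complex"
  assumes q: "2 < q" and g: "g \<in> Lp_space (lebesgue_on disk) q"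
  shows "continuous_on UNIV (\<lambda>z. LINT y|lebesgue_on disk. g y / (y - z))"
proof -
  define M where "M = lebesgue_on disk"
  have gm: "g \<in> borel_measurable M" and gq: "integrable M (\<lambda>x. cmod (g x) powr q)"
    using g by (auto simp: Lp_space_def M_def)
  have idm: "(\<lambda>y::complex. y) \<in> borel_measurable M"
    unfolding M_def using continuous_imp_measurable_on_sets_lebesgue[of disk "\<lambda>x. x"] by auto
  have fin: "finite_measure M" unfolding M_def
    by (rule finite_measure_lebesgue_on) simp
  then have one: "integrable M (\<lambda>_. 1::real)" by (rule finite_measure.integrable_const)
  obtain \<beta> s :: real where \<beta>s: "0 < \<beta>" "0 \<le> s" "s < 2" and
    split: "\<And>x t. 0 \<le> x \<Longrightarrow> 0 < t \<Longrightarrow> t \<le> 1 \<Longrightarrow> x / t \<le> t powr \<beta> * (t powr (-s) + x powr q)"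
    using cauchy_kernel_split[OF q] by blast
  obtain K where K: "K \<ge> 0" "\<And>z::complex. (\<integral>\<^sup>+y. ennreal (cmod (y - z) powr (-s)) * indicator (ball z 1) y \<partial>lborel) \<le> ennreal K"
    using riesz_kernel_mass_bounded[OF \<beta>s(3,2)] by blast
  define \<kappa> where "\<kappa> z y = cmod (y - z) powr (-s) * indicator (ball z 1) y" for z y :: complex
  have \<kappa>m: "\<kappa> z \<in> borel_measurable M" for z
  proof -
    have [measurable]: "ball z 1 \<in> sets borel" by simp
    have "\<kappa> z \<in> borel_measurable borel" unfolding \<kappa>_def by measurable
    from measurable_compose[OF idm this] show ?thesis .
  qed
  have \<kappa>n: "(\<integral>\<^sup>+y. ennreal (\<kappa> z y) \<partial>M) \<le> ennreal K" for z
  proof -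
    have "(\<integral>\<^sup>+y. ennreal (\<kappa> z y) \<partial>M) = (\<integral>\<^sup>+y. ennreal (\<kappa> z y) * indicator disk y \<partial>lebesgue)"
      unfolding M_def by (rule nn_integral_restrict_space) auto
    also have "\<dots> \<le> (\<integral>\<^sup>+y. ennreal (\<kappa> z y) \<partial>lebesgue)"
      by (intro nn_integral_mono) (auto simp: indicator_def)
    also have "\<dots> = (\<integral>\<^sup>+y. ennreal (cmod (y - z) powr (-s)) * indicator (ball z 1) y \<partial>lborel)"
      unfolding nn_integral_completion
      by (intro nn_integral_cong) (auto simp: \<kappa>_def indicator_def)
    finally show ?thesis using K(2)[of z] by simp
  qed
  have \<kappa>int: "integrable M (\<kappa> z)" for z
  proof (rule integrableI_nonneg[OF \<kappa>m])
    show "AE x in M. 0 \<le> \<kappa> z x" by (simp add: \<kappa>_def)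
    show "(\<integral>\<^sup>+x. ennreal (\<kappa> z x) \<partial>M) < \<infinity>" using \<kappa>n[of z] by (auto intro: order.strict_trans1)
  qed
  have \<kappa>le: "(LINT y|M. \<kappa> z y) \<le> K" for z
  proof -
    have "(\<integral>\<^sup>+x. ennreal (\<kappa> z x) \<partial>M) = ennreal (LINT y|M. \<kappa> z y)"
      by (rule nn_integral_eq_integral[OF \<kappa>int]) (simp add: \<kappa>_def)
    then show ?thesis using \<kappa>n[of z] K(1) by simp
  qed
  define L where "L = (LINT y|M. cmod (g y) powr q)"
  have near: "cmod (g y) / cmod (y - z) \<le> d powr \<beta> * (\<kappa> z y + cmod (g y) powr q)"
    if "cmod (y - z) < d" "d \<le> 1" for y z d
  proof (cases "y = z")
    case False
    then have t: "0 < cmod (y - z)" "cmod (y - z) \<le> 1" using that by auto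
    have "cmod (g y) / cmod (y - z) \<le> cmod (y - z) powr \<beta> * (cmod (y - z) powr (-s) + cmod (g y) powr q)"
      using t by (intro split) auto
    also have "\<dots> \<le> d powr \<beta> * (cmod (y - z) powr (-s) + cmod (g y) powr q)"
      using that t \<beta>s by (intro mult_right_mono powr_mono2) auto
    also have "cmod (y - z) powr (-s) = \<kappa> z y"
      using that by (simp add: \<kappa>_def dist_norm norm_minus_commute)
    finally show ?thesis .
  qed (auto simp: \<kappa>_def)
  have gint: "integrable M (\<lambda>y. cmod (g y))"
  proof (rule Bochner_Integration.integrable_bound[OF Bochner_Integration.integrable_add[OF one gq]])
    show "AE x in M. norm (cmod (g x)) \<le> norm (1 + cmod (g x) powr q)"
    proof (intro AE_I2)
      fix x
      have "cmod (g x) \<le> 1 + cmod (g x) powr q"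
      proof (cases "cmod (g x) \<le> 1")
        case False
        then have "cmod (g x) powr 1 \<le> cmod (g x) powr q" using q by (intro powr_mono) auto
        then show ?thesis using False by simp
      qed (simp add: add_increasing2)
      then show "norm (cmod (g x)) \<le> norm (1 + cmod (g x) powr q)" by simp
    qed
  qed (use gm in auto)
  have T_int: "integrable M (\<lambda>y. g y / (y - z))" for z
  proof (rule Bochner_Integration.integrable_bound)
    show "integrable M (\<lambda>y. (\<kappa> z y + cmod (g y) powr q) + cmod (g y))"
      using \<kappa>int gq gint by auto
    show "(\<lambda>y. g y / (y - z)) \<in> borel_measurable M"
      by (intro borel_measurable_divide borel_measurable_diff borel_measurable_const gm idm)
    show "AE y in M. norm (g y / (y - z)) \<le> norm ((\<kappa> z y + cmod (g y) powr q) + cmod (g y))"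
    proof (intro AE_I2)
      fix y
      have k0: "\<kappa> z y \<ge> 0" by (simp add: \<kappa>_def)
      have "cmod (g y) / cmod (y - z) \<le> (\<kappa> z y + cmod (g y) powr q) + cmod (g y)"
      proof (cases "cmod (y - z) < 1")
        case True
        then show ?thesis using near[of y z 1] by (simp add: add_increasing2)
      next
        case False
        then have "cmod (g y) / cmod (y - z) \<le> cmod (g y) / 1" by (intro divide_left_mono) auto
        then show ?thesis using k0 by (simp add: add_increasing)
      qed
      then show "norm (g y / (y - z)) \<le> norm ((\<kappa> z y + cmod (g y) powr q) + cmod (g y))"
        using k0 by (simp add: norm_divide)
    qed
  qed
  have ckm: "cut_kernel d \<in> borel_measurable borel" if "0 < d" for d
    using cut_kernel_continuous[OF that] by (rule borel_measurable_continuous_onI)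
  have C_int: "integrable M (\<lambda>y. g y * cut_kernel d (y - z))" if d: "0 < d" for d z
  proof (rule Bochner_Integration.integrable_bound)
    show "integrable M (\<lambda>y. cmod (g y) * (1 / d))" using gint by (rule integrable_mult_left)
    show "(\<lambda>y. g y * cut_kernel d (y - z)) \<in> borel_measurable M"
      by (intro borel_measurable_times gm measurable_compose[OF _ ckm[OF d]]
          borel_measurable_diff borel_measurable_const idm)
    show "AE y in M. norm (g y * cut_kernel d (y - z)) \<le> norm (cmod (g y) * (1 / d))"
    proof (intro AE_I2)
      fix y
      show "norm (g y * cut_kernel d (y - z)) \<le> norm (cmod (g y) * (1 / d))"
        using mult_left_mono[OF cut_kernel_bound[OF d, of "y - z"], of "cmod (g y)"] d
        by (simp add: norm_mult)
    qed
  qed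
  define \<delta> where "\<delta> n = inverse (real (Suc n))" for n
  have \<delta>: "0 < \<delta> n" "\<delta> n \<le> 1" for n by (auto simp: \<delta>_def field_simps)
  have diff: "cmod ((LINT y|M. g y * cut_kernel (\<delta> n) (y - z)) - (LINT y|M. g y / (y - z)))
      \<le> \<delta> n powr \<beta> * (K + L)" for n z
  proof -
    have "(LINT y|M. g y * cut_kernel (\<delta> n) (y - z)) - (LINT y|M. g y / (y - z))
      = (LINT y|M. g y * cut_kernel (\<delta> n) (y - z) - g y / (y - z))"
      by (rule Bochner_Integration.integral_diff[symmetric, OF C_int[OF \<delta>(1)] T_int])
    also have "cmod \<dots> \<le> (LINT y|M. \<delta> n powr \<beta> * (\<kappa> z y + cmod (g y) powr q))"
    proof (rule Bochner_Integration.integral_norm_bound_integral)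
      show "integrable M (\<lambda>y. \<delta> n powr \<beta> * (\<kappa> z y + cmod (g y) powr q))" using \<kappa>int gq by auto
      show "integrable M (\<lambda>y. g y * cut_kernel (\<delta> n) (y - z) - g y / (y - z))"
        using C_int[OF \<delta>(1)] T_int by auto
      fix y
      have k0: "0 \<le> \<delta> n powr \<beta> * (\<kappa> z y + cmod (g y) powr q)" by (simp add: \<kappa>_def)
      have "g y * cut_kernel (\<delta> n) (y - z) - g y / (y - z) = - (g y * (1 / (y - z) - cut_kernel (\<delta> n) (y - z)))"
        by (simp add: algebra_simps)
      then have "cmod (g y * cut_kernel (\<delta> n) (y - z) - g y / (y - z)) = cmod (g y) * cmod (1 / (y - z) - cut_kernel (\<delta> n) (y - z))"
        by (simp only: norm_minus_cancel norm_mult)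
      also have "\<dots> \<le> cmod (g y) * (if cmod (y - z) < \<delta> n then 1 / cmod (y - z) else 0)"
        by (intro mult_left_mono cut_kernel_difference \<delta>) auto
      also have "\<dots> \<le> \<delta> n powr \<beta> * (\<kappa> z y + cmod (g y) powr q)"
        using near[OF _ \<delta>(2)[of n], of y z] k0 by auto
      finally show "cmod (g y * cut_kernel (\<delta> n) (y - z) - g y / (y - z)) \<le> \<delta> n powr \<beta> * (\<kappa> z y + cmod (g y) powr q)" .
    qed
    also have "\<dots> = \<delta> n powr \<beta> * ((LINT y|M. \<kappa> z y) + L)"
      using \<kappa>int gq by (simp add: L_def Bochner_Integration.integral_add)
    also have "\<dots> \<le> \<delta> n powr \<beta> * (K + L)" using \<kappa>le by (intro mult_left_mono) auto
    finally show ?thesis .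
  qed
  have "continuous_on UNIV (\<lambda>z. LINT y|M. g y / (y - z))"
  proof (rule uniform_limit_theorem)
    show "\<forall>\<^sub>F n in sequentially. continuous_on UNIV (\<lambda>z. LINT y|M. g y * cut_kernel (\<delta> n) (y - z))"
    proof (intro always_eventually allI)
      fix n
      show "continuous_on UNIV (\<lambda>z. LINT y|M. g y * cut_kernel (\<delta> n) (y - z))"
        unfolding continuous_on_sequentially comp_def
      proof (intro ballI allI impI)
        fix x :: "nat \<Rightarrow> complex" and z assume "(\<forall>k. x k \<in> UNIV) \<and> x \<longlonglongrightarrow> z"
        then have x: "x \<longlonglongrightarrow> z" by simp
        show "(\<lambda>k. LINT y|M. g y * cut_kernel (\<delta> n) (y - x k)) \<longlonglongrightarrow> (LINT y|M. g y * cut_kernel (\<delta> n) (y - z))"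
        proof (rule integral_dominated_convergence[where w = "\<lambda>y. cmod (g y) * (1 / \<delta> n)"])
          show "integrable M (\<lambda>y. cmod (g y) * (1 / \<delta> n))" using gint by (rule integrable_mult_left)
          show "(\<lambda>y. g y * cut_kernel (\<delta> n) (y - x k)) \<in> borel_measurable M" for k
            using C_int[OF \<delta>(1)] by (rule borel_measurable_integrable)
          show "(\<lambda>y. g y * cut_kernel (\<delta> n) (y - z)) \<in> borel_measurable M"
            using C_int[OF \<delta>(1)] by (rule borel_measurable_integrable)
          show "AE y in M. (\<lambda>k. g y * cut_kernel (\<delta> n) (y - x k)) \<longlonglongrightarrow> g y * cut_kernel (\<delta> n) (y - z)"
          proof (intro AE_I2 tendsto_mult tendsto_const)
            fix y
            have "isCont (cut_kernel (\<delta> n)) (y - z)"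
              using cut_kernel_continuous[OF \<delta>(1)] by (simp add: continuous_on_eq_continuous_at)
            then show "(\<lambda>k. cut_kernel (\<delta> n) (y - x k)) \<longlonglongrightarrow> cut_kernel (\<delta> n) (y - z)"
              by (rule isCont_tendsto_compose) (intro tendsto_intros x)
          qed
          show "AE y in M. norm (g y * cut_kernel (\<delta> n) (y - x k)) \<le> cmod (g y) * (1 / \<delta> n)" for k
            using mult_left_mono[OF cut_kernel_bound[OF \<delta>(1)]] by (intro AE_I2) (simp only: norm_mult norm_ge_zero)
        qed
      qed
    qed
    show "uniform_limit UNIV (\<lambda>n z. LINT y|M. g y * cut_kernel (\<delta> n) (y - z)) (\<lambda>z. LINT y|M. g y / (y - z)) sequentially"
      unfolding uniform_limit_iff
    proof (intro allI impI)
      fix e :: real assume e: "0 < e"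
      have "(\<lambda>n. \<delta> n powr \<beta> * (K + L)) \<longlonglongrightarrow> 0 powr \<beta> * (K + L)"
        unfolding \<delta>_def using \<beta>s(1)
        by (intro tendsto_mult tendsto_powr' tendsto_const LIMSEQ_inverse_real_of_nat) auto
      then have "\<forall>\<^sub>F n in sequentially. \<delta> n powr \<beta> * (K + L) < e" using e by (intro order_tendstoD(2)) auto
      then show "\<forall>\<^sub>F n in sequentially. \<forall>z\<in>UNIV. dist (LINT y|M. g y * cut_kernel (\<delta> n) (y - z)) (LINT y|M. g y / (y - z)) < e"
      proof eventually_elim
        case (elim n)
        then show ?case using diff[of n] by (auto simp: dist_norm intro: order.strict_trans1)
      qed
    qed
  qed auto
  then show ?thesis by (simp add: M_def)
qed

section \<open>Mean squares on circles and the Parseval identity\<close>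

definition square_mean :: "(complex \<Rightarrow> complex) \<Rightarrow> real \<Rightarrow> real"
  where "square_mean u r = integral {0..2*pi} (\<lambda>t. (cmod (u (of_real r * cis t)))\<^sup>2)"

lemma nn_integral_lebesgue_on_continuous:
  fixes w :: "real \<Rightarrow> real"
  assumes "continuous_on {a..b} w" "\<And>x. x \<in> {a..b} \<Longrightarrow> 0 \<le> w x"
  shows "(\<integral>\<^sup>+x. ennreal (w x) \<partial>lebesgue_on {a..b}) = ennreal (integral {a..b} w)"
proof -
  have "integrable (lebesgue_on {a..b}) w"
    using assms(1) by (rule continuous_imp_integrable_real)
  then have "(\<integral>\<^sup>+x. ennreal (w x) \<partial>lebesgue_on {a..b}) = ennreal (integral\<^sup>L (lebesgue_on {a..b}) w)"
    by (intro nn_integral_eq_integral AE_I2) (use assms(2) in auto)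
  also have "integral\<^sup>L (lebesgue_on {a..b}) w = integral {a..b} w"
    by (rule lebesgue_integral_eq_integral) (use \<open>integrable _ w\<close> in auto)
  finally show ?thesis .
qed

lemma continuous_on_circle:
  assumes "continuous_on (cball 0 \<bar>r\<bar>) (u :: complex \<Rightarrow> 'b::topological_space)"
  shows "continuous_on S (\<lambda>t. u (of_real r * cis t))"
proof (rule continuous_on_compose2[OF assms])
  show "continuous_on S (\<lambda>t. of_real r * cis t)" by (intro continuous_intros)
qed (auto simp: norm_mult)

lemma has_integral_cis_full_period:
  "((\<lambda>t. cis (of_int k * t)) has_integral (if k = 0 then of_real (2*pi) else 0)) {0..2*pi}"
proof (cases "k = 0")
  case True
  then show ?thesis using has_integral_const_real[of "1::complex" 0 "2*pi"]
    by (simp add: scaleR_conv_of_real)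
next
  case False
  define F where "F z = exp (\<i> * of_int k * z) / (\<i> * of_int k)" for z :: complex
  have F: "F (of_real t) = cis (of_int k * t) / (\<i> * of_int k)" for t :: real
    by (simp add: F_def cis_conv_exp mult_ac)
  have "(F has_field_derivative cis (of_int k * t)) (at (of_real t))" for t :: real
    unfolding F_def using False
    by (auto intro!: derivative_eq_intros simp: cis_conv_exp mult_ac)
  then have "((\<lambda>t. cis (of_int k * t)) has_integral
      (F (of_real (2*pi)) - F (of_real 0))) {0..2*pi}"
    by (intro fundamental_theorem_of_calculus has_vector_derivative_real_field) auto
  moreover have "cis (of_int k * (2*pi)) = 1"
    using cis_multiple_2pi[of "of_int k"] by (simp add: mult_ac)
  ultimately show ?thesis using False unfolding F by simp
qed

lemma square_mean_polynomial:
  "square_mean (\<lambda>z. \<Sum>n<N. a n * z ^ n) r = (\<Sum>n<N. 2 * pi * (cmod (a n))\<^sup>2 * r ^ (2*n))"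
proof -
  define c where "c n = a n * of_real r ^ n" for n
  define s where "s t = (\<Sum>n<N. a n * (of_real r * cis t) ^ n)" for t
  have s: "s t = (\<Sum>n<N. c n * cis (real n * t))" for t
    by (simp add: s_def c_def power_mult_distrib Complex.DeMoivre mult_ac)
  have eq: "of_real ((cmod (s t))\<^sup>2) = (\<Sum>n<N. \<Sum>m<N. c n * cnj (c m) * cis (of_int (int n - int m) * t))" for t
  proof -
    have "of_real ((cmod (s t))\<^sup>2) = s t * cnj (s t)"
      by (rule complex_norm_square)
    also have "\<dots> = (\<Sum>n<N. \<Sum>m<N. (c n * cis (real n * t)) * (cnj (c m) * cis (- (real m * t))))"
      by (simp add: s sum_product cis_cnj)
    also have "\<dots> = (\<Sum>n<N. \<Sum>m<N. c n * cnj (c m) * cis (of_int (int n - int m) * t))"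
      by (intro sum.cong refl) (simp add: mult.assoc mult.left_commute cis_mult algebra_simps)
    finally show ?thesis .
  qed
  have "((\<lambda>t. complex_of_real ((cmod (s t))\<^sup>2)) has_integral
     (\<Sum>n<N. \<Sum>m<N. c n * cnj (c m) * (if int n - int m = 0 then of_real (2*pi) else 0))) {0..2*pi}"
    unfolding eq
    by (intro has_integral_sum has_integral_mult_right has_integral_cis_full_period finite_lessThan)
  also have "(\<Sum>n<N. \<Sum>m<N. c n * cnj (c m) * (if int n - int m = 0 then of_real (2*pi) else 0))
     = (\<Sum>n<N. c n * cnj (c n) * of_real (2*pi))"
    by (intro sum.cong refl) (simp add: if_distrib[of "\<lambda>x. _ * x"] sum.If_cases Collect_conv_if2 cong: if_cong)
  also have "\<dots> = of_real (\<Sum>n<N. 2 * pi * (cmod (a n))\<^sup>2 * r ^ (2*n))"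
    unfolding of_real_sum
  proof (intro sum.cong refl)
    fix n
    have "c n * cnj (c n) = of_real ((cmod (c n))\<^sup>2)" by (simp only: complex_norm_square)
    also have "(cmod (c n))\<^sup>2 = (cmod (a n))\<^sup>2 * r ^ (2*n)"
      by (simp add: c_def norm_mult norm_power power_mult_distrib power_even_abs mult.commute[of n 2] flip: power_mult)
    finally show "c n * cnj (c n) * of_real (2*pi) = of_real (2 * pi * (cmod (a n))\<^sup>2 * r ^ (2*n))"
      by simp
  qed
  finally have "((\<lambda>t. Re (complex_of_real ((cmod (s t))\<^sup>2))) has_integral
      Re (of_real (\<Sum>n<N. 2 * pi * (cmod (a n))\<^sup>2 * r ^ (2*n)))) {0..2*pi}"
    by (rule has_integral_Re)
  then show ?thesis
    unfolding square_mean_def s_def by (simp add: integral_unique)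
qed

text \<open>The circle is compactly contained in the disk of convergence, so the Taylor polynomials are uniformly
bounded on it and the identity for polynomials passes to the limit.\<close>

lemma parseval:
  assumes ps: "\<And>z. cmod z < R \<Longrightarrow> (\<lambda>n. a n * z ^ n) sums u z" and r: "0 \<le> r" "r < R"
  shows "(\<lambda>n. 2 * pi * (cmod (a n))\<^sup>2 * r ^ (2*n)) sums square_mean u r"
proof -
  define s where "s N z = (\<Sum>n<N. a n * z ^ n)" for N z
  define \<rho> where "\<rho> = (r + R) / 2"
  have "summable (\<lambda>n. a n * of_real \<rho> ^ n)"
    by (rule sums_summable[OF ps]) (use r in \<open>simp add: \<rho>_def norm_of_real del: of_real_add of_real_divide\<close>)
  then have abs: "summable (\<lambda>n. cmod (a n * of_real r ^ n))"
    by (rule powser_insidea) (use r in \<open>simp add: \<rho>_def norm_of_real del: of_real_add of_real_divide\<close>)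
  define M where "M = (\<Sum>n. cmod (a n * of_real r ^ n))"
  have bound: "cmod (s N (of_real r * cis t)) \<le> M" for N t
  proof -
    have "cmod (s N (of_real r * cis t)) \<le> (\<Sum>n<N. cmod (a n * of_real r ^ n))"
      unfolding s_def
      by (rule order_trans[OF norm_sum]) (simp add: norm_mult norm_power power_mult_distrib)
    also have "\<dots> \<le> M"
      unfolding M_def by (rule sum_le_suminf) (use abs in auto)
    finally show ?thesis .
  qed
  have "(\<lambda>N. integral {0..2*pi} (\<lambda>t. (cmod (s N (of_real r * cis t)))\<^sup>2))
      \<longlonglongrightarrow> square_mean u r"
    unfolding square_mean_def
  proof (rule dominated_convergence(2)[where h = "\<lambda>_. M\<^sup>2"])
    show "(\<lambda>t. (cmod (s k (of_real r * cis t)))\<^sup>2) integrable_on {0..2*pi}" for k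
      unfolding s_def
      by (intro integrable_continuous_real continuous_intros)
    show "norm ((cmod (s k (of_real r * cis x)))\<^sup>2) \<le> M\<^sup>2" for k x
      using power_mono[OF bound norm_ge_zero, of k x 2] by simp
    show "(\<lambda>k. (cmod (s k (of_real r * cis x)))\<^sup>2) \<longlonglongrightarrow> (cmod (u (of_real r * cis x)))\<^sup>2" for x
    proof -
      have "(\<lambda>k. s k (of_real r * cis x)) \<longlonglongrightarrow> u (of_real r * cis x)"
        using ps[of "of_real r * cis x"] r by (simp add: norm_mult sums_def s_def)
      then show ?thesis by (intro tendsto_intros)
    qed
  qed auto
  then show ?thesis
    unfolding sums_def using square_mean_polynomial
    by (simp add: square_mean_def s_def)
qed

section \<open>Poisson majorants and the maximal inequality\<close>

lemma dilation_holomorphic: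
  assumes u: "u holomorphic_on disk" and r: "0 \<le> r" "r < 1"
  shows "(\<lambda>z. u (of_real r * z)) holomorphic_on cball 0 1"
proof (rule holomorphic_on_compose_gen[OF _ u, unfolded o_def])
  show "(\<lambda>z::complex. of_real r * z) ` cball 0 1 \<subseteq> disk"
  proof (intro image_subsetI)
    fix z :: complex assume "z \<in> cball 0 1"
    then have "r * cmod z \<le> r" using r by (intro mult_left_le) auto
    then have "r * cmod z < 1" using r by linarith
    then show "of_real r * z \<in> disk" using r by (simp add: norm_mult)
  qed
qed (intro holomorphic_intros)

text \<open>With \<open>x = (t - \<theta>)/2\<close> the chord has length \<open>2 |sin x|\<close>, and \<open>|sin x - x| \<le> |x|\<^sup>3/6 \<le> 2 |x|/3\<close>
for \<open>|x| \<le> \<pi>/2 < 2\<close>.\<close>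

lemma chord_lower_bound:
  assumes "\<bar>t - \<theta>\<bar> \<le> pi"
  shows "\<bar>t - \<theta>\<bar> \<le> 3 * cmod (cis t - cis \<theta>)"
proof -
  define x where "x = (t - \<theta>) / 2"
  have x: "\<bar>x\<bar> \<le> 2" using assms pi_less_4 by (auto simp: x_def)
  have "cis t - cis \<theta> = cis ((t + \<theta>)/2) * (cis x - cis (-x))"
    by (simp add: algebra_simps cis_mult x_def add_divide_distrib diff_divide_distrib)
  also have "cis x - cis (-x) = 2 * \<i> * of_real (sin x)"
    by (simp add: complex_eq_iff)
  finally have c: "cmod (cis t - cis \<theta>) = 2 * \<bar>sin x\<bar>"
    by (simp add: norm_mult)
  have "\<bar>sin x - (\<Sum>m<3. sin_coeff m * x ^ m)\<bar> \<le> inverse (fact 3) * \<bar>x\<bar> ^ 3"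
    by (rule Maclaurin_sin_bound)
  then have "\<bar>sin x - x\<bar> \<le> \<bar>x\<bar> ^ 3 / 6"
    by (simp add: sin_coeff_def lessThan_Suc numeral_eq_Suc fact_numeral)
  moreover have "\<bar>x\<bar> ^ 3 \<le> 4 * \<bar>x\<bar>"
  proof -
    have "\<bar>x\<bar> ^ 3 = \<bar>x\<bar>\<^sup>2 * \<bar>x\<bar>" by (simp add: power3_eq_cube power2_eq_square)
    also have "\<dots> \<le> 2\<^sup>2 * \<bar>x\<bar>" using x by (intro mult_right_mono power_mono) auto
    finally show ?thesis by simp
  qed
  ultimately have "\<bar>x\<bar> \<le> 3 * \<bar>sin x\<bar>" by linarith
  then show ?thesis unfolding c by (simp add: x_def)
qed

definition poisson_kernel :: "complex \<Rightarrow> complex \<Rightarrow> real"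
  where "poisson_kernel z \<zeta> = (1 - (cmod z)\<^sup>2) / (cmod (\<zeta> - z))\<^sup>2"

text \<open>The Cauchy formula is applied to \<open>u(\<zeta>)\<^sup>2 (1 - |z|\<^sup>2) / (1 - z\<^sup>* \<zeta>)\<close>, whose value at \<open>\<zeta> = z\<close> is
\<open>u(z)\<^sup>2\<close>. On the unit circle \<open>|1 - z\<^sup>* \<zeta>| = |\<zeta> - z|\<close>, so the modulus of the resulting kernel is exactly the
Poisson kernel. This yields the inequality without any theory of harmonic functions.\<close>

lemma poisson_majorant_origin:
  assumes u: "u holomorphic_on cball 0 1" and z: "cmod z < 1"
  shows "(cmod (u z))\<^sup>2 \<le> 1 / (2*pi) * integral {0..2*pi}
     (\<lambda>t. (cmod (u (cis t)))\<^sup>2 * poisson_kernel z (cis t))"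
proof -
  define F where "F \<zeta> = (u \<zeta>)\<^sup>2 * of_real (1 - (cmod z)\<^sup>2) / (1 - cnj z * \<zeta>)" for \<zeta>
  have nz: "1 - cnj z * \<zeta> \<noteq> 0" if "cmod \<zeta> \<le> 1" for \<zeta>
  proof
    assume "1 - cnj z * \<zeta> = 0"
    then have "cnj z * \<zeta> = 1" by simp
    then have "cmod z * cmod \<zeta> = 1"
      by (metis complex_mod_cnj norm_mult norm_one)
    moreover have "cmod z * cmod \<zeta> \<le> cmod z" using that by (simp add: mult_left_le)
    ultimately show False using z by simp
  qed
  have "F holomorphic_on cball 0 1"
    unfolding F_def by (intro holomorphic_intros u) (use nz in auto)
  then have "((\<lambda>\<zeta>. F \<zeta> / (\<zeta> - z)) has_contour_integral (2 * of_real pi * \<i> * F z)) (circlepath 0 1)"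
    by (rule Cauchy_integral_circlepath_simple) (use z in auto)
  then have *: "((\<lambda>t. F (cis t) / (cis t - z) * \<i> * cis t) has_integral (2 * of_real pi * \<i> * F z)) {0..2*pi}"
    unfolding circlepath_def by (subst (asm) has_contour_integral_part_circlepath_iff) auto
  have ne: "cis t - z \<noteq> 0" for t
    using z by auto
  have "norm (integral {0..2*pi} (\<lambda>t. F (cis t) / (cis t - z) * \<i> * cis t))
     \<le> integral {0..2*pi} (\<lambda>t. (cmod (u (cis t)))\<^sup>2 * poisson_kernel z (cis t))"
  proof (rule integral_norm_bound_integral)
    show "(\<lambda>t. F (cis t) / (cis t - z) * \<i> * cis t) integrable_on {0..2 * pi}"
      using * by auto
    have "continuous_on {0..2*pi} (\<lambda>t. u (of_real 1 * cis t))"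
      by (rule continuous_on_circle) (use u holomorphic_on_imp_continuous_on in auto)
    then show "(\<lambda>t. (cmod (u (cis t)))\<^sup>2 * poisson_kernel z (cis t)) integrable_on {0..2 * pi}"
      using ne unfolding poisson_kernel_def by (intro integrable_continuous_real continuous_intros) auto
    fix t
    have "1 - cnj z * cis t = cis t * cnj (cis t - z)"
      by (simp add: algebra_simps cis_cnj cis_mult)
    then have "cmod (1 - cnj z * cis t) = cmod (cis t - z)"
      by (metis complex_mod_cnj mult_1 norm_cis norm_mult)
    moreover have "cmod (of_real (1 - (cmod z)\<^sup>2)) = 1 - (cmod z)\<^sup>2"
      unfolding norm_of_real using z by (simp add: abs_square_le_1)
    ultimately show "cmod (F (cis t) / (cis t - z) * \<i> * cis t)
       \<le> (cmod (u (cis t)))\<^sup>2 * poisson_kernel z (cis t)"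
      by (simp only: F_def poisson_kernel_def norm_mult norm_divide norm_power) (simp add: power2_eq_square)
  qed
  also have "integral {0..2*pi} (\<lambda>t. F (cis t) / (cis t - z) * \<i> * cis t) = 2 * of_real pi * \<i> * F z"
    using * by (rule integral_unique)
  also have "F z = (u z)\<^sup>2"
  proof -
    have "of_real (1 - (cmod z)\<^sup>2) = 1 - cnj z * z"
      using complex_norm_square[of z] by (simp add: mult.commute)
    then show ?thesis using nz[of z] z by (simp add: F_def)
  qed
  finally show ?thesis
    by (simp add: norm_mult norm_power field_simps)
qed

text \<open>A rotation moves the fundamental period to an interval centred at \<open>\<theta>\<close>, where the distance on the
circle and the distance of the parameters are comparable.\<close>

lemma poisson_majorant:
  assumes u: "u holomorphic_on cball 0 1" and z: "cmod z < 1"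
  shows "(cmod (u z))\<^sup>2 \<le> 1 / (2*pi) * integral {\<theta>-pi..\<theta>+pi}
     (\<lambda>t. (cmod (u (cis t)))\<^sup>2 * poisson_kernel z (cis t))"
proof -
  define a where "a = \<theta> - pi"
  have hol: "(\<lambda>\<zeta>. u (cis a * \<zeta>)) holomorphic_on cball 0 1"
    by (rule holomorphic_on_compose_gen[OF _ u, unfolded o_def])
      (auto intro!: holomorphic_intros simp: norm_mult)
  have z': "cmod (cis (-a) * z) < 1" using z by (simp add: norm_mult)
  have eq: "cmod (cis t - cis (-a) * z) = cmod (cis (t + a) - z)" for t
  proof -
    have "cis (t + a) - z = cis a * (cis t - cis (-a) * z)"
      by (simp add: algebra_simps cis_mult flip: mult.assoc)
    then show ?thesis by (simp add: norm_mult)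
  qed
  have "(cmod (u z))\<^sup>2 = (cmod (u (cis a * (cis (-a) * z))))\<^sup>2"
    by (simp add: cis_mult flip: mult.assoc)
  also have "\<dots> \<le> 1 / (2*pi) * integral {0..2*pi}
     (\<lambda>t. (cmod (u (cis a * cis t)))\<^sup>2 * poisson_kernel (cis (-a) * z) (cis t))"
    by (rule poisson_majorant_origin[OF hol z'])
  also have "(\<lambda>t. (cmod (u (cis a * cis t)))\<^sup>2 * poisson_kernel (cis (-a) * z) (cis t))
    = (\<lambda>t. (cmod (u (cis t)))\<^sup>2 * poisson_kernel z (cis t)) \<circ> ((+) a)"
    by (auto simp: fun_eq_iff poisson_kernel_def eq norm_mult cis_mult add.commute)
  also have "integral {0..2*pi} \<dots> = integral {0+a..2*pi+a}
     (\<lambda>t. (cmod (u (cis t)))\<^sup>2 * poisson_kernel z (cis t))"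
    by (rule integral_shift_Icc_real)
  finally show ?thesis by (simp add: a_def algebra_simps)
qed

text \<open>A kernel decaying like \<open>\<delta>/|t - \<theta>|\<^sup>2\<close> beyond distance \<open>\<delta>\<close> is dominated by a sum of multiples, with
coefficients of order \<open>4\<^bsup>-j\<^esup>/\<delta>\<close>, of indicators of the intervals of radius \<open>2\<^sup>j \<delta>\<close>. Bounded
averages then give a geometric series in \<open>2\<^bsup>-j\<^esup>\<close>.\<close>

lemma dyadic_kernel_estimate:
  fixes w P :: "real \<Rightarrow> real"
  assumes w: "continuous_on UNIV w" "\<And>t. 0 \<le> w t"
    and P: "continuous_on UNIV P" "\<And>t. \<bar>t - \<theta>\<bar> \<le> pi \<Longrightarrow> P t \<le> K * \<delta> / (max \<delta> \<bar>t - \<theta>\<bar>)\<^sup>2"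
    and \<delta>: "0 < \<delta>" "\<delta> \<le> 1" and "0 \<le> K" "0 \<le> \<mu>"
    and avg: "\<And>s. 0 < s \<Longrightarrow> s < 2*pi \<Longrightarrow> integral {\<theta>-s..\<theta>+s} w \<le> \<mu> * s"
  shows "integral {\<theta>-pi..\<theta>+pi} (\<lambda>t. w t * P t) \<le> 8 * K * \<mu>"
proof -
  have wint: "w integrable_on {a..b}" for a b
    by (intro integrable_continuous_real continuous_on_subset[OF w(1)]) auto
  obtain n0 where n0: "pi / \<delta> < 2 ^ n0" using real_arch_pow[of 2 "pi/\<delta>"] by auto
  \<comment> \<open>\<open>J\<close> is the first step at which the dyadic intervals exhaust the period; by minimality
    all radii stay below \<open>2 \<pi>\<close>.\<close>
  define J where "J = (LEAST n. pi \<le> 2 ^ n * \<delta>)"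
  have ex: "pi \<le> 2 ^ n0 * \<delta>" using n0 \<delta> by (simp add: field_simps)
  have J: "pi \<le> 2 ^ J * \<delta>" unfolding J_def by (rule LeastI[of _ n0]) (rule ex)
  have J2: "2 ^ J * \<delta> < 2 * pi"
  proof (cases J)
    case 0 then show ?thesis using \<delta> pi_gt3 by simp
  next
    case (Suc j)
    then have "\<not> pi \<le> 2 ^ j * \<delta>" unfolding J_def using not_less_Least by (metis lessI)
    then show ?thesis using Suc by simp
  qed
  define s where "s j = 2 ^ j * \<delta>" for j :: nat
  have spos: "s j > 0" for j using \<delta> by (simp add: s_def)
  have s2: "s j < 2*pi" if "j \<le> J" for j
  proof -
    have "s j \<le> s J" unfolding s_def using \<delta> that by (intro mult_right_mono power_increasing) auto
    then show ?thesis using J2 by (simp add: s_def)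
  qed
  define I where "I j t = (if t \<in> {\<theta>-s j..\<theta>+s j} then w t else 0)" for j t
  have I0: "I j t \<ge> 0" for j t using w by (simp add: I_def)
  have Iint: "I j integrable_on {\<theta>-pi..\<theta>+pi}" for j
    unfolding I_def integrable_restrict_Int by (simp only: Int_atLeastAtMost) (rule wint)
  have Ib: "integral {\<theta>-pi..\<theta>+pi} (I j) \<le> \<mu> * s j" if "j \<le> J" for j
  proof -
    have "integral {\<theta>-pi..\<theta>+pi} (I j) = integral ({\<theta>-s j..\<theta>+s j} \<inter> {\<theta>-pi..\<theta>+pi}) w"
      unfolding I_def by (rule Henstock_Kurzweil_Integration.integral_restrict_Int)
    also have "\<dots> \<le> integral {\<theta>-s j..\<theta>+s j} w"
      using w(2) wint by (intro integral_subset_le) (auto simp: Int_atLeastAtMost)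
    also have "\<dots> \<le> \<mu> * s j" using avg spos s2 that by auto
    finally show ?thesis .
  qed
  define c where "c j = 4 * K / (\<delta> * 4 ^ j)" for j :: nat
  have c0: "c j \<ge> 0" for j using \<delta> \<open>0 \<le> K\<close> by (simp add: c_def)
  have pt: "w t * P t \<le> (\<Sum>j\<le>J. c j * I j t)" if t: "t \<in> {\<theta>-pi..\<theta>+pi}" for t
  proof -
    have tp: "\<bar>t - \<theta>\<bar> \<le> pi" using t by auto
    \<comment> \<open>The first dyadic interval that contains \<open>t\<close>: its radius is comparable to \<open>max \<delta> |t - \<theta>|\<close>.\<close>
    define j where "j = (LEAST j. \<bar>t - \<theta>\<bar> \<le> s j)"
    have exJ: "\<bar>t - \<theta>\<bar> \<le> s J" using tp J by (simp add: s_def)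
    have j1: "\<bar>t - \<theta>\<bar> \<le> s j" unfolding j_def by (rule LeastI[of _ J]) (rule exJ)
    have jJ: "j \<le> J" unfolding j_def by (rule Least_le) (rule exJ)
    have "P t \<le> K * \<delta> / (max \<delta> \<bar>t - \<theta>\<bar>)\<^sup>2" by (rule P(2)[OF tp])
    also have "\<dots> \<le> K * \<delta> / (s j / 2)\<^sup>2"
    proof -
      have "s j / 2 \<le> max \<delta> \<bar>t - \<theta>\<bar>"
      proof (cases j)
        case 0 then show ?thesis using \<delta> by (auto simp: s_def max_def)
      next
        case (Suc i)
        then have "\<not> \<bar>t - \<theta>\<bar> \<le> s i" unfolding j_def using not_less_Least by (metis lessI)
        then show ?thesis using Suc by (simp add: s_def)
      qed
      then have "(s j / 2)\<^sup>2 \<le> (max \<delta> \<bar>t - \<theta>\<bar>)\<^sup>2"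
        using spos[of j] by (intro power_mono) auto
      then show ?thesis using spos[of j] \<delta> \<open>0 \<le> K\<close> by (intro divide_left_mono) auto
    qed
    also have "\<dots> = c j"
    proof -
      have "(2 ^ j * \<delta>)\<^sup>2 = \<delta> * (\<delta> * 4 ^ j)"
        by (simp add: power_mult_distrib power2_eq_square flip: power_mult_distrib)
      then show ?thesis using \<delta>
        by (simp add: s_def c_def power_divide field_simps)
    qed
    finally have "w t * P t \<le> w t * c j" using w by (intro mult_left_mono) auto
    also have "\<dots> = c j * I j t" using j1 by (auto simp: I_def abs_le_iff)
    also have "\<dots> \<le> (\<Sum>j\<le>J. c j * I j t)"
      using jJ c0 I0 by (intro member_le_sum) auto
    finally show ?thesis .
  qed
  have "integral {\<theta>-pi..\<theta>+pi} (\<lambda>t. w t * P t) \<le> integral {\<theta>-pi..\<theta>+pi} (\<lambda>t. \<Sum>j\<le>J. c j * I j t)"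
  proof (rule integral_le)
    show "(\<lambda>t. w t * P t) integrable_on {\<theta>-pi..\<theta>+pi}"
      by (intro integrable_continuous_real continuous_intros continuous_on_subset[OF w(1)]
          continuous_on_subset[OF P(1)]) auto
    show "(\<lambda>t. \<Sum>j\<le>J. c j * I j t) integrable_on {\<theta>-pi..\<theta>+pi}"
      by (intro integrable_sum integrable_on_mult_right Iint) auto
  qed (rule pt)
  also have "\<dots> = (\<Sum>j\<le>J. c j * integral {\<theta>-pi..\<theta>+pi} (I j))"
    by (subst integral_sum) (auto intro!: integrable_on_mult_right Iint)
  also have "\<dots> \<le> (\<Sum>j\<le>J. c j * (\<mu> * s j))"
    using Ib c0 by (intro sum_mono mult_left_mono) auto
  also have "\<dots> = (\<Sum>j\<le>J. 4 * K * \<mu> * (1/2) ^ j)"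
  proof (intro sum.cong refl)
    fix j
    have "(4::real) ^ j = 2 ^ j * 2 ^ j" by (simp flip: power_mult_distrib)
    then show "c j * (\<mu> * s j) = 4 * K * \<mu> * (1/2) ^ j"
      using \<delta> by (simp add: c_def s_def power_divide field_simps)
  qed
  also have "\<dots> = 4 * K * \<mu> * (\<Sum>j\<le>J. (1/2) ^ j)" by (simp add: sum_distrib_left)
  also have "\<dots> \<le> 4 * K * \<mu> * 2"
  proof (rule mult_left_mono)
    show "(\<Sum>j\<le>J. (1/2::real) ^ j) \<le> 2"
      unfolding sum_gp0 by (simp add: field_simps)
  qed (use assms in auto)
  finally show ?thesis by simp
qed

text \<open>The Hardy-Littlewood argument. The Vitali lemma extracts disjoint intervals on each of which
\<open>w\<close> has mean larger than \<open>\<mu>/2\<close>, while their fivefold enlargements still cover the exceptional points. The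
constant is \<open>3 * 10\<close>: the intervals lie in three periods, and an interval of radius \<open>s\<close> has an
enlargement of length \<open>10 s\<close>.\<close>

lemma averages_weak_type:
  fixes w :: "real \<Rightarrow> real"
  assumes w: "continuous_on UNIV w" "\<And>t. 0 \<le> w t" "\<And>t. w (t + 2*pi) = w t" and \<mu>: "0 < \<mu>"
  obtains E where "E \<in> lmeasurable" "measure lebesgue E \<le> 30 * integral {0..2*pi} w / \<mu>"
    "\<And>\<theta> s. \<theta> \<in> {0..2*pi} \<Longrightarrow> 0 < s \<Longrightarrow> s < 2*pi \<Longrightarrow> \<mu> * s < integral {\<theta>-s..\<theta>+s} w \<Longrightarrow> \<theta> \<in> E"
proof -
  have wint: "w integrable_on {a..b}" for a b
    by (intro integrable_continuous_real continuous_on_subset[OF w(1)]) auto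
  have shift: "integral {c..c + 2*pi} w = integral {c + 2*pi..c + 2*pi + 2*pi} w" for c
  proof -
    have "integral {c + 2*pi..c + 2*pi + 2*pi} w = integral {c..c + 2*pi} (w \<circ> ((+) (2*pi)))"
      by (simp add: integral_shift_Icc_real)
    also have "w \<circ> ((+) (2*pi)) = w" using w(3) by (auto simp: fun_eq_iff add.commute)
    finally show ?thesis by simp
  qed
  have three: "integral {-2*pi..4*pi} w = 3 * integral {0..2*pi} w"
  proof -
    have "integral {-2*pi..0} w + integral {0..4*pi} w = integral {-2*pi..4*pi} w"
      by (rule Henstock_Kurzweil_Integration.integral_combine) (auto intro: wint)
    moreover have "integral {0..2*pi} w + integral {2*pi..4*pi} w = integral {0..4*pi} w"
      by (rule Henstock_Kurzweil_Integration.integral_combine) (auto intro: wint)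
    ultimately show ?thesis using shift[of "-2*pi"] shift[of 0] by (simp add: algebra_simps)
  qed
  define K where "K = {(\<theta>, s). \<theta> \<in> {0..2*pi} \<and> 0 < s \<and> s < 2*pi \<and> \<mu> * s < integral {\<theta>-s..\<theta>+s} w}"
  define S where "S = (\<Union>i\<in>K. cball (fst i) (snd i))"
  obtain C where C: "countable C" "C \<subseteq> K"
      "pairwise (\<lambda>i j. disjnt (cball (fst i) (snd i)) (cball (fst j) (snd j))) C"
      "S \<subseteq> (\<Union>i\<in>C. cball (fst i) (5 * snd i))"
  proof (rule Vitali_covering_lemma_cballs[where S = S and K = K and a = fst and r = snd and B = "2*pi"])
    show "S \<subseteq> (\<Union>i\<in>K. cball (fst i) (snd i))" by (simp add: S_def)
    show "0 < snd i \<and> snd i \<le> 2 * pi" if "i \<in> K" for i using that by (auto simp: K_def)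
  qed (rule that)
  define E where "E = (\<Union>i\<in>C. cball (fst i) (5 * snd i))"
  have finite_bound: "measure lebesgue (\<Union>i\<in>F. cball (fst i) (5 * snd i)) \<le> 30 * integral {0..2*pi} w / \<mu>"
    if F: "F \<subseteq> C" "finite F" for F
  proof -
    have FK: "i \<in> K" if "i \<in> F" for i using F C that by auto
    have cb: "cball (fst i) (snd i) = {fst i - snd i..fst i + snd i}" for i :: "real \<times> real"
      by (rule cball_eq_atLeastAtMost)
    have hi: "(w has_integral (\<Sum>i\<in>F. integral (cball (fst i) (snd i)) w)) (\<Union>i\<in>F. cball (fst i) (snd i))"
    proof (rule has_integral_UN[OF F(2)])
      show "(w has_integral integral (cball (fst i) (snd i)) w) (cball (fst i) (snd i))" for i
        unfolding cb by (intro integrable_integral wint)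
      show "pairwise (\<lambda>i i'. negligible (cball (fst i) (snd i) \<inter> cball (fst i') (snd i'))) F"
        using C(3) F(1) unfolding pairwise_def disjnt_def by (metis negligible_empty subsetD)
    qed
    have "(\<Sum>i\<in>F. \<mu> * snd i) \<le> (\<Sum>i\<in>F. integral (cball (fst i) (snd i)) w)"
      using FK unfolding cb by (intro sum_mono) (fastforce simp: K_def split_beta)
    also have "\<dots> = integral (\<Union>i\<in>F. cball (fst i) (snd i)) w"
      using hi by (simp add: integral_unique)
    also have "\<dots> \<le> integral {-2*pi..4*pi} w"
    proof (rule integral_subset_le)
      show "(\<Union>i\<in>F. cball (fst i) (snd i)) \<subseteq> {-2*pi..4*pi}"
        unfolding cb using FK by (fastforce simp: K_def)
    qed (use hi wint w in auto)
    finally have *: "\<mu> * (\<Sum>i\<in>F. snd i) \<le> 3 * integral {0..2*pi} w"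
      by (simp only: three sum_distrib_left)
    have "measure lebesgue (\<Union>i\<in>F. cball (fst i) (5 * snd i)) \<le> (\<Sum>i\<in>F. measure lebesgue (cball (fst i) (5 * snd i)))"
      by (rule measure_UNION_le) (use F in auto)
    also have "\<dots> = (\<Sum>i\<in>F. 10 * snd i)"
    proof (rule sum.cong[OF refl])
      fix i assume "i \<in> F"
      then have "0 < snd i" using FK[of i] by (cases i) (auto simp: K_def)
      then show "measure lebesgue (cball (fst i) (5 * snd i)) = 10 * snd i"
        by (simp add: cball_eq_atLeastAtMost)
    qed
    also have "\<dots> \<le> 30 * integral {0..2*pi} w / \<mu>"
      unfolding sum_distrib_left[symmetric] using * \<mu> by (simp add: field_simps)
    finally show ?thesis .
  qed
  have "E \<in> lmeasurable"
    unfolding E_def by (rule fmeasurable_UN_bound[OF C(1) _ finite_bound]) auto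
  moreover have "measure lebesgue E \<le> 30 * integral {0..2*pi} w / \<mu>"
    unfolding E_def by (rule measure_UN_bound[OF C(1) _ finite_bound]) auto
  moreover have "\<theta> \<in> E" if "\<theta> \<in> {0..2*pi}" "0 < s" "s < 2*pi" "\<mu> * s < integral {\<theta>-s..\<theta>+s} w" for \<theta> s
  proof -
    have "(\<theta>, s) \<in> K" using that by (simp add: K_def)
    then have "\<theta> \<in> S" using that(2) unfolding S_def by (intro UN_I[of "(\<theta>, s)"]) auto
    then show ?thesis using C(4) unfolding E_def by blast
  qed
  ultimately show ?thesis by (rule that)
qed

text \<open>In a Stolz region at \<open>cis \<theta>\<close> the Poisson kernel of \<open>z\<close> is a dyadic kernel centred at \<open>\<theta>\<close> with
\<open>\<delta> = 1 - |z|\<close>, because \<open>|cis t - cis \<theta>| \<le> (1 + \<alpha>) |cis t - z|\<close>. Hence \<open>|u(z)|\<^sup>2\<close> is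
controlled by the averages of \<open>|u|\<^sup>2\<close> around \<open>\<theta>\<close>.\<close>

lemma stolz_maximal_weak_type_closed_disk:
  assumes u: "u holomorphic_on cball 0 1" and C: "square_mean u 1 \<le> C"
    and \<alpha>: "1 < \<alpha>" and l: "0 < l"
  shows "\<exists>E. E \<in> lmeasurable \<and> measure lebesgue E \<le> 8640 * (1 + \<alpha>)\<^sup>2 * C / l\<^sup>2 \<and>
    (\<forall>\<theta>\<in>{0..2*pi}. \<forall>z\<in>stolz_region \<alpha> (cis \<theta>). l < cmod (u z) \<longrightarrow> \<theta> \<in> E)"
proof -
  define w where "w t = (cmod (u (cis t)))\<^sup>2" for t
  have wc: "continuous_on UNIV w"
  proof -
    have "continuous_on UNIV (\<lambda>t. u (of_real 1 * cis t))"
      by (rule continuous_on_circle) (use u holomorphic_on_imp_continuous_on in auto)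
    then show ?thesis unfolding w_def by (intro continuous_intros) auto
  qed
  \<comment> \<open>The factor \<open>18\<close> is \<open>2 * 3\<^sup>2\<close>: \<open>1 - |z|\<^sup>2 \<le> 2 \<delta>\<close>, and \<open>3\<close> comes from the chord bound.\<close>
  define K where "K = 18 * (1 + \<alpha>)\<^sup>2"
  have Kpos: "K > 0" using \<alpha> by (simp add: K_def)
  \<comment> \<open>With this threshold, small averages at \<open>\<theta>\<close> force \<open>|u(z)|\<^sup>2 \<le> 8 K \<mu> < l\<^sup>2\<close>.\<close>
  define \<mu> where "\<mu> = l\<^sup>2 / (16 * K)"
  have \<mu>: "\<mu> > 0" using Kpos l by (simp add: \<mu>_def)
  have w_nonneg: "0 \<le> w t" for t by (simp add: w_def)
  have w_periodic: "w (t + 2*pi) = w t" for t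
    by (simp add: w_def flip: cis_mult)
  obtain E where E: "E \<in> lmeasurable" "measure lebesgue E \<le> 30 * integral {0..2*pi} w / \<mu>"
    "\<And>\<theta> s. \<theta> \<in> {0..2*pi} \<Longrightarrow> 0 < s \<Longrightarrow> s < 2*pi \<Longrightarrow> \<mu> * s < integral {\<theta>-s..\<theta>+s} w \<Longrightarrow> \<theta> \<in> E"
    using averages_weak_type[where w = w and \<mu> = \<mu>, OF wc w_nonneg w_periodic \<mu>] by blast
  have "integral {0..2*pi} w \<le> C" using C unfolding w_def square_mean_def by simp
  then have "30 * integral {0..2*pi} w / \<mu> \<le> 30 * C / \<mu>"
    using \<mu> by (intro divide_right_mono) auto
  also have "\<dots> = 8640 * (1 + \<alpha>)\<^sup>2 * C / l\<^sup>2"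
    using l \<alpha> by (simp add: \<mu>_def K_def field_simps)
  finally have E2: "measure lebesgue E \<le> 8640 * (1 + \<alpha>)\<^sup>2 * C / l\<^sup>2" using E(2) by linarith
  have E3: "\<theta> \<in> E" if \<theta>: "\<theta> \<in> {0..2*pi}" and z: "z \<in> stolz_region \<alpha> (cis \<theta>)" and big: "l < cmod (u z)" for \<theta> z
  proof (rule ccontr)
    assume "\<theta> \<notin> E"
    then have avg: "integral {\<theta>-s..\<theta>+s} w \<le> \<mu> * s" if "0 < s" "s < 2*pi" for s
      using E(3)[OF \<theta> that] by fastforce
    have z1: "cmod z < 1" "cmod (z - cis \<theta>) < \<alpha> * (1 - cmod z)"
      using z by (auto simp: stolz_region_def)
    define P where "P t = poisson_kernel z (cis t)" for t
    have ne: "cis t - z \<noteq> 0" for t using z1 by auto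
    have Pc: "continuous_on UNIV P"
      unfolding P_def poisson_kernel_def using ne by (intro continuous_intros) auto
    define \<delta> where "\<delta> = 1 - cmod z"
    have \<delta>: "0 < \<delta>" "\<delta> \<le> 1" using z1 by (auto simp: \<delta>_def)
    have Pb: "P t \<le> K * \<delta> / (max \<delta> \<bar>t - \<theta>\<bar>)\<^sup>2" if t: "\<bar>t - \<theta>\<bar> \<le> pi" for t
    proof -
      have d1: "\<delta> \<le> cmod (cis t - z)"
        using norm_triangle_ineq2[of "cis t" z] by (simp add: \<delta>_def)
      have "cmod (cis t - cis \<theta>) \<le> cmod (cis t - z) + cmod (z - cis \<theta>)"
        using norm_triangle_ineq[of "cis t - z" "z - cis \<theta>"] by simp
      also have "\<dots> \<le> cmod (cis t - z) + \<alpha> * cmod (cis t - z)"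
      proof -
        have "\<alpha> * \<delta> \<le> \<alpha> * cmod (cis t - z)" using d1 \<alpha> by (intro mult_left_mono) auto
        then show ?thesis using z1(2) by (simp add: \<delta>_def)
      qed
      finally have "\<bar>t - \<theta>\<bar> \<le> 3 * ((1 + \<alpha>) * cmod (cis t - z))"
        using chord_lower_bound[OF t] by (simp add: algebra_simps)
      moreover have "\<delta> \<le> 3 * ((1 + \<alpha>) * cmod (cis t - z))"
      proof -
        have "1 * cmod (cis t - z) \<le> (3 * (1 + \<alpha>)) * cmod (cis t - z)"
          using \<alpha> by (intro mult_right_mono) auto
        then show ?thesis using d1 by (simp add: algebra_simps)
      qed
      ultimately have "max \<delta> \<bar>t - \<theta>\<bar> \<le> 3 * ((1 + \<alpha>) * cmod (cis t - z))" by simp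
      then have "(max \<delta> \<bar>t - \<theta>\<bar>)\<^sup>2 \<le> (3 * ((1 + \<alpha>) * cmod (cis t - z)))\<^sup>2"
        using \<delta> by (intro power_mono) auto
      also have "\<dots> = (9 * (1 + \<alpha>)\<^sup>2) * (cmod (cis t - z))\<^sup>2" by (simp add: power_mult_distrib)
      finally have m: "(max \<delta> \<bar>t - \<theta>\<bar>)\<^sup>2 \<le> (9 * (1 + \<alpha>)\<^sup>2) * (cmod (cis t - z))\<^sup>2" .
      have "1 - (cmod z)\<^sup>2 = \<delta> * (1 + cmod z)" by (simp add: \<delta>_def algebra_simps power2_eq_square)
      also have "\<dots> \<le> \<delta> * 2" using \<delta> z1 by (intro mult_left_mono) auto
      finally have "P t \<le> \<delta> * 2 / (cmod (cis t - z))\<^sup>2"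
        unfolding P_def poisson_kernel_def by (intro divide_right_mono) auto
      also have "\<dots> \<le> K * \<delta> / (max \<delta> \<bar>t - \<theta>\<bar>)\<^sup>2"
      proof -
        have "(max \<delta> \<bar>t - \<theta>\<bar>)\<^sup>2 > 0" using \<delta> by auto
        moreover have "(cmod (cis t - z))\<^sup>2 > 0" using ne by auto
        moreover have "\<delta> * 2 * (max \<delta> \<bar>t - \<theta>\<bar>)\<^sup>2 \<le> \<delta> * 2 * ((9 * (1 + \<alpha>)\<^sup>2) * (cmod (cis t - z))\<^sup>2)"
          using \<delta> by (intro mult_left_mono m) auto
        ultimately show ?thesis
          by (simp only: pos_divide_le_eq times_divide_eq_left pos_le_divide_eq)
             (simp add: K_def algebra_simps)
      qed
      finally show ?thesis .
    qed
    have "(cmod (u z))\<^sup>2 \<le> 1 / (2*pi) * integral {\<theta>-pi..\<theta>+pi} (\<lambda>t. w t * P t)"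
      unfolding w_def P_def by (rule poisson_majorant[OF u z1(1)])
    also have "\<dots> \<le> 1 / (2*pi) * (8 * K * \<mu>)"
      by (intro mult_left_mono dyadic_kernel_estimate[where w = w and P = P and \<theta> = \<theta>, OF wc w_nonneg Pc Pb \<delta>])
         (use Kpos \<mu> avg in auto)
    also have "\<dots> \<le> 1 * (8 * K * \<mu>)"
      using Kpos \<mu> pi_gt3 by (intro mult_right_mono) (auto simp: field_simps)
    also have "\<dots> < l\<^sup>2" using Kpos l by (simp add: \<mu>_def)
    finally have "(cmod (u z))\<^sup>2 < l\<^sup>2" .
    moreover have "l\<^sup>2 \<le> (cmod (u z))\<^sup>2" using big l by (intro power_mono) auto
    ultimately show False by simp
  qed
  show ?thesis using E(1) E2 E3 by blast
qed

text \<open>A point where \<open>u\<close> exceeds \<open>l\<close> is one where all sufficiently close dilations of \<open>u\<close> exceed \<open>l\<close>, so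
the exceptional set lies in the lower limit of the exceptional sets of the dilations.\<close>

lemma stolz_maximal_weak_type:
  assumes u: "u holomorphic_on ball 0 1" and C: "\<And>r. 0 \<le> r \<Longrightarrow> r < 1 \<Longrightarrow> square_mean u r \<le> C"
    and \<alpha>: "1 < \<alpha>" and l: "0 < l"
  shows "\<exists>E\<in>sets lebesgue. emeasure lebesgue E \<le> ennreal (8640 * (1 + \<alpha>)\<^sup>2 * C / l\<^sup>2) \<and>
    (\<forall>\<theta>\<in>{0..2*pi}. \<forall>z\<in>stolz_region \<alpha> (cis \<theta>). l < cmod (u z) \<longrightarrow> \<theta> \<in> E)"
proof -
  define B where "B = 8640 * (1 + \<alpha>)\<^sup>2 * C / l\<^sup>2"
  define r where "r n = 1 - inverse (real (Suc n))" for n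
  have r: "0 \<le> r n" "r n < 1" for n by (auto simp: r_def field_simps)
  have rlim: "r \<longlonglongrightarrow> 1"
    unfolding r_def using tendsto_diff[OF tendsto_const LIMSEQ_inverse_real_of_nat, of 1] by simp
  have "\<exists>E. E \<in> lmeasurable \<and> measure lebesgue E \<le> B \<and>
    (\<forall>\<theta>\<in>{0..2*pi}. \<forall>z\<in>stolz_region \<alpha> (cis \<theta>). l < cmod (u (of_real (r n) * z)) \<longrightarrow> \<theta> \<in> E)" for n
  proof -
    have hol: "(\<lambda>z. u (of_real (r n) * z)) holomorphic_on cball 0 1"
      by (rule dilation_holomorphic[OF u r])
    have sq: "square_mean (\<lambda>z. u (of_real (r n) * z)) 1 \<le> C"
      using C[OF r] by (simp add: square_mean_def)
    show ?thesis
      unfolding B_def by (rule stolz_maximal_weak_type_closed_disk[OF hol sq \<alpha> l])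
  qed
  then have "\<forall>n. \<exists>E. E \<in> lmeasurable \<and> measure lebesgue E \<le> B \<and>
    (\<forall>\<theta>\<in>{0..2*pi}. \<forall>z\<in>stolz_region \<alpha> (cis \<theta>). l < cmod (u (of_real (r n) * z)) \<longrightarrow> \<theta> \<in> E)" ..
  from choice[OF this] obtain E where E: "\<And>n. E n \<in> lmeasurable" "\<And>n. measure lebesgue (E n) \<le> B"
    "\<And>n \<theta> z. \<theta> \<in> {0..2*pi} \<Longrightarrow> z \<in> stolz_region \<alpha> (cis \<theta>) \<Longrightarrow> l < cmod (u (of_real (r n) * z)) \<Longrightarrow> \<theta> \<in> E n"
    by blast
  define G where "G N = (\<Inter>n\<in>{N..}. E n)" for N
  have Gm: "G N \<in> sets lebesgue" for N
    unfolding G_def by (intro sets.countable_INT) (use E(1) in auto)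
  have Gle: "emeasure lebesgue (G N) \<le> ennreal B" for N
  proof -
    have "emeasure lebesgue (G N) \<le> emeasure lebesgue (E N)"
      by (rule emeasure_mono) (use E(1) in \<open>auto simp: G_def\<close>)
    also have "\<dots> = ennreal (measure lebesgue (E N))"
      using E(1) by (simp add: emeasure_eq_measure2)
    also have "\<dots> \<le> ennreal B" using E(2) by (intro ennreal_leI)
    finally show ?thesis .
  qed
  have "incseq G" by (auto simp: incseq_def G_def)
  then have "emeasure lebesgue (\<Union>N. G N) = (SUP N. emeasure lebesgue (G N))"
    using Gm by (intro SUP_emeasure_incseq[symmetric]) auto
  also have "\<dots> \<le> ennreal B" using Gle by (rule SUP_least)
  finally have le: "emeasure lebesgue (\<Union>N. G N) \<le> ennreal B" .
  have mem: "\<theta> \<in> (\<Union>N. G N)" if \<theta>: "\<theta> \<in> {0..2*pi}" and z: "z \<in> stolz_region \<alpha> (cis \<theta>)" and big: "l < cmod (u z)" for \<theta> z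
  proof -
    have "z \<in> ball 0 1" using z by (simp add: stolz_region_def)
    moreover have "continuous_on (ball 0 1) u" using u by (rule holomorphic_on_imp_continuous_on)
    ultimately have "isCont u z" by (simp add: continuous_on_eq_continuous_at)
    moreover have "(\<lambda>n. of_real (r n) * z) \<longlonglongrightarrow> of_real 1 * z" by (intro tendsto_intros rlim)
    ultimately have "(\<lambda>n. cmod (u (of_real (r n) * z))) \<longlonglongrightarrow> cmod (u z)"
      by (intro tendsto_norm isCont_tendsto_compose[of z u]) auto
    then have "\<forall>\<^sub>F n in sequentially. l < cmod (u (of_real (r n) * z))"
      using big by (rule order_tendstoD)
    then obtain N where "\<And>n. n \<ge> N \<Longrightarrow> l < cmod (u (of_real (r n) * z))"
      by (auto simp: eventually_sequentially)
    then show ?thesis using E(3)[OF \<theta> z] by (auto simp: G_def)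
  qed
  have "(\<Union>N. G N) \<in> sets lebesgue" using Gm by (intro sets.countable_UN) auto
  then show ?thesis using le mem unfolding B_def by blast
qed

section \<open>Boundary values in \<open>H\<^sup>2\<close>\<close>

text \<open>The Hardy space \<open>H\<^sup>2\<close>; by Parseval it consists of the power series with square summable coefficients.\<close>

definition hardy2 :: "(complex \<Rightarrow> complex) \<Rightarrow> bool"
  where "hardy2 u \<longleftrightarrow> u holomorphic_on disk \<and> (\<exists>C. \<forall>r. 0 \<le> r \<longrightarrow> r < 1 \<longrightarrow> square_mean u r \<le> C)"

text \<open>The limit along a fixed sequence of radii. Where it does not exist the value is unspecified, but for
continuous \<open>u\<close> the resulting function on the circle is measurable without exceptional set.\<close>

definition radial_limit :: "(complex \<Rightarrow> complex) \<Rightarrow> complex \<Rightarrow> complex"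
  where "radial_limit u \<zeta> = lim (\<lambda>n. u (of_real (1 - inverse (real (Suc n))) * \<zeta>))"

abbreviation circle_measure :: "real measure"
  where "circle_measure \<equiv> lebesgue_on {0..2*pi}"

lemma approaching_radii:
  "0 \<le> 1 - inverse (real (Suc n))" "1 - inverse (real (Suc n)) < 1"
  "(\<lambda>n. 1 - inverse (real (Suc n))) \<longlonglongrightarrow> 1"
  using tendsto_diff[OF tendsto_const LIMSEQ_inverse_real_of_nat, of 1] by (auto simp: field_simps)

text \<open>By Parseval, all square means of the remainder of the Taylor series are bounded by the tail of
the convergent series of the squared coefficients.\<close>

lemma hardy2_polynomial_approximation:
  assumes "hardy2 u" "0 < e"
  obtains s where "s holomorphic_on UNIV"
    "\<And>r. 0 \<le> r \<Longrightarrow> r < 1 \<Longrightarrow> square_mean (\<lambda>z. u z - s z) r \<le> e"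
proof -
  obtain C where u: "u holomorphic_on disk" and C: "\<And>r. 0 \<le> r \<Longrightarrow> r < 1 \<Longrightarrow> square_mean u r \<le> C"
    using assms by (auto simp: hardy2_def)
  define a where "a n = (deriv ^^ n) u 0 / fact n" for n
  have ps: "(\<lambda>n. a n * z ^ n) sums u z" if "cmod z < 1" for z
    using holomorphic_power_series[OF u, of z] that by (simp add: a_def)
  define c where "c n = 2 * pi * (cmod (a n))\<^sup>2" for n
  have c0: "c n \<ge> 0" for n by (simp add: c_def)
  have partial: "(\<Sum>n<N. c n * r ^ (2*n)) \<le> C" if r: "0 \<le> r" "r < 1" for r N
  proof -
    have s: "(\<lambda>n. c n * r ^ (2*n)) sums square_mean u r"
      unfolding c_def by (rule parseval[OF ps r])
    then have "(\<Sum>n<N. c n * r ^ (2*n)) \<le> (\<Sum>n. c n * r ^ (2*n))"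
      using c0 r by (intro sum_le_suminf) (auto simp: sums_iff)
    also have "\<dots> \<le> C" using s C[OF r] by (simp add: sums_iff)
    finally show ?thesis .
  qed
  have "(\<Sum>n<N. c n) \<le> C" for N
  proof (rule LIMSEQ_le_const2)
    show "(\<lambda>k. \<Sum>n<N. c n * (1 - inverse (real (Suc k))) ^ (2*n)) \<longlonglongrightarrow> (\<Sum>n<N. c n)"
    proof (rule tendsto_sum)
      fix n
      have "(\<lambda>k. c n * (1 - inverse (real (Suc k))) ^ (2*n)) \<longlonglongrightarrow> c n * 1 ^ (2*n)"
        by (intro tendsto_mult tendsto_const tendsto_power approaching_radii(3))
      then show "(\<lambda>k. c n * (1 - inverse (real (Suc k))) ^ (2*n)) \<longlonglongrightarrow> c n" by simp
    qed
    show "\<exists>M. \<forall>k\<ge>M. (\<Sum>n<N. c n * (1 - inverse (real (Suc k))) ^ (2*n)) \<le> C"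
      using partial[OF approaching_radii(1,2)] by blast
  qed
  then have csum: "summable c" using c0 by (intro summableI_nonneg_bounded)
  obtain N where N: "\<And>n. n \<ge> N \<Longrightarrow> norm (\<Sum>i. c (i + n)) < e"
    using suminf_exist_split[OF assms(2) csum] by auto
  define s where "s z = (\<Sum>n<N. a n * z ^ n)" for z
  define b where "b n = (if n < N then 0 else a n)" for n
  have "(\<lambda>n. b n * z ^ n) sums (u z - s z)" if "cmod z < 1" for z
  proof -
    have "(\<lambda>n. if n < N then a n * z ^ n else 0) sums (\<Sum>n | n < N. a n * z ^ n)"
      using sums_If_finite[of "\<lambda>n. n < N" "\<lambda>n. a n * z ^ n"] by simp
    moreover have "{n. n < N} = {..<N}" by auto
    ultimately have "(\<lambda>n. a n * z ^ n - (if n < N then a n * z ^ n else 0)) sums (u z - s z)"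
      unfolding s_def by (metis sums_diff[OF ps[OF that]])
    moreover have "a n * z ^ n - (if n < N then a n * z ^ n else 0) = b n * z ^ n" for n
      by (simp add: b_def)
    ultimately show ?thesis by simp
  qed
  note bps = this
  have "square_mean (\<lambda>z. u z - s z) r \<le> e" if r: "0 \<le> r" "r < 1" for r
  proof -
    have S: "(\<lambda>n. 2 * pi * (cmod (b n))\<^sup>2 * r ^ (2*n)) sums square_mean (\<lambda>z. u z - s z) r"
      by (rule parseval[OF bps r])
    have bsum: "summable (\<lambda>n. 2 * pi * (cmod (b n))\<^sup>2)"
      by (rule summable_comparison_test'[OF csum]) (auto simp: b_def c_def)
    have "square_mean (\<lambda>z. u z - s z) r \<le> (\<Sum>n. 2 * pi * (cmod (b n))\<^sup>2)"
      unfolding sums_unique[OF S]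
    proof (rule suminf_le)
      show "2 * pi * (cmod (b n))\<^sup>2 * r ^ (2*n) \<le> 2 * pi * (cmod (b n))\<^sup>2" for n
        using r by (intro mult_left_le power_le_one) auto
    qed (use S bsum in \<open>auto simp: sums_iff\<close>)
    also have "\<dots> = (\<Sum>n. 2 * pi * (cmod (b (n + N)))\<^sup>2) + (\<Sum>n<N. 2 * pi * (cmod (b n))\<^sup>2)"
      by (rule suminf_split_initial_segment[OF bsum])
    also have "\<dots> = (\<Sum>n. c (n + N))" by (simp add: b_def c_def)
    also have "\<dots> \<le> e" using N[of N] by simp
    finally show ?thesis .
  qed
  moreover have "s holomorphic_on UNIV" unfolding s_def by (intro holomorphic_intros)
  ultimately show ?thesis using that by blast
qed

lemma stolz_region_mono: "\<alpha> \<le> \<beta> \<Longrightarrow> stolz_region \<alpha> \<zeta> \<subseteq> stolz_region \<beta> \<zeta>"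
proof
  fix z assume "\<alpha> \<le> \<beta>" "z \<in> stolz_region \<alpha> \<zeta>"
  moreover from this have "\<alpha> * (1 - cmod z) \<le> \<beta> * (1 - cmod z)"
    by (intro mult_right_mono) (auto simp: stolz_region_def)
  ultimately show "z \<in> stolz_region \<beta> \<zeta>" by (auto simp: stolz_region_def intro: less_le_trans)
qed

lemma radius_in_stolz_region:
  assumes "1 < \<alpha>" "0 \<le> r" "r < 1" "cmod \<zeta> = 1"
  shows "of_real r * \<zeta> \<in> stolz_region \<alpha> \<zeta>"
proof -
  have "of_real r * \<zeta> - \<zeta> = of_real (r - 1) * \<zeta>" by (simp add: algebra_simps)
  then have "cmod (of_real r * \<zeta> - \<zeta>) = 1 - r"
    using assms by (simp add: norm_mult norm_of_real del: of_real_diff)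
  then show ?thesis using assms by (simp add: stolz_region_def norm_mult)
qed

lemma has_nontangential_limit_radius:
  assumes lim: "\<And>\<alpha>. 1 < \<alpha> \<Longrightarrow> (f \<longlongrightarrow> L) (at \<zeta> within stolz_region \<alpha> \<zeta>)" and "cmod \<zeta> = 1"
    and r: "\<And>n. 0 \<le> r n" "\<And>n. r n < 1" "r \<longlonglongrightarrow> 1"
  shows "(\<lambda>n. f (of_real (r n) * \<zeta>)) \<longlonglongrightarrow> L"
proof -
  have "filterlim (\<lambda>n. of_real (r n) * \<zeta>) (at \<zeta> within stolz_region 2 \<zeta>) sequentially"
    unfolding filterlim_at
  proof
    show "\<forall>\<^sub>F n in sequentially. of_real (r n) * \<zeta> \<in> stolz_region 2 \<zeta> \<and> of_real (r n) * \<zeta> \<noteq> \<zeta>"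
    proof (intro always_eventually allI conjI)
      fix n
      show "of_real (r n) * \<zeta> \<in> stolz_region 2 \<zeta>"
        by (rule radius_in_stolz_region) (use assms in auto)
      then show "of_real (r n) * \<zeta> \<noteq> \<zeta>" using assms(2) by (auto simp: stolz_region_def)
    qed
    show "(\<lambda>n. of_real (r n) * \<zeta>) \<longlonglongrightarrow> \<zeta>"
      using tendsto_mult[OF tendsto_of_real[OF r(3)] tendsto_const[of \<zeta>]] by simp
  qed
  with lim[of 2] show ?thesis by (rule filterlim_compose) simp
qed

lemma AE_circle_measure_negligible:
  assumes "negligible N" "\<And>t. t \<in> {0..2*pi} \<Longrightarrow> t \<notin> N \<Longrightarrow> P t"
  shows "AE t in circle_measure. P t"
proof -
  have "AE t in lebesgue. t \<in> {0..2*pi} \<longrightarrow> P t"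
    by (rule AE_I'[of N]) (use assms in \<open>auto simp: negligible_iff_null_sets\<close>)
  then show ?thesis by (subst AE_restrict_space_iff) auto
qed

text \<open>Subtracting a polynomial does not change the oscillation at a boundary point, and the remainder can be
made arbitrarily small in the square mean. The weak-type bound then makes the measure of the set as
small as desired.\<close>

lemma nontangential_oscillation_negligible:
  assumes u: "hardy2 u" and \<alpha>: "1 < \<alpha>" and l: "0 < l"
  shows "negligible {t \<in> {0..2*pi}. \<forall>d>0. \<exists>z\<in>stolz_region \<alpha> (cis t) \<inter> ball (cis t) d.
     \<exists>z'\<in>stolz_region \<alpha> (cis t) \<inter> ball (cis t) d. 3 * l \<le> cmod (u z - u z')}" (is "negligible ?B")
  unfolding negligible_outer_le
proof (intro allI impI)
  fix e :: real assume e: "0 < e"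
  define K where "K = 8640 * (1 + \<alpha>)\<^sup>2 / l\<^sup>2"
  have K: "K > 0" using \<alpha> l by (simp add: K_def)
  obtain s where s: "s holomorphic_on UNIV"
    "\<And>r. 0 \<le> r \<Longrightarrow> r < 1 \<Longrightarrow> square_mean (\<lambda>z. u z - s z) r \<le> e / K"
    using hardy2_polynomial_approximation[OF u, of "e / K"] e K by auto
  have "u holomorphic_on disk" using u by (simp add: hardy2_def)
  moreover have "s holomorphic_on disk" using s(1) by (rule holomorphic_on_subset) auto
  ultimately have hol: "(\<lambda>z. u z - s z) holomorphic_on disk" by (intro holomorphic_intros)
  have "\<exists>E\<in>sets lebesgue. emeasure lebesgue E \<le> ennreal (8640 * (1 + \<alpha>)\<^sup>2 * (e / K) / l\<^sup>2) \<and>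
    (\<forall>t\<in>{0..2*pi}. \<forall>z\<in>stolz_region \<alpha> (cis t). l < cmod (u z - s z) \<longrightarrow> t \<in> E)"
    by (rule stolz_maximal_weak_type[OF hol s(2) \<alpha> l])
  moreover have "8640 * (1 + \<alpha>)\<^sup>2 * (e / K) / l\<^sup>2 = e"
    using \<alpha> l by (simp add: K_def)
  ultimately have "\<exists>E\<in>sets lebesgue. emeasure lebesgue E \<le> ennreal e \<and>
    (\<forall>t\<in>{0..2*pi}. \<forall>z\<in>stolz_region \<alpha> (cis t). l < cmod (u z - s z) \<longrightarrow> t \<in> E)"
    by simp
  then obtain E where E: "E \<in> sets lebesgue" "emeasure lebesgue E \<le> ennreal e"
    "\<And>t z. t \<in> {0..2*pi} \<Longrightarrow> z \<in> stolz_region \<alpha> (cis t) \<Longrightarrow> l < cmod (u z - s z) \<Longrightarrow> t \<in> E"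
    by blast
  have "?B \<subseteq> E"
  proof
    fix t assume B: "t \<in> ?B"
    then have t: "t \<in> {0..2*pi}" by simp
    have "isCont s (cis t)"
      using s(1) by (meson UNIV_I continuous_on_eq_continuous_at holomorphic_on_imp_continuous_on open_UNIV)
    then obtain d where d: "d > 0" "\<And>z. dist z (cis t) < d \<Longrightarrow> cmod (s z - s (cis t)) < l / 2"
      using l unfolding continuous_at_eps_delta by (metis dist_norm half_gt_zero)
    obtain z z' where z: "z \<in> stolz_region \<alpha> (cis t)" "dist z (cis t) < d"
      "z' \<in> stolz_region \<alpha> (cis t)" "dist z' (cis t) < d" "3 * l \<le> cmod (u z - u z')"
      using B d(1) by (auto simp: dist_commute)
    show "t \<in> E"
    proof (rule ccontr)
      assume "t \<notin> E"
      then have 1: "cmod (u z - s z) \<le> l" "cmod (u z' - s z') \<le> l"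
        using E(3)[OF t] z by force+
      have 2: "cmod (s z - s (cis t)) < l / 2" "cmod (s z' - s (cis t)) < l / 2"
        using d(2) z by auto
      have "cmod (u z - u z') = cmod ((u z - s z) - (u z' - s z') + ((s z - s (cis t)) - (s z' - s (cis t))))"
        by simp
      also have "\<dots> \<le> cmod ((u z - s z) - (u z' - s z')) + cmod ((s z - s (cis t)) - (s z' - s (cis t)))"
        by (rule norm_triangle_ineq)
      also have "\<dots> \<le> (cmod (u z - s z) + cmod (u z' - s z')) + (cmod (s z - s (cis t)) + cmod (s z' - s (cis t)))"
        by (intro add_mono norm_triangle_ineq4)
      finally have "cmod (u z - u z') \<le> (cmod (u z - s z) + cmod (u z' - s z')) + (cmod (s z - s (cis t)) + cmod (s z' - s (cis t)))" .
      then show False using 1 2 z(5) by linarith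
    qed
  qed
  moreover have "E \<in> lmeasurable"
    using E(1,2) by (auto intro!: fmeasurableI simp: less_top[symmetric] top_unique)
  moreover have "measure lebesgue E \<le> e"
    using E(2) e by (simp add: measure_def enn2real_leI)
  ultimately show "\<exists>T. ?B \<subseteq> T \<and> T \<in> lmeasurable \<and> measure lebesgue T \<le> e" by blast
qed

text \<open>Countably many apertures and countably many levels suffice. Outside the union of the exceptional
sets \<open>u\<close> is Cauchy in every Stolz region, and all these regions share the radius, so the limits agree.\<close>

theorem hardy2_nontangential_limit:
  assumes u: "hardy2 u"
  shows "has_nontangential_limit u (radial_limit u)"
proof -
  define Bad where "Bad k m = {t \<in> {0..2*pi}. \<forall>d>0. \<exists>z\<in>stolz_region (real (Suc (Suc k))) (cis t) \<inter> ball (cis t) d.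
     \<exists>z'\<in>stolz_region (real (Suc (Suc k))) (cis t) \<inter> ball (cis t) d. 3 * inverse (real (Suc m)) \<le> cmod (u z - u z')}" for k m
  have "negligible (Bad k m)" for k m
    unfolding Bad_def by (rule nontangential_oscillation_negligible[OF u]) auto
  then have neg: "negligible (\<Union>k. \<Union>m. Bad k m)"
    by (intro negligible_countable_Union[of "range _"] negligible_countable_Union) (auto intro!: negligible_countable_Union)
  show ?thesis
    unfolding has_nontangential_limit_def
  proof (rule AE_circle_measure_negligible[OF neg])
    fix t assume t: "t \<in> {0..2*pi}" "t \<notin> (\<Union>k. \<Union>m. Bad k m)"
    let ?b = "cis t"
    have osc: "\<exists>d>0. \<forall>z\<in>stolz_region \<alpha> ?b \<inter> ball ?b d. \<forall>z'\<in>stolz_region \<alpha> ?b \<inter> ball ?b d. cmod (u z - u z') < e"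
      if \<alpha>: "1 < \<alpha>" and e: "0 < e" for \<alpha> e
    proof -
      obtain k where "\<alpha> \<le> real k" using real_arch_simple by blast
      then have k: "\<alpha> \<le> real (Suc (Suc k))" by simp
      obtain m where m: "inverse (real (Suc m)) < e / 3" using reals_Archimedean[of "e/3"] e by auto
      have "t \<notin> Bad k m" using t(2) by blast
      then obtain d where d: "d > 0" "\<And>z z'. z \<in> stolz_region (real (Suc (Suc k))) ?b \<inter> ball ?b d \<Longrightarrow>
          z' \<in> stolz_region (real (Suc (Suc k))) ?b \<inter> ball ?b d \<Longrightarrow> cmod (u z - u z') < 3 * inverse (real (Suc m))"
        using t(1) unfolding Bad_def by (auto simp: not_le simp del: of_nat_Suc)
      have "cmod (u z - u z') < e" if "z \<in> stolz_region \<alpha> ?b \<inter> ball ?b d" "z' \<in> stolz_region \<alpha> ?b \<inter> ball ?b d" for z z'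
      proof -
        have "cmod (u z - u z') < 3 * inverse (real (Suc m))"
          by (rule d(2)) (use that stolz_region_mono[OF k, of ?b] in auto)
        then show ?thesis using m by linarith
      qed
      then show ?thesis using d(1) by blast
    qed
    define r where "r n = 1 - inverse (real (Suc n))" for n
    define x where "x n = of_real (r n) * ?b" for n
    have xS: "x n \<in> stolz_region \<alpha> ?b" if "1 < \<alpha>" for \<alpha> n
      unfolding x_def r_def by (rule radius_in_stolz_region[OF that approaching_radii(1,2)]) simp
    have "x \<longlonglongrightarrow> of_real 1 * ?b"
      unfolding x_def r_def by (intro tendsto_intros approaching_radii)
    then have xl: "\<forall>\<^sub>F n in sequentially. x n \<in> ball ?b d" if "d > 0" for d
      using that by (auto simp: tendsto_iff dist_commute)
    have "Cauchy (\<lambda>n. u (x n))"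
      unfolding Cauchy_def
    proof (intro allI impI)
      fix e :: real assume "0 < e"
      then obtain d where d: "d > 0" "\<forall>z\<in>stolz_region 2 ?b \<inter> ball ?b d. \<forall>z'\<in>stolz_region 2 ?b \<inter> ball ?b d. cmod (u z - u z') < e"
        using osc[of 2 e] by auto
      obtain N where "\<forall>n\<ge>N. x n \<in> ball ?b d" using xl[OF d(1)] by (auto simp: eventually_sequentially)
      then show "\<exists>M. \<forall>m\<ge>M. \<forall>n\<ge>M. dist (u (x m)) (u (x n)) < e"
        using d(2) xS[of 2] by (intro exI[of _ N]) (auto simp: dist_norm)
    qed
    then have L: "(\<lambda>n. u (x n)) \<longlonglongrightarrow> radial_limit u ?b"
      unfolding radial_limit_def x_def r_def by (simp add: Cauchy_convergent_iff convergent_LIMSEQ_iff)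
    show "\<forall>\<alpha>>1. (u \<longlongrightarrow> radial_limit u ?b) (at ?b within stolz_region \<alpha> ?b)"
    proof (intro allI impI)
      fix \<alpha> :: real assume \<alpha>: "1 < \<alpha>"
      show "(u \<longlongrightarrow> radial_limit u ?b) (at ?b within stolz_region \<alpha> ?b)"
        unfolding tendsto_iff
      proof (intro allI impI)
        fix e :: real assume e: "0 < e"
        obtain d where d: "d > 0" "\<forall>z\<in>stolz_region \<alpha> ?b \<inter> ball ?b d. \<forall>z'\<in>stolz_region \<alpha> ?b \<inter> ball ?b d. cmod (u z - u z') < e/2"
          using osc[OF \<alpha>, of "e/2"] e by auto
        have "\<forall>\<^sub>F n in sequentially. dist (u (x n)) (radial_limit u ?b) < e/2"
          using tendstoD[OF L, of "e/2"] e by simp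
        then have "\<forall>\<^sub>F n in sequentially. x n \<in> ball ?b d \<and> dist (u (x n)) (radial_limit u ?b) < e/2"
          using xl[OF d(1)] by eventually_elim auto
        then obtain n where n: "x n \<in> ball ?b d" "dist (u (x n)) (radial_limit u ?b) < e/2"
          by (auto simp: eventually_sequentially)
        have "dist (u z) (radial_limit u ?b) < e" if "z \<in> stolz_region \<alpha> ?b" "dist z ?b < d" for z
        proof -
          have "dist (u z) (u (x n)) < e/2"
            using d(2) that n(1) xS[OF \<alpha>] by (auto simp: dist_norm norm_minus_commute)
          then show ?thesis using n(2) dist_triangle[of "u z" "radial_limit u ?b" "u (x n)"] by linarith
        qed
        then show "\<forall>\<^sub>F z in at ?b within stolz_region \<alpha> ?b. dist (u z) (radial_limit u ?b) < e"
          unfolding eventually_at using d(1) by auto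
      qed
    qed
  qed
qed

lemma measurable_on_circle:
  assumes "continuous_on disk u" "0 \<le> r" "r < 1"
  shows "(\<lambda>t. u (of_real r * cis t)) \<in> borel_measurable circle_measure"
proof (rule continuous_imp_measurable_on_sets_lebesgue)
  show "continuous_on {0..2*pi} (\<lambda>t. u (of_real r * cis t))"
    by (rule continuous_on_circle, rule continuous_on_subset[OF assms(1)]) (use assms in auto)
qed auto

lemma measurable_radial_limit:
  assumes "continuous_on disk u"
  shows "(\<lambda>t. radial_limit u (cis t)) \<in> borel_measurable circle_measure"
  unfolding radial_limit_def
  by (intro borel_measurable_lim_metric measurable_on_circle[OF assms] approaching_radii)

lemma nn_integral_square_mean:
  assumes "continuous_on (cball 0 \<bar>r\<bar>) u"
  shows "(\<integral>\<^sup>+t. ennreal ((cmod (u (of_real r * cis t)))\<^sup>2) \<partial>circle_measure) = ennreal (square_mean u r)"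
  unfolding square_mean_def
  by (intro nn_integral_lebesgue_on_continuous continuous_intros continuous_on_circle[OF assms]) auto

text \<open>Fatou's lemma along the radii. For \<open>s = 0\<close> it bounds the boundary function; for a Taylor polynomial
it transfers the approximation to the boundary.\<close>

lemma radial_limit_fatou:
  assumes lim: "has_nontangential_limit u (radial_limit u)" and u: "continuous_on disk u"
    and s: "continuous_on UNIV s"
    and e: "\<And>r. 0 \<le> r \<Longrightarrow> r < 1 \<Longrightarrow> square_mean (\<lambda>z. u z - s z) r \<le> e"
  shows "(\<integral>\<^sup>+t. ennreal ((cmod (radial_limit u (cis t) - s (cis t)))\<^sup>2) \<partial>circle_measure) \<le> ennreal e"
proof -
  define r where "r n = 1 - inverse (real (Suc n))" for n
  have r: "0 \<le> r n" "r n < 1" "r \<longlonglongrightarrow> 1" for n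
    using approaching_radii unfolding r_def by auto
  define F where "F n t = ennreal ((cmod (u (of_real (r n) * cis t) - s (of_real (r n) * cis t)))\<^sup>2)" for n t
  have us: "continuous_on disk (\<lambda>z. u z - s z)"
    by (intro continuous_intros u continuous_on_subset[OF s]) auto
  have meas: "F n \<in> borel_measurable circle_measure" for n
    using measurable_on_circle[OF us r(1,2), of n] unfolding F_def by measurable
  have "AE t in circle_measure. ennreal ((cmod (radial_limit u (cis t) - s (cis t)))\<^sup>2) = liminf (\<lambda>n. F n t)"
    using lim unfolding has_nontangential_limit_def
  proof eventually_elim
    case (elim t)
    have "(\<lambda>n. u (of_real (r n) * cis t)) \<longlonglongrightarrow> radial_limit u (cis t)"
      by (rule has_nontangential_limit_radius) (use elim r in auto)
    moreover have "(\<lambda>n. s (of_real (r n) * cis t)) \<longlonglongrightarrow> s (cis t)"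
    proof (rule isCont_tendsto_compose[of _ s])
      show "isCont s (cis t)" using s by (simp add: continuous_on_eq_continuous_at)
      show "(\<lambda>n. of_real (r n) * cis t) \<longlonglongrightarrow> cis t"
        using tendsto_mult[OF tendsto_of_real[OF r(3)] tendsto_const[of "cis t"]] by simp
    qed
    ultimately have "(\<lambda>n. F n t) \<longlonglongrightarrow> ennreal ((cmod (radial_limit u (cis t) - s (cis t)))\<^sup>2)"
      unfolding F_def by (intro tendsto_intros)
    then show ?case by (simp add: lim_imp_Liminf)
  qed
  then have "(\<integral>\<^sup>+t. ennreal ((cmod (radial_limit u (cis t) - s (cis t)))\<^sup>2) \<partial>circle_measure)
      = (\<integral>\<^sup>+t. liminf (\<lambda>n. F n t) \<partial>circle_measure)"
    by (rule nn_integral_cong_AE)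
  also have "\<dots> \<le> liminf (\<lambda>n. \<integral>\<^sup>+t. F n t \<partial>circle_measure)"
    by (rule nn_integral_liminf) (rule meas)
  also have "\<dots> \<le> liminf (\<lambda>n::nat. ennreal e)"
  proof (rule Liminf_mono, rule always_eventually, rule allI)
    fix n
    have "(\<integral>\<^sup>+t. F n t \<partial>circle_measure) = ennreal (square_mean (\<lambda>z. u z - s z) (r n))"
      unfolding F_def
      by (rule nn_integral_square_mean, rule continuous_on_subset[OF us]) (use r(1,2)[of n] in auto)
    also have "\<dots> \<le> ennreal e" by (intro ennreal_leI e r)
    finally show "(\<integral>\<^sup>+t. F n t \<partial>circle_measure) \<le> ennreal e" .
  qed
  also have "\<dots> = ennreal e" by (simp add: Liminf_const)
  finally show ?thesis .
qed

lemma emeasure_circle_measure: "emeasure circle_measure (space circle_measure) = ennreal (2*pi)"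
  by (simp add: emeasure_restrict_space space_restrict_space)

lemma square_norm_sum3: "(cmod (a + b + c))\<^sup>2 \<le> 3 * (cmod a)\<^sup>2 + 3 * (cmod b)\<^sup>2 + 3 * (cmod c)\<^sup>2"
proof -
  have "(cmod (a + b + c))\<^sup>2 \<le> (cmod a + cmod b + cmod c)\<^sup>2"
    by (intro power_mono order_trans[OF norm_triangle_ineq] add_right_mono norm_triangle_ineq) auto
  also have "\<dots> \<le> 3 * (cmod a)\<^sup>2 + 3 * (cmod b)\<^sup>2 + 3 * (cmod c)\<^sup>2"
  proof -
    have "0 \<le> (cmod a - cmod b)\<^sup>2 + (cmod b - cmod c)\<^sup>2 + (cmod a - cmod c)\<^sup>2" by simp
    then show ?thesis by (simp add: power2_eq_square algebra_simps)
  qed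
  finally show ?thesis .
qed

text \<open>With a polynomial \<open>s\<close> close to \<open>u\<close> in all square means, the difference between the boundary function and
\<open>u\<^sub>r\<close> splits into the boundary error of \<open>s\<close>, the modulus of continuity of \<open>s\<close>, and the error on the
circle of radius \<open>r\<close>.\<close>

theorem hardy2_mean_convergence:
  assumes "hardy2 u"
  shows "((\<lambda>r. \<integral>\<^sup>+t. ennreal ((cmod (radial_limit u (cis t) - u (of_real r * cis t)))\<^sup>2) \<partial>circle_measure)
    \<longlongrightarrow> 0) (at_left 1)"
    and "(\<integral>\<^sup>+t. ennreal ((cmod (radial_limit u (cis t)))\<^sup>2) \<partial>circle_measure) < \<infinity>"
proof -
  have u: "continuous_on disk u" using assms by (auto simp: hardy2_def holomorphic_on_imp_continuous_on)
  have lim: "has_nontangential_limit u (radial_limit u)" using assms by (rule hardy2_nontangential_limit)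
  obtain C where C: "\<And>r. 0 \<le> r \<Longrightarrow> r < 1 \<Longrightarrow> square_mean u r \<le> C" using assms by (auto simp: hardy2_def)
  show "(\<integral>\<^sup>+t. ennreal ((cmod (radial_limit u (cis t)))\<^sup>2) \<partial>circle_measure) < \<infinity>"
    using radial_limit_fatou[OF lim u, of "\<lambda>_. 0" C] C by (auto simp: order.strict_trans1)
  let ?X = "\<lambda>r. \<integral>\<^sup>+t. ennreal ((cmod (radial_limit u (cis t) - u (of_real r * cis t)))\<^sup>2) \<partial>circle_measure"
  have main: "\<forall>\<^sub>F r in at_left 1. ?X r \<le> ennreal (9 * e)" if e: "0 < e" for e
  proof -
    obtain s where s: "s holomorphic_on UNIV" "\<And>r. 0 \<le> r \<Longrightarrow> r < 1 \<Longrightarrow> square_mean (\<lambda>z. u z - s z) r \<le> e"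
      using hardy2_polynomial_approximation[OF assms e] by blast
    have sc: "continuous_on UNIV s" using s(1) by (rule holomorphic_on_imp_continuous_on)
    have "uniformly_continuous_on (cball 0 1) s"
      by (intro compact_uniformly_continuous continuous_on_subset[OF sc]) auto
    moreover have "sqrt (e / (2*pi)) > 0" using e by simp
    ultimately obtain d where d: "d > 0" "\<And>x y. x \<in> cball 0 1 \<Longrightarrow> y \<in> cball 0 1 \<Longrightarrow> dist y x < d \<Longrightarrow> dist (s y) (s x) < sqrt (e / (2*pi))"
      unfolding uniformly_continuous_on_def by blast
    have "\<forall>\<^sub>F r in at_left (1::real). max 0 (1 - d) < r \<and> r < 1"
      using d(1) eventually_at_left_real[of "max 0 (1-d)" 1] by simp
    then show ?thesis
    proof eventually_elim
      case (elim r)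
      then have r: "0 \<le> r" "r < 1" "1 - r < d" by auto
      have us: "continuous_on disk (\<lambda>z. u z - s z)"
        by (intro continuous_intros u continuous_on_subset[OF sc]) auto
      note [measurable] = measurable_radial_limit[OF u] measurable_on_circle[OF u r(1,2)]
        measurable_on_circle[OF continuous_on_subset[OF sc subset_UNIV] r(1,2)]
      have [measurable]: "(\<lambda>t. s (cis t)) \<in> borel_measurable circle_measure"
        by (rule continuous_imp_measurable_on_sets_lebesgue)
          (auto intro!: continuous_on_compose2[OF sc] continuous_intros)
      define a b c where "a t = radial_limit u (cis t) - s (cis t)"
        and "b t = s (cis t) - s (of_real r * cis t)"
        and "c t = s (of_real r * cis t) - u (of_real r * cis t)" for t
      have [measurable]: "a \<in> borel_measurable circle_measure" "b \<in> borel_measurable circle_measure"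
        "c \<in> borel_measurable circle_measure"
        unfolding a_def b_def c_def by measurable
      have "?X r \<le> (\<integral>\<^sup>+t. 3 * ennreal ((cmod (a t))\<^sup>2) + 3 * ennreal ((cmod (b t))\<^sup>2) + 3 * ennreal ((cmod (c t))\<^sup>2) \<partial>circle_measure)"
      proof (rule nn_integral_mono)
        fix t
        have "radial_limit u (cis t) - u (of_real r * cis t) = a t + b t + c t"
          by (simp add: a_def b_def c_def)
        then have "ennreal ((cmod (radial_limit u (cis t) - u (of_real r * cis t)))\<^sup>2)
            \<le> ennreal (3 * (cmod (a t))\<^sup>2 + 3 * (cmod (b t))\<^sup>2 + 3 * (cmod (c t))\<^sup>2)"
          using square_norm_sum3 by (simp only: ennreal_leI)
        then show "ennreal ((cmod (radial_limit u (cis t) - u (of_real r * cis t)))\<^sup>2)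
            \<le> 3 * ennreal ((cmod (a t))\<^sup>2) + 3 * ennreal ((cmod (b t))\<^sup>2) + 3 * ennreal ((cmod (c t))\<^sup>2)"
          by (simp add: ennreal_plus ennreal_mult)
      qed
      also have "\<dots> = 3 * (\<integral>\<^sup>+t. ennreal ((cmod (a t))\<^sup>2) \<partial>circle_measure)
          + 3 * (\<integral>\<^sup>+t. ennreal ((cmod (b t))\<^sup>2) \<partial>circle_measure)
          + 3 * (\<integral>\<^sup>+t. ennreal ((cmod (c t))\<^sup>2) \<partial>circle_measure)"
        by (simp add: nn_integral_add nn_integral_cmult)
      also have "\<dots> \<le> 3 * ennreal e + 3 * ennreal e + 3 * ennreal e"
      proof (intro add_mono mult_left_mono)
        show "(\<integral>\<^sup>+t. ennreal ((cmod (a t))\<^sup>2) \<partial>circle_measure) \<le> ennreal e"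
          unfolding a_def by (rule radial_limit_fatou[OF lim u sc s(2)])
        have "(\<integral>\<^sup>+t. ennreal ((cmod (b t))\<^sup>2) \<partial>circle_measure) \<le> (\<integral>\<^sup>+t. ennreal (e / (2*pi)) \<partial>circle_measure)"
        proof (intro nn_integral_mono ennreal_leI)
          fix t
          have "cis t - of_real r * cis t = of_real (1 - r) * cis t" by (simp add: algebra_simps)
          then have "dist (cis t) (of_real r * cis t) < d"
            using r by (simp add: dist_norm norm_mult norm_of_real del: of_real_diff)
          then have "dist (s (cis t)) (s (of_real r * cis t)) < sqrt (e / (2*pi))"
            using r by (intro d(2)) (auto simp: norm_mult)
          then have "(cmod (b t))\<^sup>2 \<le> (sqrt (e / (2*pi)))\<^sup>2"
            by (intro power_mono) (auto simp: b_def dist_norm)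
          then show "(cmod (b t))\<^sup>2 \<le> e / (2*pi)" using e by simp
        qed
        also have "\<dots> = ennreal (e / (2*pi)) * ennreal (2*pi)"
          by (simp only: nn_integral_const emeasure_circle_measure)
        also have "\<dots> = ennreal e" using e by (simp flip: ennreal_mult)
        finally show "(\<integral>\<^sup>+t. ennreal ((cmod (b t))\<^sup>2) \<partial>circle_measure) \<le> ennreal e" .
        have "(\<integral>\<^sup>+t. ennreal ((cmod (c t))\<^sup>2) \<partial>circle_measure) = ennreal (square_mean (\<lambda>z. u z - s z) r)"
          unfolding c_def
          by (subst norm_minus_commute, rule nn_integral_square_mean, rule continuous_on_subset[OF us]) (use r in auto)
        also have "\<dots> \<le> ennreal e" by (intro ennreal_leI s(2) r)
        finally show "(\<integral>\<^sup>+t. ennreal ((cmod (c t))\<^sup>2) \<partial>circle_measure) \<le> ennreal e" .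
      qed auto
      also have "\<dots> = ennreal (9 * e)"
        using e by (simp add: ennreal_mult flip: distrib_right)
      finally show ?case .
    qed
  qed
  show "(?X \<longlongrightarrow> 0) (at_left 1)"
  proof (rule order_tendstoI)
    fix a :: ennreal assume "0 < a"
    have "\<exists>e>0. ennreal e < a"
    proof (cases a)
      case (real x)
      then show ?thesis using \<open>0 < a\<close> by (intro exI[of _ "x/2"]) (auto simp: ennreal_lessI)
    next
      case top
      then show ?thesis by (intro exI[of _ 1]) auto
    qed
    then obtain e where e: "0 < e" "ennreal e < a" by blast
    show "\<forall>\<^sub>F r in at_left 1. ?X r < a"
      using main[of "e/9"] e by (auto elim!: eventually_mono intro: order.strict_trans1)
  qed simp
qed

section \<open>Factorization of \<open>H\<^sup>p\<close> functions\<close>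

text \<open>On the unit circle every real trigonometric polynomial is the real part of a polynomial in \<open>z\<close>, since
\<open>cis (-n t)\<close> and \<open>cis (n t)\<close> are conjugate.\<close>

definition trigonometric_polynomial :: "(complex \<Rightarrow> real) \<Rightarrow> bool"
  where "trigonometric_polynomial v \<longleftrightarrow> (\<exists>Q. \<forall>z\<in>sphere 0 1. v z = Re (poly Q z))"

lemma trigonometric_polynomial_add:
  assumes "trigonometric_polynomial v" "trigonometric_polynomial w"
  shows "trigonometric_polynomial (\<lambda>z. v z + w z)"
proof -
  obtain Q R where "\<forall>z\<in>sphere 0 1. v z = Re (poly Q z)" "\<forall>z\<in>sphere 0 1. w z = Re (poly R z)"
    using assms unfolding trigonometric_polynomial_def by blast
  then show ?thesis unfolding trigonometric_polynomial_def by (intro exI[of _ "Q + R"]) auto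
qed

text \<open>Removing the constant coefficients of both polynomials and using \<open>z z\<^sup>* = 1\<close> lowers both degrees by one; the
remaining terms are real parts of polynomials after a conjugation.\<close>

lemma trigonometric_polynomial_cnj_product:
  "trigonometric_polynomial (\<lambda>z. Re (poly P z * cnj (poly Q z)))"
proof (induction P arbitrary: Q)
  case 0
  then show ?case unfolding trigonometric_polynomial_def by (intro exI[of _ 0]) auto
next
  case (pCons a P)
  obtain b R where Q: "Q = pCons b R" by (cases Q)
  have "trigonometric_polynomial (\<lambda>z. Re (poly (smult (cnj a) Q + smult (cnj b) (pCons 0 P)) z))"
    unfolding trigonometric_polynomial_def by blast
  from trigonometric_polynomial_add[OF this pCons.IH[of R]]
  obtain S where S: "\<And>z. z \<in> sphere 0 1 \<Longrightarrow>
      Re (poly (smult (cnj a) Q + smult (cnj b) (pCons 0 P)) z) + Re (poly P z * cnj (poly R z)) = Re (poly S z)"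
    unfolding trigonometric_polynomial_def by blast
  show ?case
    unfolding trigonometric_polynomial_def
  proof (intro exI[of _ S] ballI)
    fix z :: complex assume z: "z \<in> sphere 0 1"
    then have "z * cnj z = 1" by (simp add: complex_norm_square[symmetric])
    then have zz: "poly P z * cnj (poly R z) = (z * poly P z) * (cnj z * cnj (poly R z))"
      by (simp add: algebra_simps)
    have "poly (pCons a P) z * cnj (poly Q z)
        = a * cnj (poly Q z) + cnj b * (z * poly P z) + (z * poly P z) * (cnj z * cnj (poly R z))"
      by (simp add: Q algebra_simps)
    also have "Re \<dots> = Re (poly (smult (cnj a) Q + smult (cnj b) (pCons 0 P)) z) + Re (poly P z * cnj (poly R z))"
      unfolding zz by (simp add: algebra_simps)
    finally show "Re (poly (pCons a P) z * cnj (poly Q z)) = Re (poly S z)" using S[OF z] by simp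
  qed
qed

text \<open>This rests on \<open>Re a Re b = Re (a b)/2 + Re (a b\<^sup>*)/2\<close>.\<close>

lemma trigonometric_polynomial_mult:
  assumes "trigonometric_polynomial v" "trigonometric_polynomial w"
  shows "trigonometric_polynomial (\<lambda>z. v z * w z)"
proof -
  obtain Q R where QR: "\<forall>z\<in>sphere 0 1. v z = Re (poly Q z)" "\<forall>z\<in>sphere 0 1. w z = Re (poly R z)"
    using assms unfolding trigonometric_polynomial_def by blast
  have "trigonometric_polynomial (\<lambda>z. Re (poly (smult (1/2) Q * R) z))"
    unfolding trigonometric_polynomial_def by blast
  from trigonometric_polynomial_add[OF this trigonometric_polynomial_cnj_product[of "smult (1/2) Q" R]]
  obtain S where S: "\<And>z. z \<in> sphere 0 1 \<Longrightarrow>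
      Re (poly (smult (1/2) Q * R) z) + Re (poly (smult (1/2) Q) z * cnj (poly R z)) = Re (poly S z)"
    unfolding trigonometric_polynomial_def by blast
  have "v z * w z = Re (poly S z)" if "z \<in> sphere 0 1" for z
    using S[OF that, symmetric] QR that by (simp add: field_simps)
  then show ?thesis unfolding trigonometric_polynomial_def by blast
qed

lemma trigonometric_approximation:
  assumes "continuous_on (sphere 0 1) f" "0 < e"
  obtains Q where "\<And>z. cmod z = 1 \<Longrightarrow> \<bar>f z - Re (poly Q z)\<bar> < e"
proof -
  have "\<exists>g. trigonometric_polynomial g \<and> (\<forall>x\<in>sphere 0 1. \<bar>f x - g x\<bar> < e)"
  proof (rule Stone_Weierstrass_HOL[where P = trigonometric_polynomial])
    show "trigonometric_polynomial (\<lambda>x. c)" for c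
      unfolding trigonometric_polynomial_def by (intro exI[of _ "[:of_real c:]"]) auto
    show "continuous_on (sphere 0 1) v" if v: "trigonometric_polynomial v" for v
    proof -
      obtain Q where "\<And>z. z \<in> sphere 0 1 \<Longrightarrow> v z = Re (poly Q z)"
        using v unfolding trigonometric_polynomial_def by blast
      then show ?thesis
        by (subst continuous_on_cong[OF refl]) (auto intro!: continuous_intros)
    qed
    show "\<exists>g. trigonometric_polynomial g \<and> g x \<noteq> g y" if "x \<in> sphere 0 1 \<and> y \<in> sphere 0 1 \<and> x \<noteq> y" for x y
    proof -
      have "trigonometric_polynomial Re"
        unfolding trigonometric_polynomial_def by (intro exI[of _ "[:0, 1:]"]) auto
      moreover have "trigonometric_polynomial Im"
        unfolding trigonometric_polynomial_def by (intro exI[of _ "[:0, -\<i>:]"]) auto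
      ultimately show ?thesis using that by (metis complex_eq_iff)
    qed
  qed (use assms trigonometric_polynomial_add trigonometric_polynomial_mult in auto)
  then obtain g where g: "trigonometric_polynomial g" "\<And>x. x \<in> sphere 0 1 \<Longrightarrow> \<bar>f x - g x\<bar> < e" by blast
  then obtain Q where "\<And>z. z \<in> sphere 0 1 \<Longrightarrow> g z = Re (poly Q z)"
    unfolding trigonometric_polynomial_def by blast
  then show ?thesis using g(2) by (intro that[of Q]) (metis mem_sphere_0)
qed

text \<open>The function \<open>exp Q\<close> plays the role of an outer function that majorizes \<open>h\<close>. Adding \<open>1\<close> to \<open>|h|\<^sup>p\<close> makes
the logarithm continuous despite the zeros of \<open>h\<close>, and only boundedness of the means matters, so the factor
\<open>2\<close> leaves room for the approximation error.\<close>

lemma outer_majorant: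
  fixes h :: "complex \<Rightarrow> complex"
  assumes h: "h holomorphic_on cball 0 1" and p: "0 < p"
  obtains Q where "\<And>z. cmod z \<le> 1 \<Longrightarrow> cmod (h z) \<le> exp (Re (poly Q z))"
    "\<And>z. cmod z = 1 \<Longrightarrow> exp (p * Re (poly Q z)) \<le> 2 * (cmod (h z) powr p + 1)"
proof -
  define f where "f z = (ln (cmod (h z) powr p + 1) + ln 2 / 2) / p" for z
  have hc: "continuous_on (cball 0 1) h" using h by (rule holomorphic_on_imp_continuous_on)
  have pos: "cmod (h z) powr p + 1 > 0" for z by (simp add: add_nonneg_pos)
  have "continuous_on (sphere 0 1) f"
    unfolding f_def using p pos[THEN less_imp_neq]
    by (intro continuous_intros continuous_on_subset[OF hc] continuous_on_powr') (auto simp: add_nonneg_eq_0_iff)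
  moreover have "0 < ln 2 / (2*p)" using p by simp
  ultimately obtain Q where Q: "\<And>z. cmod z = 1 \<Longrightarrow> \<bar>f z - Re (poly Q z)\<bar> < ln 2 / (2*p)"
    using trigonometric_approximation by blast
  have bounds: "ln (cmod (h z) powr p + 1) < p * Re (poly Q z)"
    "p * Re (poly Q z) < ln (cmod (h z) powr p + 1) + ln 2" if "cmod z = 1" for z
  proof -
    have "\<bar>p * f z - p * Re (poly Q z)\<bar> = p * \<bar>f z - Re (poly Q z)\<bar>"
      using p by (simp add: abs_mult flip: right_diff_distrib)
    also have "\<dots> < p * (ln 2 / (2*p))" using Q[OF that] p by (intro mult_strict_left_mono)
    also have "\<dots> = ln 2 / 2" using p by simp
    finally have "\<bar>p * f z - p * Re (poly Q z)\<bar> < ln 2 / 2" .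
    moreover have "p * f z = ln (cmod (h z) powr p + 1) + ln 2 / 2" using p by (simp add: f_def)
    ultimately show "ln (cmod (h z) powr p + 1) < p * Re (poly Q z)"
      "p * Re (poly Q z) < ln (cmod (h z) powr p + 1) + ln 2" by linarith+
  qed
  have upper: "exp (p * Re (poly Q z)) \<le> 2 * (cmod (h z) powr p + 1)" if "cmod z = 1" for z
  proof -
    have "exp (p * Re (poly Q z)) \<le> exp (ln (cmod (h z) powr p + 1) + ln 2)"
      using bounds(2)[OF that] by simp
    also have "\<dots> = 2 * (cmod (h z) powr p + 1)" using pos[of z] by (simp add: exp_add)
    finally show ?thesis .
  qed
  have lower: "cmod (h z) \<le> exp (Re (poly Q z))" if "cmod z = 1" for z
  proof -
    have "cmod (h z) powr p + 1 = exp (ln (cmod (h z) powr p + 1))" using pos[of z] by simp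
    also have "\<dots> < exp (p * Re (poly Q z))" using bounds(1)[OF that] by simp
    finally have "cmod (h z) powr p < exp (p * Re (poly Q z))" by simp
    also have "\<dots> = exp (Re (poly Q z)) powr p" by (simp add: powr_def)
    finally have "\<not> exp (Re (poly Q z)) powr p \<le> cmod (h z) powr p" by simp
    then show ?thesis using p powr_mono2[of p "exp (Re (poly Q z))" "cmod (h z)"] by fastforce
  qed
  have "cmod (h z / exp (poly Q z)) \<le> 1" if z: "z \<in> cball 0 1" for z
  proof (rule maximum_modulus_frontier[of "\<lambda>z. h z / exp (poly Q z)" "cball 0 1"])
    show "(\<lambda>z. h z / exp (poly Q z)) holomorphic_on interior (cball 0 1)"
      by (intro holomorphic_intros holomorphic_on_subset[OF h]) auto
    show "continuous_on (closure (cball 0 1)) (\<lambda>z. h z / exp (poly Q z))"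
      using hc by (auto intro!: continuous_intros)
    show "cmod (h z / exp (poly Q z)) \<le> 1" if "z \<in> frontier (cball 0 1)" for z
      using lower[of z] that by (simp add: norm_divide)
  qed (use z in auto)
  then have "cmod (h z) \<le> exp (Re (poly Q z))" if "cmod z \<le> 1" for z
    using that by (simp add: norm_divide)
  then show ?thesis using upper that by blast
qed

lemma square_mean_mono_radius:
  assumes u: "u holomorphic_on ball 0 R" and r: "0 \<le> r" "r \<le> r'" "r' < R"
  shows "square_mean u r \<le> square_mean u r'"
proof -
  define a where "a n = (deriv ^^ n) u 0 / fact n" for n
  have ps: "(\<lambda>n. a n * z ^ n) sums u z" if "cmod z < R" for z
    using holomorphic_power_series[OF u, of z] that by (simp add: a_def)
  have 1: "(\<lambda>n. 2 * pi * (cmod (a n))\<^sup>2 * r ^ (2*n)) sums square_mean u r"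
    by (rule parseval[OF ps]) (use r in auto)
  have 2: "(\<lambda>n. 2 * pi * (cmod (a n))\<^sup>2 * r' ^ (2*n)) sums square_mean u r'"
    by (rule parseval[OF ps]) (use r in auto)
  show ?thesis
    by (rule sums_le[OF _ 1 2]) (use r in \<open>auto intro!: mult_left_mono power_mono\<close>)
qed

lemma square_mean_nonneg: "0 \<le> square_mean u r"
  unfolding square_mean_def
  by (cases "(\<lambda>\<theta>. (cmod (u (of_real r * cis \<theta>)))\<^sup>2) integrable_on {0..2*pi}")
    (auto intro: Henstock_Kurzweil_Integration.integral_nonneg simp: not_integrable_integral)

text \<open>The Poisson majorant on the circle of radius \<open>(1 + \<rho>)/2\<close>: bounded square means imply local
boundedness, as required by Montel's theorem.\<close>

lemma square_mean_point_bound: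
  assumes u: "u holomorphic_on disk" and M: "\<And>r. 0 \<le> r \<Longrightarrow> r < 1 \<Longrightarrow> square_mean u r \<le> M"
    and \<rho>: "0 \<le> \<rho>" "\<rho> < 1" and z: "cmod z \<le> \<rho>"
  shows "(cmod (u z))\<^sup>2 \<le> M / (1 - 2 * \<rho> / (1 + \<rho>))\<^sup>2"
proof -
  define R where "R = (1 + \<rho>) / 2"
  define s where "s = \<rho> / R"
  have R: "0 < R" "R < 1" and s: "0 \<le> s" "s < 1" using \<rho> by (auto simp: R_def s_def field_simps)
  define v where "v \<zeta> = u (of_real R * \<zeta>)" for \<zeta>
  have v: "v holomorphic_on cball 0 1"
    unfolding v_def by (rule dilation_holomorphic[OF u]) (use R in auto)
  define \<zeta> where "\<zeta> = z / of_real R"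
  have \<zeta>: "cmod \<zeta> \<le> s" using z R by (simp add: \<zeta>_def s_def norm_divide divide_right_mono)
  then have \<zeta>1: "cmod \<zeta> < 1" using s by linarith
  have "u z = v \<zeta>" using R by (simp add: v_def \<zeta>_def)
  then have "(cmod (u z))\<^sup>2 \<le> 1 / (2*pi) * integral {0..2*pi}
     (\<lambda>t. (cmod (v (cis t)))\<^sup>2 * poisson_kernel \<zeta> (cis t))"
    using poisson_majorant_origin[OF v \<zeta>1] by simp
  also have "\<dots> \<le> 1 / (2*pi) * integral {0..2*pi} (\<lambda>t. (cmod (v (cis t)))\<^sup>2 * (1 / (1 - s)\<^sup>2))"
  proof (rule mult_left_mono, rule integral_le)
    have vc: "continuous_on {0..2*pi} (\<lambda>t. v (of_real 1 * cis t))"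
      by (rule continuous_on_circle) (use v holomorphic_on_imp_continuous_on in auto)
    have ne: "cis t \<noteq> \<zeta>" for t using \<zeta>1 by auto
    show "(\<lambda>t. (cmod (v (cis t)))\<^sup>2 * poisson_kernel \<zeta> (cis t)) integrable_on {0..2*pi}"
      using vc ne unfolding poisson_kernel_def by (intro integrable_continuous_real continuous_intros) auto
    show "(\<lambda>t. (cmod (v (cis t)))\<^sup>2 * (1 / (1 - s)\<^sup>2)) integrable_on {0..2*pi}"
      using vc by (intro integrable_continuous_real continuous_intros) (use s in auto)
    fix t
    have "1 - s \<le> cmod (cis t - \<zeta>)" using norm_triangle_ineq2[of "cis t" \<zeta>] \<zeta> by simp
    then have "(1 - s)\<^sup>2 \<le> (cmod (cis t - \<zeta>))\<^sup>2" using s by (intro power_mono) auto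
    then have "poisson_kernel \<zeta> (cis t) \<le> 1 / (1 - s)\<^sup>2"
      using s \<zeta>1 unfolding poisson_kernel_def by (intro frac_le) (auto simp: abs_square_le_1)
    then show "(cmod (v (cis t)))\<^sup>2 * poisson_kernel \<zeta> (cis t) \<le> (cmod (v (cis t)))\<^sup>2 * (1 / (1 - s)\<^sup>2)"
      by (intro mult_left_mono) auto
  qed auto
  also have "integral {0..2*pi} (\<lambda>t. (cmod (v (cis t)))\<^sup>2 * (1 / (1 - s)\<^sup>2)) = square_mean u R * (1 / (1 - s)\<^sup>2)"
    unfolding square_mean_def v_def by (rule integral_mult_left)
  also have "1 / (2*pi) * (square_mean u R * (1 / (1 - s)\<^sup>2)) \<le> 1 * (M * (1 / (1 - s)\<^sup>2))"
  proof (intro mult_mono)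
    show "square_mean u R \<le> M" using M R by simp
    have sq: "0 \<le> square_mean u R" by (rule square_mean_nonneg)
    then show "0 \<le> M" using \<open>square_mean u R \<le> M\<close> by linarith
    show "0 \<le> square_mean u R * (1 / (1 - s)\<^sup>2)" using sq by simp
  qed (use pi_gt3 in auto)
  also have "1 * (M * (1 / (1 - s)\<^sup>2)) = M / (1 - 2 * \<rho> / (1 + \<rho>))\<^sup>2"
    by (simp add: s_def R_def mult.commute)
  finally show ?thesis .
qed

lemma hardy2_normal_family:
  assumes u: "\<And>n::nat. u n holomorphic_on disk"
    and M: "\<And>n r. 0 \<le> r \<Longrightarrow> r < 1 \<Longrightarrow> square_mean (u n) r \<le> M"
  obtains v \<sigma> where "strict_mono (\<sigma> :: nat \<Rightarrow> nat)" "hardy2 v"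
    "\<And>z. z \<in> disk \<Longrightarrow> (\<lambda>n. u (\<sigma> n) z) \<longlonglongrightarrow> v z"
proof -
  define b where "b \<rho> = sqrt (M / (1 - 2 * \<rho> / (1 + \<rho>))\<^sup>2)" for \<rho>
  have b: "cmod (u n z) \<le> b \<rho>" if "0 \<le> \<rho>" "\<rho> < 1" "cmod z \<le> \<rho>" for n z \<rho>
    unfolding b_def by (rule real_le_rsqrt, rule square_mean_point_bound[OF u M that])
  obtain v \<sigma> where v: "v holomorphic_on disk" "strict_mono (\<sigma> :: nat \<Rightarrow> nat)"
    "\<And>x. x \<in> disk \<Longrightarrow> (\<lambda>n. u (\<sigma> n) x) \<longlonglongrightarrow> v x"
  proof (rule Montel[of disk "range u" u])
    show "\<exists>B. \<forall>h\<in>range u. \<forall>z\<in>K. cmod (h z) \<le> B" if K: "compact K" "K \<subseteq> disk" for K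
    proof (cases "K = {}")
      case False
      obtain z0 where z0: "z0 \<in> K" "\<And>z. z \<in> K \<Longrightarrow> cmod z \<le> cmod z0"
        using continuous_attains_sup[OF K(1) False, of cmod] by (auto intro: continuous_intros)
      then have "cmod z0 < 1" using K(2) by auto
      then show ?thesis using b[of "cmod z0"] z0(2) by (intro exI[of _ "b (cmod z0)"]) auto
    qed auto
  qed (use u in auto)
  have "square_mean v r \<le> M" if r: "0 \<le> r" "r < 1" for r
  proof (rule LIMSEQ_le_const2)
    show "\<exists>N. \<forall>n\<ge>N. square_mean (u (\<sigma> n)) r \<le> M" using M[OF r] by blast
    show "(\<lambda>n. square_mean (u (\<sigma> n)) r) \<longlonglongrightarrow> square_mean v r"
      unfolding square_mean_def
    proof (rule dominated_convergence(2)[where h = "\<lambda>_. (b r)\<^sup>2"])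
      show "(\<lambda>t. (cmod (u (\<sigma> k) (of_real r * cis t)))\<^sup>2) integrable_on {0..2*pi}" for k
        using r by (intro integrable_continuous_real continuous_intros continuous_on_circle
            holomorphic_on_imp_continuous_on holomorphic_on_subset[OF u]) auto
      show "norm ((cmod (u (\<sigma> k) (of_real r * cis x)))\<^sup>2) \<le> (b r)\<^sup>2" for k x
        using power_mono[OF b[OF r, of "of_real r * cis x" "\<sigma> k"], of 2] r by (simp add: norm_mult)
      show "(\<lambda>k. (cmod (u (\<sigma> k) (of_real r * cis x)))\<^sup>2) \<longlonglongrightarrow> (cmod (v (of_real r * cis x)))\<^sup>2" for x
        using r by (intro tendsto_intros v(3)) (simp add: norm_mult)
    qed auto
  qed
  then have "hardy2 v" using v(1) unfolding hardy2_def by blast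
  then show ?thesis using that v by blast
qed

lemma square_mean_le_integral:
  assumes u: "continuous_on (sphere 0 1) u" and w: "continuous_on {0..2*pi} w"
    and le: "\<And>t. (cmod (u (cis t)))\<^sup>2 \<le> w t"
  shows "square_mean u 1 \<le> integral {0..2*pi} w"
  unfolding square_mean_def
proof (rule integral_le)
  have "continuous_on {0..2*pi} (\<lambda>t. u (of_real 1 * cis t))"
    by (rule continuous_on_compose2[OF u]) (auto intro!: continuous_intros)
  then show "(\<lambda>t. (cmod (u (of_real 1 * cis t)))\<^sup>2) integrable_on {0..2*pi}"
    by (intro integrable_continuous_real continuous_intros)
qed (use le integrable_continuous_real[OF w] in auto)

definition power_mean :: "real \<Rightarrow> (complex \<Rightarrow> complex) \<Rightarrow> real \<Rightarrow> real"
  where "power_mean p h r = integral {0..2*pi} (\<lambda>t. cmod (h (of_real r * cis t)) powr p)"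

text \<open>On each smaller disk the three factors come from one function \<open>exp Q\<close> without zeros, so roots and powers of
it are holomorphic. Their square means on the boundary circle are bounded by the \<open>p\<close>-means of
\<open>h\<close>: for \<open>k\<close> because \<open>|k|\<^sup>2 = |exp Q|\<^sup>p\<close>, for \<open>G\<close> because \<open>2/m \<le> p\<close>. Both relations survive a
locally uniform limit, and no control of the zeros in the limit is needed.\<close>

theorem hardy_factorization:
  fixes h :: "complex \<Rightarrow> complex"
  assumes h: "h holomorphic_on disk" and p: "0 < p"
    and C: "\<And>r. 0 < r \<Longrightarrow> r < 1 \<Longrightarrow> power_mean p h r \<le> C"
  obtains B G k m where "hardy2 B" "hardy2 G" "hardy2 k"
    "\<And>z. z \<in> disk \<Longrightarrow> h z = B z * G z ^ m" "\<And>z. z \<in> disk \<Longrightarrow> cmod (h z) powr p \<le> (cmod (k z))\<^sup>2"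
proof -
  \<comment> \<open>The exponent of \<open>G\<close> is taken so large that \<open>2/m \<le> p\<close>.\<close>
  obtain m :: nat where m2: "2 / p < real m" using reals_Archimedean2 by blast
  then have "0 < real m" using p by (meson divide_pos_pos less_trans zero_less_numeral)
  then have m: "m > 0" "2 / real m \<le> p" using p m2 by (auto simp: field_simps)
  \<comment> \<open>The index is shifted by one to exclude the radius \<open>0\<close>.\<close>
  define R where "R n = 1 - inverse (real (Suc (Suc n)))" for n
  have R: "0 < R n" "R n < 1" for n by (auto simp: R_def field_simps)
  have Rlim: "R \<longlonglongrightarrow> 1"
    unfolding R_def using approaching_radii(3) by (rule LIMSEQ_Suc)
  define H where "H n z = h (of_real (R n) * z)" for n z
  have Hhol: "H n holomorphic_on cball 0 1" for n
    unfolding H_def by (rule dilation_holomorphic[OF h]) (use R[of n] in auto)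
  have "\<forall>n. \<exists>Q. (\<forall>z. cmod z \<le> 1 \<longrightarrow> cmod (H n z) \<le> exp (Re (poly Q z))) \<and>
    (\<forall>z. cmod z = 1 \<longrightarrow> exp (p * Re (poly Q z)) \<le> 2 * (cmod (H n z) powr p + 1))"
    using outer_majorant[OF Hhol p] by metis
  from choice[OF this] obtain Q where Q: "\<And>n z. cmod z \<le> 1 \<Longrightarrow> cmod (H n z) \<le> exp (Re (poly (Q n) z))"
    "\<And>n z. cmod z = 1 \<Longrightarrow> exp (p * Re (poly (Q n) z)) \<le> 2 * (cmod (H n z) powr p + 1)"
    by blast
  define Bn where "Bn n z = H n z / exp (poly (Q n) z)" for n z
  define Gn where "Gn n z = exp (poly (Q n) z / of_nat m)" for n z
  define kn where "kn n z = exp (of_real (p/2) * poly (Q n) z)" for n z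
  define M where "M = 2 * C + 6 * pi"
  have Ble: "cmod (Bn n z) \<le> 1" if "cmod z \<le> 1" for n z
    using Q(1)[OF that, of n] by (simp add: Bn_def norm_divide)
  have Bhol: "Bn n holomorphic_on disk" for n
    unfolding Bn_def by (intro holomorphic_intros holomorphic_on_subset[OF Hhol]) auto
  have Ghol: "Gn n holomorphic_on UNIV" for n
    unfolding Gn_def using m by (intro holomorphic_intros) auto
  have khol: "kn n holomorphic_on UNIV" for n
    unfolding kn_def by (intro holomorphic_intros)
  have Bsq: "square_mean (Bn n) r \<le> 2 * pi" if r: "0 \<le> r" "r < 1" for n r
  proof -
    have "square_mean (Bn n) r \<le> integral {0..2*pi} (\<lambda>_. 1)"
      unfolding square_mean_def
    proof (rule integral_le)
      show "(\<lambda>t. (cmod (Bn n (of_real r * cis t)))\<^sup>2) integrable_on {0..2*pi}"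
        using r by (intro integrable_continuous_real continuous_intros continuous_on_circle
            holomorphic_on_imp_continuous_on holomorphic_on_subset[OF Bhol]) auto
      show "(cmod (Bn n (of_real r * cis x)))\<^sup>2 \<le> 1" for x
        using Ble[of "of_real r * cis x" n] r by (simp add: norm_mult power_le_one)
    qed auto
    then show ?thesis by simp
  qed
  define w where "w n t = 2 * cmod (h (of_real (R n) * cis t)) powr p + 3" for n t
  have hpc: "continuous_on {0..2*pi} (\<lambda>t. cmod (h (of_real (R n) * cis t)) powr p)" for n
    using p R[of n]
    by (intro continuous_on_powr' continuous_intros continuous_on_circle
        holomorphic_on_imp_continuous_on holomorphic_on_subset[OF h]) auto
  have wc: "continuous_on {0..2*pi} (w n)" for n
    unfolding w_def by (intro continuous_intros hpc)
  have wM: "integral {0..2*pi} (w n) \<le> M" for n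
  proof -
    have "integral {0..2*pi} (w n) = 2 * integral {0..2*pi} (\<lambda>t. cmod (h (of_real (R n) * cis t)) powr p) + 6 * pi"
      unfolding w_def using integrable_continuous_real[OF hpc[of n]]
      by (subst integral_add) (auto intro!: integrable_on_mult_right)
    then show ?thesis using C[OF R, of n] by (simp add: M_def power_mean_def)
  qed
  have expb: "exp (p * Re (poly (Q n) (cis t))) + 1 \<le> w n t" for n t
    using Q(2)[of "cis t" n] by (simp add: w_def H_def)
  have k1: "square_mean (kn n) 1 \<le> M" for n
  proof (rule order_trans[OF square_mean_le_integral[OF _ wc] wM])
    show "continuous_on (sphere 0 1) (kn n)"
      by (intro holomorphic_on_imp_continuous_on holomorphic_on_subset[OF khol]) auto
    fix t
    have "(cmod (kn n (cis t)))\<^sup>2 = exp (p * Re (poly (Q n) (cis t)))"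
      by (simp add: kn_def flip: exp_double)
    then show "(cmod (kn n (cis t)))\<^sup>2 \<le> w n t" using expb[of n t] by simp
  qed
  have G1: "square_mean (Gn n) 1 \<le> M" for n
  proof (rule order_trans[OF square_mean_le_integral[OF _ wc] wM])
    show "continuous_on (sphere 0 1) (Gn n)"
      by (intro holomorphic_on_imp_continuous_on holomorphic_on_subset[OF Ghol]) auto
    fix t
    have "(cmod (Gn n (cis t)))\<^sup>2 = exp (2 / real m * Re (poly (Q n) (cis t)))"
      by (simp add: Gn_def flip: exp_double)
    also have "\<dots> \<le> exp (p * Re (poly (Q n) (cis t))) + 1"
    proof (cases "0 \<le> Re (poly (Q n) (cis t))")
      case True
      then have "2 / real m * Re (poly (Q n) (cis t)) \<le> p * Re (poly (Q n) (cis t))"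
        using m(2) by (rule mult_right_mono[rotated])
      then have "exp (2 / real m * Re (poly (Q n) (cis t))) \<le> exp (p * Re (poly (Q n) (cis t)))" by simp
      then show ?thesis by linarith
    next
      case False
      then have "2 / real m * Re (poly (Q n) (cis t)) \<le> 0" by (intro mult_nonneg_nonpos) auto
      then have "exp (2 / real m * Re (poly (Q n) (cis t))) \<le> 1" by simp
      then show ?thesis by (simp add: add_increasing)
    qed
    finally show "(cmod (Gn n (cis t)))\<^sup>2 \<le> w n t" using expb[of n t] by simp
  qed
  have ksq: "square_mean (kn n) r \<le> M" and Gsq: "square_mean (Gn n) r \<le> M" if r: "0 \<le> r" "r < 1" for n r
    using square_mean_mono_radius[OF holomorphic_on_subset[OF khol subset_UNIV], of r 1 2 n]
      square_mean_mono_radius[OF holomorphic_on_subset[OF Ghol subset_UNIV], of r 1 2 n] k1[of n] G1[of n] r by auto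
  obtain B \<sigma>1 where B: "strict_mono \<sigma>1" "hardy2 B" "\<And>z. z \<in> disk \<Longrightarrow> (\<lambda>n. Bn (\<sigma>1 n) z) \<longlonglongrightarrow> B z"
    using hardy2_normal_family[of Bn, OF Bhol Bsq] by blast
  obtain G \<sigma>2 where G: "strict_mono \<sigma>2" "hardy2 G" "\<And>z. z \<in> disk \<Longrightarrow> (\<lambda>n. Gn (\<sigma>1 (\<sigma>2 n)) z) \<longlonglongrightarrow> G z"
    using hardy2_normal_family[of "\<lambda>n. Gn (\<sigma>1 n)", OF holomorphic_on_subset[OF Ghol subset_UNIV] Gsq] by blast
  obtain k \<sigma>3 where k: "strict_mono \<sigma>3" "hardy2 k" "\<And>z. z \<in> disk \<Longrightarrow> (\<lambda>n. kn (\<sigma>1 (\<sigma>2 (\<sigma>3 n))) z) \<longlonglongrightarrow> k z"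
    using hardy2_normal_family[of "\<lambda>n. kn (\<sigma>1 (\<sigma>2 n))", OF holomorphic_on_subset[OF khol subset_UNIV] ksq] by blast
  define \<sigma> where "\<sigma> n = \<sigma>1 (\<sigma>2 (\<sigma>3 n))" for n
  have sm: "strict_mono \<sigma>" using B(1) G(1) k(1) by (simp add: \<sigma>_def strict_mono_def)
  have lims: "(\<lambda>n. Bn (\<sigma> n) z) \<longlonglongrightarrow> B z" "(\<lambda>n. Gn (\<sigma> n) z) \<longlonglongrightarrow> G z" "(\<lambda>n. kn (\<sigma> n) z) \<longlonglongrightarrow> k z"
    "(\<lambda>n. H (\<sigma> n) z) \<longlonglongrightarrow> h z" if z: "z \<in> disk" for z
  proof -
    have "strict_mono (\<lambda>n. \<sigma>2 (\<sigma>3 n))" using G(1) k(1) by (simp add: strict_mono_def)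
    then show "(\<lambda>n. Bn (\<sigma> n) z) \<longlonglongrightarrow> B z"
      using LIMSEQ_subseq_LIMSEQ[OF B(3)[OF z]] unfolding \<sigma>_def comp_def by blast
    show "(\<lambda>n. Gn (\<sigma> n) z) \<longlonglongrightarrow> G z"
      using LIMSEQ_subseq_LIMSEQ[OF G(3)[OF z] k(1)] unfolding \<sigma>_def comp_def .
    show "(\<lambda>n. kn (\<sigma> n) z) \<longlonglongrightarrow> k z" using k(3)[OF z] unfolding \<sigma>_def .
    have "isCont h z"
      using h z by (meson continuous_on_eq_continuous_at holomorphic_on_imp_continuous_on open_ball)
    moreover have "(\<lambda>n. of_real (R (\<sigma> n)) * z) \<longlonglongrightarrow> of_real 1 * z"
      using LIMSEQ_subseq_LIMSEQ[OF Rlim sm] unfolding comp_def by (intro tendsto_intros)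
    ultimately show "(\<lambda>n. H (\<sigma> n) z) \<longlonglongrightarrow> h z"
      unfolding H_def by (intro isCont_tendsto_compose[of z h]) auto
  qed
  have "h z = B z * G z ^ m" if z: "z \<in> disk" for z
  proof (rule LIMSEQ_unique)
    show "(\<lambda>n. H (\<sigma> n) z) \<longlonglongrightarrow> h z" by (rule lims(4)[OF z])
    have "H n z = Bn n z * Gn n z ^ m" for n
      using m by (simp add: Bn_def Gn_def flip: exp_of_nat_mult)
    then show "(\<lambda>n. H (\<sigma> n) z) \<longlonglongrightarrow> B z * G z ^ m"
      using lims(1,2)[OF z] by (auto intro!: tendsto_intros)
  qed
  moreover have "cmod (h z) powr p \<le> (cmod (k z))\<^sup>2" if z: "z \<in> disk" for z
  proof (rule LIMSEQ_le)
    show "(\<lambda>n. cmod (H (\<sigma> n) z) powr p) \<longlonglongrightarrow> cmod (h z) powr p"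
      using p by (intro tendsto_powr' tendsto_norm lims(4)[OF z] tendsto_const) auto
    show "(\<lambda>n. (cmod (kn (\<sigma> n) z))\<^sup>2) \<longlonglongrightarrow> (cmod (k z))\<^sup>2"
      by (intro tendsto_intros lims(3)[OF z])
    have "cmod (H n z) powr p \<le> (cmod (kn n z))\<^sup>2" for n
    proof -
      have "cmod (H n z) powr p \<le> exp (Re (poly (Q n) z)) powr p"
        using Q(1)[of z n] z p by (intro powr_mono2) auto
      also have "\<dots> = (cmod (kn n z))\<^sup>2"
        by (simp add: kn_def powr_def flip: exp_double)
      finally show ?thesis .
    qed
    then show "\<exists>N. \<forall>n\<ge>N. cmod (H (\<sigma> n) z) powr p \<le> (cmod (kn (\<sigma> n) z))\<^sup>2" by blast
  qed
  ultimately show ?thesis using that B(2) G(2) k(2) by blast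
qed

section \<open>Boundary values in \<open>H\<^sup>p\<close>\<close>

lemma radial_limit_eq:
  assumes "has_nontangential_limit h g"
  shows "AE t in circle_measure. radial_limit h (cis t) = g (cis t)"
  using assms unfolding has_nontangential_limit_def
proof eventually_elim
  case (elim t)
  have "(\<lambda>n. h (of_real (1 - inverse (real (Suc n))) * cis t)) \<longlonglongrightarrow> g (cis t)"
    by (rule has_nontangential_limit_radius[OF _ _ approaching_radii]) (use elim in auto)
  then show ?case unfolding radial_limit_def by (rule limI)
qed

lemma has_nontangential_limit_radial_limit:
  assumes "has_nontangential_limit h g"
  shows "has_nontangential_limit h (radial_limit h)"
  using radial_limit_eq[OF assms] assms
  unfolding has_nontangential_limit_def by eventually_elim simp

lemma tendsto_within_stolz_cong:
  assumes "\<And>z. z \<in> disk \<Longrightarrow> f z = g z" "(g \<longlongrightarrow> L) (at \<zeta> within stolz_region \<alpha> \<zeta>)"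
  shows "(f \<longlongrightarrow> L) (at \<zeta> within stolz_region \<alpha> \<zeta>)"
proof (rule Lim_transform_eventually[OF assms(2)])
  show "\<forall>\<^sub>F z in at \<zeta> within stolz_region \<alpha> \<zeta>. g z = f z"
    unfolding eventually_at_filter using assms(1) by (auto simp: stolz_region_def)
qed

text \<open>The limits of \<open>B\<close> and \<open>G\<close> exist simultaneously at almost every point, hence so does that of \<open>h = B G\<^sup>m\<close>.\<close>

theorem hardy_boundary_values:
  fixes h :: "complex \<Rightarrow> complex"
  assumes h: "h holomorphic_on disk" and p: "0 < p"
    and C: "\<And>r. 0 < r \<Longrightarrow> r < 1 \<Longrightarrow> power_mean p h r \<le> C"
  obtains k where "has_nontangential_limit h (radial_limit h)" "hardy2 k"
    "\<And>z. z \<in> disk \<Longrightarrow> cmod (h z) powr p \<le> (cmod (k z))\<^sup>2"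
proof -
  obtain B G k m where H: "hardy2 B" "hardy2 G" "hardy2 k"
    "\<And>z. z \<in> disk \<Longrightarrow> h z = B z * G z ^ m" "\<And>z. z \<in> disk \<Longrightarrow> cmod (h z) powr p \<le> (cmod (k z))\<^sup>2"
    using hardy_factorization[OF h p C] by blast
  have "has_nontangential_limit h (\<lambda>\<zeta>. radial_limit B \<zeta> * radial_limit G \<zeta> ^ m)"
    using hardy2_nontangential_limit[OF H(1)] hardy2_nontangential_limit[OF H(2)]
    unfolding has_nontangential_limit_def
  proof eventually_elim
    case (elim t)
    show ?case
    proof (intro allI impI)
      fix \<alpha> :: real assume "1 < \<alpha>"
      then show "(h \<longlongrightarrow> radial_limit B (cis t) * radial_limit G (cis t) ^ m) (at (cis t) within stolz_region \<alpha> (cis t))"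
        using elim by (intro tendsto_within_stolz_cong[OF H(4)] tendsto_intros) auto
    qed
  qed
  then show ?thesis using that has_nontangential_limit_radial_limit H(3,5) by blast
qed

section \<open>Bicomplex Hardy functions\<close>

text \<open>Dominated convergence applied to \<open>min X Y\<close>, since \<open>X \<le> min X Y + Z\<close>.\<close>

lemma nn_integral_tendsto_0_perturbed:
  fixes X Z :: "nat \<Rightarrow> 'a \<Rightarrow> ennreal"
  assumes [measurable]: "\<And>n. X n \<in> borel_measurable M" "Y \<in> borel_measurable M" "\<And>n. Z n \<in> borel_measurable M"
    and X0: "AE x in M. (\<lambda>n. X n x) \<longlonglongrightarrow> 0"
    and le: "\<And>n. AE x in M. X n x \<le> Y x + Z n x"
    and Y: "(\<integral>\<^sup>+x. Y x \<partial>M) < \<infinity>" and Z: "(\<lambda>n. \<integral>\<^sup>+x. Z n x \<partial>M) \<longlonglongrightarrow> 0"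
  shows "(\<lambda>n. \<integral>\<^sup>+x. X n x \<partial>M) \<longlonglongrightarrow> 0"
proof -
  have "(\<lambda>n. \<integral>\<^sup>+x. min (X n x) (Y x) \<partial>M) \<longlonglongrightarrow> (\<integral>\<^sup>+x. 0 \<partial>M)"
  proof (rule nn_integral_dominated_convergence[where w = Y])
    show "AE x in M. (\<lambda>n. min (X n x) (Y x)) \<longlonglongrightarrow> 0"
      using X0
    proof eventually_elim
      case (elim x)
      show ?case
        by (rule tendsto_sandwich[OF _ _ tendsto_const elim]) auto
    qed
  qed (use Y in auto)
  then have "(\<lambda>n. (\<integral>\<^sup>+x. min (X n x) (Y x) \<partial>M) + (\<integral>\<^sup>+x. Z n x \<partial>M)) \<longlonglongrightarrow> 0 + 0"
    by (intro tendsto_add Z) simp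
  then have lim: "(\<lambda>n. (\<integral>\<^sup>+x. min (X n x) (Y x) \<partial>M) + (\<integral>\<^sup>+x. Z n x \<partial>M)) \<longlonglongrightarrow> 0" by simp
  have "(\<integral>\<^sup>+x. X n x \<partial>M) \<le> (\<integral>\<^sup>+x. min (X n x) (Y x) \<partial>M) + (\<integral>\<^sup>+x. Z n x \<partial>M)" for n
  proof -
    have "(\<integral>\<^sup>+x. X n x \<partial>M) \<le> (\<integral>\<^sup>+x. min (X n x) (Y x) + Z n x \<partial>M)"
      by (rule nn_integral_mono_AE, use le[of n] in eventually_elim) (auto simp: min_def)
    then show ?thesis by (simp add: nn_integral_add)
  qed
  then show ?thesis
    by (intro tendsto_sandwich[OF _ _ tendsto_const lim] always_eventually allI) auto
qed

lemma cmod_c_le_norm: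
  "cmod (c_plus w) \<le> 2 * norm w" "cmod (c_minus w) \<le> 2 * norm w"
proof -
  have "(cmod (c_plus w))\<^sup>2 + (cmod (c_minus w))\<^sup>2 = 2 * (norm w)\<^sup>2"
    by (simp add: norm_bicomplex_def)
  then have "(cmod (c_plus w))\<^sup>2 \<le> (2 * norm w)\<^sup>2" "(cmod (c_minus w))\<^sup>2 \<le> (2 * norm w)\<^sup>2"
    by (simp_all add: power_mult_distrib) (smt (verit) zero_le_power2)+
  then show "cmod (c_plus w) \<le> 2 * norm w" "cmod (c_minus w) \<le> 2 * norm w"
    by (meson power2_le_imp_le mult_nonneg_nonneg norm_ge_zero zero_le_numeral)+
qed

lemma norm_bicomplex_le: "norm w \<le> cmod (c_plus w) + cmod (c_minus w)"
  unfolding norm_bicomplex_def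
proof (rule real_le_lsqrt)
  have "((cmod (c_plus w))\<^sup>2 + (cmod (c_minus w))\<^sup>2) / 2 \<le> (cmod (c_plus w))\<^sup>2 + (cmod (c_minus w))\<^sup>2"
    by (simp add: field_simps)
  also have "\<dots> \<le> (cmod (c_plus w) + cmod (c_minus w))\<^sup>2" by (simp add: power2_sum)
  finally show "((cmod (c_plus w))\<^sup>2 + (cmod (c_minus w))\<^sup>2) / 2 \<le> (cmod (c_plus w) + cmod (c_minus w))\<^sup>2" .
qed auto

lemma tendsto_bicomplexI:
  assumes "((\<lambda>x. c_plus (f x)) \<longlongrightarrow> c_plus L) F" "((\<lambda>x. c_minus (f x)) \<longlongrightarrow> c_minus L) F"
  shows "(f \<longlongrightarrow> L) F"
proof (subst tendsto_norm_zero_iff[symmetric, of "\<lambda>x. f x - L" F, unfolded LIM_zero_iff], rule tendsto_sandwich[OF _ _ tendsto_const])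
  have "((\<lambda>x. cmod (c_plus (f x) - c_plus L) + cmod (c_minus (f x) - c_minus L)) \<longlongrightarrow> 0 + 0) F"
    by (intro tendsto_add tendsto_norm_zero LIM_zero assms)
  then show "((\<lambda>x. cmod (c_plus (f x) - c_plus L) + cmod (c_minus (f x) - c_minus L)) \<longlongrightarrow> 0) F" by simp
  show "\<forall>\<^sub>F x in F. norm (f x - L) \<le> cmod (c_plus (f x) - c_plus L) + cmod (c_minus (f x) - c_minus L)"
    using norm_bicomplex_le by (intro always_eventually allI) (metis c_plus_simps(4) c_minus_simps(4))
qed auto

lemma continuous_c_plus: "continuous_on S c_plus" and continuous_c_minus: "continuous_on S c_minus"
proof -
  have "continuous_on UNIV c_plus"
  proof (rule lipschitz_on_continuous_on)
    show "2-lipschitz_on UNIV c_plus"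
      using cmod_c_le_norm(1) by (intro lipschitz_onI) (auto simp: dist_norm simp flip: c_plus_simps)
  qed
  moreover have "continuous_on UNIV c_minus"
  proof (rule lipschitz_on_continuous_on)
    show "2-lipschitz_on UNIV c_minus"
      using cmod_c_le_norm(2) by (intro lipschitz_onI) (auto simp: dist_norm simp flip: c_minus_simps)
  qed
  ultimately show "continuous_on S c_plus" "continuous_on S c_minus"
    using continuous_on_subset by blast+
qed

definition of_idempotent :: "complex \<Rightarrow> complex \<Rightarrow> bicomplex"
  where "of_idempotent a b = p_plus * bc_of_complex a + p_minus * bc_of_complex b"

lemma of_idempotent_components [simp]: "c_plus (of_idempotent a b) = a" "c_minus (of_idempotent a b) = b"
  unfolding of_idempotent_def by (rule c_plus_idempotent c_minus_idempotent)+

lemma measurable_of_idempotent: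
  assumes "a \<in> borel_measurable M" "b \<in> borel_measurable M"
  shows "(\<lambda>x. of_idempotent (a x) (b x)) \<in> borel_measurable M"
proof -
  have "continuous_on UNIV (\<lambda>x. of_idempotent (fst x) (snd x))"
    unfolding continuous_on_def
    by (intro ballI tendsto_bicomplexI) (auto intro!: tendsto_intros)
  then have "(\<lambda>x. of_idempotent (fst x) (snd x)) \<in> borel_measurable borel"
    by (rule borel_measurable_continuous_onI)
  from measurable_compose[OF borel_measurable_Pair[OF assms] this] show ?thesis by simp
qed

text \<open>The first component is the conjugate of the Cauchy transform of the conjugate.\<close>

lemma T_bc_components_continuous:
  assumes q: "2 < q" and A: "A \<in> Lp_space (lebesgue_on disk) q"
  shows "continuous_on UNIV (\<lambda>z. c_plus (T_bc A z))" "continuous_on UNIV (\<lambda>z. c_minus (T_bc A z))"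
proof -
  have Am: "A \<in> borel_measurable (lebesgue_on disk)" and Aq: "integrable (lebesgue_on disk) (\<lambda>x. norm (A x) powr q)"
    using A by (auto simp: Lp_space_def)
  have Lq: "g \<in> Lp_space (lebesgue_on disk) q"
    if gm: "g \<in> borel_measurable (lebesgue_on disk)" and g: "\<And>x. cmod (g x) \<le> 2 * norm (A x)" for g :: "complex \<Rightarrow> complex"
  proof -
    have "integrable (lebesgue_on disk) (\<lambda>x. cmod (g x) powr q)"
    proof (rule Bochner_Integration.integrable_bound)
      show "integrable (lebesgue_on disk) (\<lambda>x. 2 powr q * norm (A x) powr q)"
        using Aq by (rule integrable_mult_right)
      show "(\<lambda>x. cmod (g x) powr q) \<in> borel_measurable (lebesgue_on disk)"
        using gm by measurable
      show "AE x in lebesgue_on disk. norm (cmod (g x) powr q) \<le> norm (2 powr q * norm (A x) powr q)"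
        using powr_mono2[OF _ norm_ge_zero g, of q] q by (intro AE_I2) (simp add: powr_mult)
    qed
    then show ?thesis using gm by (simp add: Lp_space_def)
  qed
  have "(\<lambda>x. c_minus (A x)) \<in> borel_measurable (lebesgue_on disk)"
    by (rule measurable_compose[OF Am borel_measurable_continuous_onI[OF continuous_c_minus]])
  then have "(\<lambda>x. c_minus (A x)) \<in> Lp_space (lebesgue_on disk) q"
    by (rule Lq) (rule cmod_c_le_norm)
  note minus = cauchy_transform_continuous[OF q this]
  show "continuous_on UNIV (\<lambda>z. c_minus (T_bc A z))"
    unfolding T_bc_def c_minus_idempotent by (intro continuous_intros minus)
  have "(\<lambda>x. c_plus (A x)) \<in> borel_measurable (lebesgue_on disk)"
    by (rule measurable_compose[OF Am borel_measurable_continuous_onI[OF continuous_c_plus]])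
  then have "(\<lambda>x. cnj (c_plus (A x))) \<in> borel_measurable (lebesgue_on disk)"
    by (rule measurable_compose) (intro borel_measurable_continuous_onI continuous_intros)
  then have "(\<lambda>x. cnj (c_plus (A x))) \<in> Lp_space (lebesgue_on disk) q"
    by (rule Lq) (simp add: cmod_c_le_norm)
  note plus = cauchy_transform_continuous[OF q this]
  have "(LINT \<zeta>|lebesgue_on disk. c_plus (A \<zeta>) / (cnj \<zeta> - cnj z))
     = cnj (LINT \<zeta>|lebesgue_on disk. cnj (c_plus (A \<zeta>)) / (\<zeta> - z))" for z
    by (subst Bochner_Integration.integral_cnj[symmetric]) simp
  then show "continuous_on UNIV (\<lambda>z. c_plus (T_bc A z))"
    unfolding T_bc_def c_plus_idempotent by (simp only:) (intro continuous_intros plus)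
qed

text \<open>The first component is annihilated by the \<open>z\<close>-derivative, so its conjugate is weakly holomorphic.\<close>

lemma Hol_bc_components_holomorphic:
  assumes "\<phi> \<in> Hol_bc"
  shows "(\<lambda>z. cnj (c_plus (\<phi> z))) holomorphic_on disk" "(\<lambda>z. c_minus (\<phi> z)) holomorphic_on disk"
proof -
  have c: "continuous_on disk \<phi>" and w: "weak_d_z (\<lambda>z. c_plus (\<phi> z)) (\<lambda>z. 0)" "weak_d_zbar (\<lambda>z. c_minus (\<phi> z)) (\<lambda>z. 0)"
    using assms by (auto simp: Hol_bc_def weak_dbar_def)
  show "(\<lambda>z. c_minus (\<phi> z)) holomorphic_on disk"
  proof (rule weyl_lemma)
    show "continuous_on disk (\<lambda>z. c_minus (\<phi> z))"
      by (rule continuous_on_compose2[OF continuous_c_minus c]) auto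
    show "(LINT z|lebesgue_on disk. c_minus (\<phi> z) * d_zbar (\<lambda>z. of_real (bump a e z)) z) = 0"
      if "0 < e" "cball a e \<subseteq> disk" for a e
      using w(2) bump_test_function[OF that] unfolding weak_d_zbar_def by simp
  qed
  show "(\<lambda>z. cnj (c_plus (\<phi> z))) holomorphic_on disk"
  proof (rule weyl_lemma)
    show "continuous_on disk (\<lambda>z. cnj (c_plus (\<phi> z)))"
      by (intro continuous_intros continuous_on_compose2[OF continuous_c_plus c]) auto
    show "(LINT z|lebesgue_on disk. cnj (c_plus (\<phi> z)) * d_zbar (\<lambda>z. of_real (bump a e z)) z) = 0"
      if "0 < e" "cball a e \<subseteq> disk" for a e
    proof -
      have "(LINT z|lebesgue_on disk. cnj (c_plus (\<phi> z)) * d_zbar (\<lambda>z. of_real (bump a e z)) z)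
        = (LINT z|lebesgue_on disk. cnj (c_plus (\<phi> z) * d_z (\<lambda>z. of_real (bump a e z)) z))"
        by (simp add: bump_d_zbar bump_d_z)
      also have "\<dots> = cnj (LINT z|lebesgue_on disk. c_plus (\<phi> z) * d_z (\<lambda>z. of_real (bump a e z)) z)"
        by (rule Bochner_Integration.integral_cnj)
      also have "\<dots> = 0"
        using w(1) bump_test_function[OF that] unfolding weak_d_z_def by simp
      finally show ?thesis .
    qed
  qed
qed

text \<open>The supremum in \<open>bounded_p_means\<close> is taken over extended integrals; for a continuous minorant it becomes a
bound on ordinary integrals.\<close>

lemma bounded_p_means_integral:
  fixes h :: "complex \<Rightarrow> complex" and f :: "complex \<Rightarrow> bicomplex"
  assumes f: "bounded_p_means p f" and h: "continuous_on disk h" and p: "0 < p" and K: "0 < K"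
    and le: "\<And>z. z \<in> disk \<Longrightarrow> cmod (h z) \<le> K * norm (f z)"
  obtains C where "\<And>r. 0 < r \<Longrightarrow> r < 1 \<Longrightarrow> power_mean p h r \<le> C"
proof -
  define S where "S = (SUP r\<in>{0<..<1}. \<integral>\<^sup>+t. ennreal (norm (f (of_real r * cis t)) powr p) \<partial>circle_measure)"
  have S: "S < \<infinity>" using f by (simp add: bounded_p_means_def S_def)
  have "power_mean p h r \<le> K powr p * enn2real S" if r: "0 < r" "r < 1" for r
  proof -
    have hc: "continuous_on {0..2*pi} (\<lambda>t. cmod (h (of_real r * cis t)) powr p / K powr p)"
      using p r K by (intro continuous_on_powr' continuous_intros continuous_on_circle continuous_on_subset[OF h]) auto
    have "ennreal (integral {0..2*pi} (\<lambda>t. cmod (h (of_real r * cis t)) powr p / K powr p))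
      = (\<integral>\<^sup>+t. ennreal (cmod (h (of_real r * cis t)) powr p / K powr p) \<partial>circle_measure)"
      by (rule nn_integral_lebesgue_on_continuous[OF hc, symmetric]) simp
    also have "\<dots> \<le> (\<integral>\<^sup>+t. ennreal (norm (f (of_real r * cis t)) powr p) \<partial>circle_measure)"
    proof (intro nn_integral_mono ennreal_leI)
      fix t
      have "cmod (h (of_real r * cis t)) powr p \<le> (K * norm (f (of_real r * cis t))) powr p"
        using r p by (intro powr_mono2 le) (auto simp: norm_mult)
      also have "\<dots> = norm (f (of_real r * cis t)) powr p * K powr p" using K by (simp add: powr_mult)
      finally show "cmod (h (of_real r * cis t)) powr p / K powr p \<le> norm (f (of_real r * cis t)) powr p"
        using K by (simp add: pos_divide_le_eq)
    qed
    also have "\<dots> \<le> S"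
      unfolding S_def using r by (intro SUP_upper) auto
    also have "\<dots> = ennreal (enn2real S)" using S by simp
    finally have "integral {0..2*pi} (\<lambda>t. cmod (h (of_real r * cis t)) powr p / K powr p) \<le> enn2real S" by simp
    then show ?thesis using K by (simp add: power_mean_def pos_divide_le_eq mult.commute)
  qed
  then show ?thesis using that by blast
qed

lemma exp_bounds_on_closed_disk:
  fixes g1 g2 :: "complex \<Rightarrow> complex"
  assumes "continuous_on UNIV g1" "continuous_on UNIV g2"
  obtains S where "1 \<le> S" "\<And>g z. g \<in> {g1, g2} \<Longrightarrow> cmod z \<le> 1 \<Longrightarrow> cmod (exp (g z)) \<le> S \<and> 1 \<le> S * cmod (exp (g z))"
proof -
  have "compact (g1 ` cball 0 1 \<union> g2 ` cball 0 1)"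
    by (intro compact_Un compact_continuous_image continuous_on_subset[OF assms(1)] continuous_on_subset[OF assms(2)]) auto
  then have "bounded (g1 ` cball 0 1 \<union> g2 ` cball 0 1)" by (rule compact_imp_bounded)
  then obtain R where "\<forall>x\<in>g1 ` cball 0 1 \<union> g2 ` cball 0 1. cmod x \<le> R"
    unfolding bounded_iff by blast
  then have R: "cmod (g z) \<le> R" if "g \<in> {g1, g2}" "cmod z \<le> 1" for g z using that by auto
  have "0 \<le> R" by (rule order_trans[OF norm_ge_zero R[of g1 0]]) simp_all
  then have "1 \<le> exp R" by simp
  moreover have "cmod (exp (g z)) \<le> exp R \<and> 1 \<le> exp R * cmod (exp (g z))" if "g \<in> {g1, g2}" "cmod z \<le> 1" for g z
  proof -
    have "Re (g z) \<le> R" "0 \<le> R + Re (g z)" using R[OF that] abs_Re_le_cmod[of "g z"] by linarith+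
    then show ?thesis by (simp flip: exp_add)
  qed
  ultimately show ?thesis by (rule that)
qed

lemma powr_add_le:
  fixes x y :: real
  assumes "0 \<le> x" "0 \<le> y" "0 < p"
  shows "(x + y) powr p \<le> 2 powr p * (x powr p + y powr p)"
proof -
  have "(x + y) powr p \<le> (2 * max x y) powr p" using assms by (intro powr_mono2) auto
  also have "\<dots> = 2 powr p * (max x y) powr p" using assms by (simp add: powr_mult)
  also have "(max x y) powr p \<le> x powr p + y powr p" by (auto simp: max_def)
  finally show ?thesis by simp
qed

lemma nontangential_bound_limit:
  assumes "has_nontangential_limit h (radial_limit h)" "hardy2 k" "0 < p"
    and le: "\<And>z. z \<in> disk \<Longrightarrow> cmod (h z) powr p \<le> (cmod (k z))\<^sup>2"
  shows "AE t in circle_measure. cmod (radial_limit h (cis t)) powr p \<le> (cmod (radial_limit k (cis t)))\<^sup>2"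
  using assms(1) hardy2_nontangential_limit[OF assms(2)] unfolding has_nontangential_limit_def
proof eventually_elim
  case (elim t)
  let ?z = "\<lambda>n. of_real (1 - inverse (real (Suc n))) * cis t"
  have h: "(\<lambda>n. h (?z n)) \<longlonglongrightarrow> radial_limit h (cis t)"
    by (rule has_nontangential_limit_radius[OF _ _ approaching_radii]) (use elim in auto)
  have k: "(\<lambda>n. k (?z n)) \<longlonglongrightarrow> radial_limit k (cis t)"
    by (rule has_nontangential_limit_radius[OF _ _ approaching_radii]) (use elim in auto)
  show ?case
  proof (rule LIMSEQ_le)
    show "(\<lambda>n. cmod (h (?z n)) powr p) \<longlonglongrightarrow> cmod (radial_limit h (cis t)) powr p"
      using assms(3) by (intro tendsto_powr' tendsto_norm h tendsto_const) auto
    show "(\<lambda>n. (cmod (k (?z n)))\<^sup>2) \<longlonglongrightarrow> (cmod (radial_limit k (cis t)))\<^sup>2"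
      by (intro tendsto_intros k)
    have "?z n \<in> disk" for n
      using radius_in_stolz_region[OF _ approaching_radii(1,2), of 2 "cis t" n] by (simp add: stolz_region_def)
    then show "\<exists>N. \<forall>n\<ge>N. cmod (h (?z n)) powr p \<le> (cmod (k (?z n)))\<^sup>2" using le by blast
  qed
qed

text \<open>Each component is a Hardy function or its conjugate, multiplied by a factor that is continuous and invertible on
the closed disk. The functions \<open>k\<^sub>1\<close>, \<open>k\<^sub>2\<close> in \<open>H\<^sup>2\<close> that dominate the components converge in the mean
square, which provides the domination for the \<open>p\<close>-th means.\<close>

theorem bicomplex_hardy_boundary_values:
  fixes f :: "complex \<Rightarrow> bicomplex" and h1 h2 g1 g2 :: "complex \<Rightarrow> complex"
  assumes p: "0 < p" and f: "bounded_p_means p f"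
    and h: "h1 holomorphic_on disk" "h2 holomorphic_on disk"
    and g: "continuous_on UNIV g1" "continuous_on UNIV g2"
    and fp: "\<And>z. z \<in> disk \<Longrightarrow> c_plus (f z) = cnj (h1 z) * exp (g1 z)"
    and fm: "\<And>z. z \<in> disk \<Longrightarrow> c_minus (f z) = h2 z * exp (g2 z)"
  shows "\<exists>f_nt. has_nontangential_limit f f_nt \<and> f_nt \<in> Lp_circle p \<and>
    ((\<lambda>r. \<integral>\<^sup>+t. ennreal (norm (f_nt (cis t) - f (of_real r * cis t)) powr p)
        \<partial>circle_measure) \<longlongrightarrow> 0) (at_left 1)"
proof -
  obtain S where S: "1 \<le> S" and gS: "\<And>g z. g \<in> {g1, g2} \<Longrightarrow> cmod z \<le> 1 \<Longrightarrow> cmod (exp (g z)) \<le> S \<and> 1 \<le> S * cmod (exp (g z))"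
    using exp_bounds_on_closed_disk[OF g] by blast
  have hc: "continuous_on disk h1" "continuous_on disk h2"
    using h by (auto intro: holomorphic_on_imp_continuous_on)
  have factor_le: "cmod x \<le> (S * 2) * norm v" if "cmod (x * exp (g z)) \<le> 2 * norm v" "g \<in> {g1, g2}" "z \<in> disk"
    for x g z and v :: bicomplex
  proof -
    have "cmod x * 1 \<le> cmod x * (S * cmod (exp (g z)))"
      using gS[OF that(2)] that(3) by (intro mult_left_mono) auto
    also have "\<dots> = S * cmod (x * exp (g z))" by (simp add: norm_mult)
    also have "\<dots> \<le> S * (2 * norm v)" using S that(1) by (intro mult_left_mono) auto
    finally show ?thesis by simp
  qed
  have hle: "cmod (h1 z) \<le> (S * 2) * norm (f z)" "cmod (h2 z) \<le> (S * 2) * norm (f z)" if z: "z \<in> disk" for z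
    using factor_le[of "cnj (h1 z)" g1 z "f z"] factor_le[of "h2 z" g2 z "f z"] cmod_c_le_norm[of "f z"] fp[OF z] fm[OF z] z
    by auto
  obtain C1 where C1: "\<And>r. 0 < r \<Longrightarrow> r < 1 \<Longrightarrow> power_mean p h1 r \<le> C1"
    using bounded_p_means_integral[OF f hc(1) p _ hle(1)] S by auto
  obtain C2 where C2: "\<And>r. 0 < r \<Longrightarrow> r < 1 \<Longrightarrow> power_mean p h2 r \<le> C2"
    using bounded_p_means_integral[OF f hc(2) p _ hle(2)] S by auto
  obtain k1 where k1: "has_nontangential_limit h1 (radial_limit h1)" "hardy2 k1"
    "\<And>z. z \<in> disk \<Longrightarrow> cmod (h1 z) powr p \<le> (cmod (k1 z))\<^sup>2"
    using hardy_boundary_values[OF h(1) p C1] by blast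
  obtain k2 where k2: "has_nontangential_limit h2 (radial_limit h2)" "hardy2 k2"
    "\<And>z. z \<in> disk \<Longrightarrow> cmod (h2 z) powr p \<le> (cmod (k2 z))\<^sup>2"
    using hardy_boundary_values[OF h(2) p C2] by blast
  define f_nt where "f_nt \<zeta> = of_idempotent (cnj (radial_limit h1 \<zeta>) * exp (g1 \<zeta>)) (radial_limit h2 \<zeta> * exp (g2 \<zeta>))" for \<zeta>
  have nt: "has_nontangential_limit f f_nt"
    using k1(1) k2(1) unfolding has_nontangential_limit_def
  proof eventually_elim
    case (elim t)
    show ?case
    proof (intro allI impI)
      fix \<alpha> :: real assume \<alpha>: "1 < \<alpha>"
      have "isCont g1 (cis t)" "isCont g2 (cis t)" using g by (simp_all add: continuous_on_eq_continuous_at)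
      then have gl: "(g1 \<longlongrightarrow> g1 (cis t)) (at (cis t) within stolz_region \<alpha> (cis t))"
        "(g2 \<longlongrightarrow> g2 (cis t)) (at (cis t) within stolz_region \<alpha> (cis t))"
        unfolding isCont_def by (auto intro: tendsto_within_subset)
      show "(f \<longlongrightarrow> f_nt (cis t)) (at (cis t) within stolz_region \<alpha> (cis t))"
      proof (rule tendsto_bicomplexI)
        show "((\<lambda>z. c_plus (f z)) \<longlongrightarrow> c_plus (f_nt (cis t))) (at (cis t) within stolz_region \<alpha> (cis t))"
          unfolding f_nt_def of_idempotent_components
          using elim(1) \<alpha> by (intro tendsto_within_stolz_cong[OF fp] tendsto_intros gl) auto
        show "((\<lambda>z. c_minus (f z)) \<longlongrightarrow> c_minus (f_nt (cis t))) (at (cis t) within stolz_region \<alpha> (cis t))"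
          unfolding f_nt_def of_idempotent_components
          using elim(2) \<alpha> by (intro tendsto_within_stolz_cong[OF fm] tendsto_intros gl) auto
      qed
    qed
  qed
  have norm_le: "norm v powr p \<le> (2 * S) powr p * (a powr p + b powr p)"
    if "cmod (c_plus v) \<le> a * S" "cmod (c_minus v) \<le> b * S" "0 \<le> a" "0 \<le> b" for v a b
  proof -
    have "norm v \<le> S * (a + b)" using norm_bicomplex_le[of v] that by (simp add: algebra_simps)
    then have "norm v powr p \<le> (S * (a + b)) powr p" using p by (intro powr_mono2) auto
    also have "\<dots> = S powr p * (a + b) powr p" using S that by (simp add: powr_mult)
    also have "\<dots> \<le> S powr p * (2 powr p * (a powr p + b powr p))"
      using that p by (intro mult_left_mono powr_add_le) auto
    also have "\<dots> = (2 * S) powr p * (a powr p + b powr p)" using S by (simp add: powr_mult)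
    finally show ?thesis .
  qed
  have comp_le: "cmod (x * exp (g1 z)) \<le> cmod x * S" "cmod (x * exp (g2 z)) \<le> cmod x * S" if "cmod z \<le> 1" for x z
    using gS[of g1 z] gS[of g2 z] that by (auto simp: norm_mult intro!: mult_left_mono)
  have f_le: "norm (f z) powr p \<le> (2 * S) powr p * ((cmod (k1 z))\<^sup>2 + (cmod (k2 z))\<^sup>2)" if z: "z \<in> disk" for z
  proof -
    have "cmod (c_plus (f z)) \<le> cmod (h1 z) * S" "cmod (c_minus (f z)) \<le> cmod (h2 z) * S"
      using comp_le[of z "cnj (h1 z)"] comp_le[of z "h2 z"] z unfolding fp[OF z] fm[OF z] by auto
    from norm_le[OF this] have "norm (f z) powr p \<le> (2 * S) powr p * (cmod (h1 z) powr p + cmod (h2 z) powr p)" by simp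
    also have "\<dots> \<le> (2 * S) powr p * ((cmod (k1 z))\<^sup>2 + (cmod (k2 z))\<^sup>2)"
      by (intro mult_left_mono add_mono k1 k2 z) auto
    finally show ?thesis .
  qed
  have "AE t in circle_measure. cmod (radial_limit h1 (cis t)) powr p \<le> (cmod (radial_limit k1 (cis t)))\<^sup>2"
    by (rule nontangential_bound_limit[OF k1(1,2) p]) (rule k1(3))
  moreover have "AE t in circle_measure. cmod (radial_limit h2 (cis t)) powr p \<le> (cmod (radial_limit k2 (cis t)))\<^sup>2"
    by (rule nontangential_bound_limit[OF k2(1,2) p]) (rule k2(3))
  ultimately have fnt_le: "AE t in circle_measure. norm (f_nt (cis t)) powr p
      \<le> (2 * S) powr p * ((cmod (radial_limit k1 (cis t)))\<^sup>2 + (cmod (radial_limit k2 (cis t)))\<^sup>2)"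
  proof eventually_elim
    case (elim t)
    have "cmod (c_plus (f_nt (cis t))) \<le> cmod (radial_limit h1 (cis t)) * S"
      "cmod (c_minus (f_nt (cis t))) \<le> cmod (radial_limit h2 (cis t)) * S"
      using comp_le[of "cis t" "cnj (radial_limit h1 (cis t))"] comp_le[of "cis t" "radial_limit h2 (cis t)"]
      by (auto simp: f_nt_def)
    from norm_le[OF this] have "norm (f_nt (cis t)) powr p
        \<le> (2 * S) powr p * (cmod (radial_limit h1 (cis t)) powr p + cmod (radial_limit h2 (cis t)) powr p)" by simp
    also have "\<dots> \<le> (2 * S) powr p * ((cmod (radial_limit k1 (cis t)))\<^sup>2 + (cmod (radial_limit k2 (cis t)))\<^sup>2)"
      by (intro mult_left_mono add_mono elim) auto
    finally show ?case .
  qed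
  have kc: "continuous_on disk k1" "continuous_on disk k2"
    using k1(2) k2(2) by (auto simp: hardy2_def holomorphic_on_imp_continuous_on)
  have gcis: "(\<lambda>t. exp (g (cis t))) \<in> borel_measurable circle_measure" if "continuous_on UNIV g" for g :: "complex \<Rightarrow> complex"
    by (rule continuous_imp_measurable_on_sets_lebesgue)
      (auto intro!: continuous_intros continuous_on_compose2[OF that])
  have fnt_meas: "(\<lambda>t. f_nt (cis t)) \<in> borel_measurable circle_measure"
    unfolding f_nt_def
  proof (intro measurable_of_idempotent borel_measurable_times gcis g measurable_radial_limit hc)
    show "(\<lambda>t. cnj (radial_limit h1 (cis t))) \<in> borel_measurable circle_measure"
      by (rule measurable_compose[OF measurable_radial_limit[OF hc(1)]])
        (intro borel_measurable_continuous_onI continuous_intros)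
  qed
  \<comment> \<open>The factors come from \<open>(x + y)\<^sup>p \<le> 2\<^sup>p (x\<^sup>p + y\<^sup>p)\<close>, used once for the difference and once for the
    two components, and from the bound \<open>S\<close> of the exponential factors.\<close>
  define D where "D = 2 powr p * (2 * S) powr p"
  have D: "D \<ge> 0" by (simp add: D_def)
  define e where "e k r t = ennreal ((cmod (radial_limit k (cis t) - k (of_real r * cis t)))\<^sup>2)" for k r t
  define Y where "Y t = ennreal (3 * D) * (ennreal ((cmod (radial_limit k1 (cis t)))\<^sup>2) + ennreal ((cmod (radial_limit k2 (cis t)))\<^sup>2))" for t
  define Z where "Z r t = ennreal (3 * D) * (e k1 r t + e k2 r t)" for r t
  note [measurable] = measurable_radial_limit[OF kc(1)] measurable_radial_limit[OF kc(2)] fnt_meas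
  have Ym[measurable]: "Y \<in> borel_measurable circle_measure" unfolding Y_def by measurable
  have Yfin: "(\<integral>\<^sup>+t. Y t \<partial>circle_measure) < \<infinity>"
    unfolding Y_def using hardy2_mean_convergence(2)[OF k1(2)] hardy2_mean_convergence(2)[OF k2(2)]
    by (simp add: nn_integral_cmult nn_integral_add ennreal_mult_less_top)
  have Lp: "f_nt \<in> Lp_circle p"
  proof -
    have "(\<integral>\<^sup>+t. ennreal (norm (f_nt (cis t)) powr p) \<partial>circle_measure) \<le> (\<integral>\<^sup>+t. Y t \<partial>circle_measure)"
    proof (rule nn_integral_mono_AE, use fnt_le in eventually_elim)
      case (elim t)
      have "1 \<le> 2 powr p" using p by (simp add: ge_one_powr_ge_zero)
      then have "(2 * S) powr p \<le> 3 * D"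
        unfolding D_def using mult_right_mono[of 1 "3 * 2 powr p" "(2 * S) powr p"] by simp
      then have "norm (f_nt (cis t)) powr p \<le> 3 * D * ((cmod (radial_limit k1 (cis t)))\<^sup>2 + (cmod (radial_limit k2 (cis t)))\<^sup>2)"
        by (intro order_trans[OF elim] mult_right_mono) auto
      then have "ennreal (norm (f_nt (cis t)) powr p) \<le> ennreal (3 * D * ((cmod (radial_limit k1 (cis t)))\<^sup>2 + (cmod (radial_limit k2 (cis t)))\<^sup>2))"
        by (rule ennreal_leI)
      also have "\<dots> = Y t" unfolding Y_def using D by (simp add: ennreal_mult ennreal_plus)
      finally show ?case .
    qed
    then have "(\<integral>\<^sup>+t. ennreal (norm (f_nt (cis t)) powr p) \<partial>circle_measure) < \<infinity>"
      using Yfin by (rule order.strict_trans1)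
    then have "integrable circle_measure (\<lambda>t. norm (f_nt (cis t)) powr p)"
      by (intro integrableI_nonneg) auto
    then show ?thesis using fnt_meas by (simp add: Lp_circle_def Lp_space_def)
  qed
  have conv: "(\<lambda>n. \<integral>\<^sup>+t. ennreal (norm (f_nt (cis t) - f (of_real (s n) * cis t)) powr p) \<partial>circle_measure) \<longlonglongrightarrow> 0"
    if s: "\<And>n. s n < 1" "\<And>n. 0 < s n" "s \<longlonglongrightarrow> 1" for s :: "nat \<Rightarrow> real"
  proof (rule nn_integral_tendsto_0_perturbed[where Y = Y and Z = "\<lambda>n. Z (s n)"])
    have s0: "0 \<le> s n" for n using s(2)[of n] by simp
    have "(\<lambda>t. of_idempotent (cnj (h1 (of_real (s n) * cis t)) * exp (g1 (of_real (s n) * cis t)))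
        (h2 (of_real (s n) * cis t) * exp (g2 (of_real (s n) * cis t)))) \<in> borel_measurable circle_measure" for n
    proof (intro measurable_of_idempotent measurable_on_circle[OF _ s0 s(1), of "\<lambda>z. cnj (h1 z) * exp (g1 z)"]
        measurable_on_circle[OF _ s0 s(1), of "\<lambda>z. h2 z * exp (g2 z)"])
      show "continuous_on disk (\<lambda>z. cnj (h1 z) * exp (g1 z))" "continuous_on disk (\<lambda>z. h2 z * exp (g2 z))"
        by (intro continuous_intros hc continuous_on_subset[OF g(1)] continuous_on_subset[OF g(2)]; simp)+
    qed
    moreover have "of_idempotent (cnj (h1 (of_real (s n) * cis t)) * exp (g1 (of_real (s n) * cis t)))
        (h2 (of_real (s n) * cis t) * exp (g2 (of_real (s n) * cis t))) = f (of_real (s n) * cis t)" for n t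
    proof -
      have "of_real (s n) * cis t \<in> disk" using s(1)[of n] s0[of n] by (simp add: norm_mult)
      then show ?thesis by (intro bicomplex_eqI) (simp_all add: fp fm)
    qed
    ultimately have fm': "(\<lambda>t. f (of_real (s n) * cis t)) \<in> borel_measurable circle_measure" for n by simp
    have diffm: "(\<lambda>t. f_nt (cis t) - f (of_real (s n) * cis t)) \<in> borel_measurable circle_measure" for n
    proof -
      have "(\<lambda>t. of_idempotent (c_plus (f_nt (cis t)) - c_plus (f (of_real (s n) * cis t)))
         (c_minus (f_nt (cis t)) - c_minus (f (of_real (s n) * cis t)))) \<in> borel_measurable circle_measure"
        by (intro measurable_of_idempotent borel_measurable_diff
            measurable_compose[OF fnt_meas borel_measurable_continuous_onI[OF continuous_c_plus]]
            measurable_compose[OF fnt_meas borel_measurable_continuous_onI[OF continuous_c_minus]]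
            measurable_compose[OF fm' borel_measurable_continuous_onI[OF continuous_c_plus]]
            measurable_compose[OF fm' borel_measurable_continuous_onI[OF continuous_c_minus]])
      moreover have "of_idempotent (c_plus v - c_plus u) (c_minus v - c_minus u) = v - u" for v u
        by (rule bicomplex_eqI) simp_all
      ultimately show ?thesis by simp
    qed
    show "(\<lambda>t. ennreal (norm (f_nt (cis t) - f (of_real (s n) * cis t)) powr p)) \<in> borel_measurable circle_measure" for n
      using diffm[of n] by measurable
    have em[measurable]: "e k1 (s n) \<in> borel_measurable circle_measure" "e k2 (s n) \<in> borel_measurable circle_measure" for n
      unfolding e_def using measurable_on_circle[OF kc(1) s0 s(1), of n] measurable_on_circle[OF kc(2) s0 s(1), of n]
      by measurable
    show "Z (s n) \<in> borel_measurable circle_measure" for n unfolding Z_def by measurable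
    show "AE t in circle_measure. (\<lambda>n. ennreal (norm (f_nt (cis t) - f (of_real (s n) * cis t)) powr p)) \<longlonglongrightarrow> 0"
      using nt unfolding has_nontangential_limit_def
    proof eventually_elim
      case (elim t)
      have "(\<lambda>n. f (of_real (s n) * cis t)) \<longlonglongrightarrow> f_nt (cis t)"
        by (rule has_nontangential_limit_radius[OF _ _ s0 s(1) s(3)]) (use elim in auto)
      then have "(\<lambda>n. norm (f_nt (cis t) - f (of_real (s n) * cis t))) \<longlonglongrightarrow> norm (f_nt (cis t) - f_nt (cis t))"
        by (intro tendsto_intros)
      then have "(\<lambda>n. norm (f_nt (cis t) - f (of_real (s n) * cis t)) powr p) \<longlonglongrightarrow> 0 powr p"
        using p by (intro tendsto_powr' tendsto_const) auto
      then have "(\<lambda>n. ennreal (norm (f_nt (cis t) - f (of_real (s n) * cis t)) powr p)) \<longlonglongrightarrow> ennreal 0"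
        by (intro tendsto_ennrealI) simp
      then show ?case by simp
    qed
    show "AE t in circle_measure. ennreal (norm (f_nt (cis t) - f (of_real (s n) * cis t)) powr p) \<le> Y t + Z (s n) t" for n
      using fnt_le
    proof eventually_elim
      case (elim t)
      define z where "z = of_real (s n) * cis t"
      have z: "z \<in> disk" using s(1)[of n] s0[of n] by (simp add: z_def norm_mult)
      define K1 K2 d1 d2 where "K1 = (cmod (radial_limit k1 (cis t)))\<^sup>2" and "K2 = (cmod (radial_limit k2 (cis t)))\<^sup>2"
        and "d1 = (cmod (radial_limit k1 (cis t) - k1 z))\<^sup>2" and "d2 = (cmod (radial_limit k2 (cis t) - k2 z))\<^sup>2"
      have pos: "0 \<le> K1" "0 \<le> K2" "0 \<le> d1" "0 \<le> d2" by (auto simp: K1_def K2_def d1_def d2_def)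
      have sq: "(cmod b)\<^sup>2 \<le> 2 * (cmod a)\<^sup>2 + 2 * (cmod (a - b))\<^sup>2" for a b :: complex
      proof -
        have "cmod b \<le> cmod a + cmod (a - b)" using norm_triangle_ineq4[of a "a - b"] by simp
        then have "(cmod b)\<^sup>2 \<le> (cmod a + cmod (a - b))\<^sup>2" by (intro power_mono) auto
        also have "\<dots> \<le> 2 * (cmod a)\<^sup>2 + 2 * (cmod (a - b))\<^sup>2"
          using zero_le_power2[of "cmod a - cmod (a - b)"] by (simp add: power2_eq_square algebra_simps)
        finally show ?thesis .
      qed
      have "norm (f_nt (cis t) - f z) powr p \<le> (norm (f_nt (cis t)) + norm (f z)) powr p"
        using p by (intro powr_mono2 norm_triangle_ineq4) auto
      also have "\<dots> \<le> 2 powr p * (norm (f_nt (cis t)) powr p + norm (f z) powr p)"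
        using p by (intro powr_add_le) auto
      also have "\<dots> \<le> 2 powr p * ((2 * S) powr p * (K1 + K2) + (2 * S) powr p * ((2 * K1 + 2 * d1) + (2 * K2 + 2 * d2)))"
      proof (intro mult_left_mono add_mono)
        show "norm (f_nt (cis t)) powr p \<le> (2 * S) powr p * (K1 + K2)" using elim by (simp add: K1_def K2_def)
        show "norm (f z) powr p \<le> (2 * S) powr p * ((2 * K1 + 2 * d1) + (2 * K2 + 2 * d2))"
          unfolding K1_def K2_def d1_def d2_def
          by (intro order_trans[OF f_le[OF z]] mult_left_mono add_mono sq) auto
      qed auto
      also have "\<dots> = D * (3 * (K1 + K2) + 2 * (d1 + d2))" by (simp add: D_def algebra_simps)
      also have "\<dots> \<le> D * (3 * (K1 + K2) + 3 * (d1 + d2))" using D pos by (intro mult_left_mono) auto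
      also have "\<dots> = 3 * D * (K1 + K2) + 3 * D * (d1 + d2)" by (simp add: algebra_simps)
      finally have "ennreal (norm (f_nt (cis t) - f z) powr p) \<le> ennreal (3 * D * (K1 + K2) + 3 * D * (d1 + d2))"
        by (rule ennreal_leI)
      also have "\<dots> = ennreal (3 * D) * (ennreal K1 + ennreal K2) + ennreal (3 * D) * (ennreal d1 + ennreal d2)"
        using D pos by (simp only: ennreal_plus ennreal_mult mult_nonneg_nonneg add_nonneg_nonneg zero_le_numeral)
      also have "\<dots> = Y t + Z (s n) t"
        by (simp only: Y_def Z_def e_def K1_def K2_def d1_def d2_def z_def)
      finally show ?case unfolding z_def .
    qed
    show "(\<lambda>n. \<integral>\<^sup>+t. Z (s n) t \<partial>circle_measure) \<longlonglongrightarrow> 0"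
    proof -
      have sl: "filterlim s (at_left 1) sequentially"
        using s(1,3) by (auto simp: filterlim_at intro!: always_eventually less_imp_neq)
      define I where "I k n = (\<integral>\<^sup>+t. e k (s n) t \<partial>circle_measure)" for k n
      have I: "I k1 \<longlonglongrightarrow> 0" "I k2 \<longlonglongrightarrow> 0"
        using filterlim_compose[OF hardy2_mean_convergence(1)[OF k1(2)] sl]
          filterlim_compose[OF hardy2_mean_convergence(1)[OF k2(2)] sl] unfolding I_def e_def by auto
      have "(\<integral>\<^sup>+t. Z (s n) t \<partial>circle_measure) = ennreal (3 * D) * (I k1 n + I k2 n)" for n
        unfolding Z_def I_def by (simp add: nn_integral_cmult nn_integral_add)
      moreover have "(\<lambda>n. ennreal (3 * D) * (I k1 n + I k2 n)) \<longlonglongrightarrow> ennreal (3 * D) * (0 + 0)"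
        by (intro ennreal_tendsto_cmult tendsto_add I) auto
      ultimately show ?thesis by simp
    qed
  qed (rule Ym, rule Yfin)
  have "((\<lambda>r. \<integral>\<^sup>+t. ennreal (norm (f_nt (cis t) - f (of_real r * cis t)) powr p) \<partial>circle_measure) \<longlongrightarrow> 0) (at_left 1)"
    by (rule tendsto_at_left_sequentially[of 0]) (auto intro: conv)
  then show ?thesis using nt Lp by blast
qed

theorem theorem4p12:
  fixes p q \<gamma> :: real
    and A f \<phi> :: "complex \<Rightarrow> bicomplex"
    and w :: "complex \<Rightarrow> complex"
  assumes "0 < p"
    and "2 < q"
    and "A \<in> Lp_space (lebesgue_on disk) q"
    and "f \<in> Hp_A p A"
    and "\<phi> \<in> Hol_bc"
    and "\<And>z. z \<in> disk \<Longrightarrow> f z = \<phi> z * bc_exp (T_bc A z)"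
    and "w \<in> Lp_space (lebesgue_on disk) \<gamma>"
    and "2 < \<gamma> \<or> (1 < \<gamma> \<and> \<gamma> \<le> 2 \<and> (\<gamma> = 2 \<or> p < \<gamma> / (2 - \<gamma>)))"
    and "(\<lambda>z. c_plus (\<phi> z)) \<in> Hp_w p w"
  shows "\<exists>f_nt. has_nontangential_limit f f_nt \<and> f_nt \<in> Lp_circle p \<and>
    ((\<lambda>r. \<integral>\<^sup>+\<theta>. ennreal (norm (f_nt (cis \<theta>) - f (of_real r * cis \<theta>)) powr p)
        \<partial>lebesgue_on {0..2*pi}) \<longlongrightarrow> 0) (at_left 1)"
proof (rule bicomplex_hardy_boundary_values[OF assms(1) _ Hol_bc_components_holomorphic[OF assms(5)]
      T_bc_components_continuous[OF assms(2,3)]])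
  show "bounded_p_means p f" using assms(4) by (simp add: Hp_A_def)
  show "c_plus (f z) = cnj (cnj (c_plus (\<phi> z))) * exp (c_plus (T_bc A z))" if "z \<in> disk" for z
    using assms(6)[OF that] by (simp add: bc_exp_def del: c_plus_simps(3) add: c_plus_simps(6) c_plus_idempotent)
  show "c_minus (f z) = c_minus (\<phi> z) * exp (c_minus (T_bc A z))" if "z \<in> disk" for z
    using assms(6)[OF that] by (simp add: bc_exp_def del: c_minus_simps(3) add: c_minus_simps(6) c_minus_idempotent)
qed

end
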